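(* Let $(M,g,\tau,P)$ be a Poisson-stationary Carrollian--Poisson bundle. Then the fundamental (Carroll) vector field $\kappa\in\ker(g)$ is locally Hamiltonian on any symplectic leaf $S$ of $(M,P)$ that is of non-zero dimension.
   Context: All manifolds are real, finite-dimensional, Hausdorff, second countable and smooth. $\mathrm{Vect}(M)$ denotes vector fields on $M$. A Carrollian bundle $(M,g,\tau)$ consists of a principal $\mathbb{R}$-bundle $\pi:M\to\Sigma$ (structure group $(\mathbb{R},+)$), with vertical bundle $\mathsf{V}M=\ker d\pi$ and vertical vector fields $\mathrm{Vect}_{\mathsf V}(M)$; a degenerate metric (symmetric 2-tensor) $g$ with $\ker(g)=\mathrm{Vect}_{\mathsf V}(M)$, not necessarily invariant under the action; and a clock form $\tau\in\Omega^1(M)$, i.e. an Ehresmann connection form (not necessarily principal nor flat), with horizontal vector fields $\mathrm{Vect}_{\mathsf H}(M)=\ker(\tau)$, so that $\mathrm{Vect}(M)=\mathrm{Vect}_{\mathsf V}(M)\oplus\mathrm{Vect}_{\mathsf H}(M)$. It is assumed that $g$ is positive on non-zero horizontal vectors. The Carroll vector field $\kappa$ is the fundamental vector field of the principal action, a nowhere vanishing frame of $\mathrm{Vect}_{\mathsf V}(M)$ normalised by $\tau(\kappa)=1$. A Poisson structure is a bivector field $P$ with vanishing Schouten--Nijenhuis bracket $[\![P,P]\!]=0$; its anchor is $P^\#:\Omega^1(M)\to\mathrm{Vect}(M)$, $P^\#(\alpha)=P(\alpha,-)$, so $\beta(P^\#(\alpha))=P(\alpha,\beta)$. A Carrollian--Poisson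 bundle $(M,g,\tau,P)$ is a Carrollian bundle $(M,g,\tau)$ with a Poisson structure $P$ such that $\ker_m(g)\subset\mathrm{Im}(P^\#_m)$ at every point $m\in M$ where the rank of $P^\#_m:T^*_mM\to T_mM$ is non-zero. It is Poisson-stationary if the principal $\mathbb{R}$-action is by Poisson maps, i.e. $P$ is equivariant (infinitesimally, $\mathcal{L}_\kappa P=0$). Symplectic leaves are the leaves of the (singular) foliation integrating $\mathrm{Im}(P^\#)$; each leaf $S$ carries the symplectic structure given by the restriction $P_S$ of $P$. The Hamiltonian vector field of a function $f$ is $P^\#(df)$. "$\kappa$ is locally Hamiltonian on $S$" means that $\kappa$ is tangent to $S$ and every point of $S$ has an open neighbourhood $U\subseteq S$ and $f\in C^\infty(U)$ with $\kappa|_U=P_S^\#(df)$. *)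

theory Defs
  imports "HOL-Analysis.Analysis"
begin

section \<open>Smooth functions and derivatives\<close>

text \<open>\<open>Ck_on\<close> is used on open sets only.\<close>

fun Ck_on :: "nat \<Rightarrow> 'e::euclidean_space set \<Rightarrow> ('e \<Rightarrow> 'f::real_normed_vector) \<Rightarrow> bool" where
  "Ck_on 0 X f \<longleftrightarrow> continuous_on X f"
| "Ck_on (Suc k) X f \<longleftrightarrow> (\<forall>x\<in>X. f differentiable (at x)) \<and>
     (\<forall>v. Ck_on k X (\<lambda>x. frechet_derivative f (at x) v))"

text \<open>On an arbitrary set, smoothness means local extendability to a smooth function on an
  open subset of the ambient space. For relatively open subsets of a linear subspace this is
  ordinary smoothness.\<close>

definition smooth_on :: "'e::euclidean_space set \<Rightarrow> ('e \<Rightarrow> 'f::real_normed_vector) \<Rightarrow> bool" where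
  "smooth_on X f \<longleftrightarrow> (\<forall>x\<in>X. \<exists>U h. open U \<and> x \<in> U \<and> (\<forall>k. Ck_on k U h) \<and> (\<forall>y\<in>X \<inter> U. h y = f y))"

text \<open>Directional derivative. For a smooth function on a relatively open subset of a subspace and
  a direction in this subspace, it is the (total) derivative applied to the direction.\<close>

definition dir_deriv :: "('e::euclidean_space \<Rightarrow> 'f::real_normed_vector) \<Rightarrow> 'e \<Rightarrow> 'e \<Rightarrow> 'f" where
  "dir_deriv f x v = vector_derivative (\<lambda>t. f (x + t *\<^sub>R v)) (at 0)"


section \<open>Smooth manifolds\<close>

text \<open>The model space is the coordinate subspace spanned by a set \<open>model\<close> of standard basis
  vectors of \<^typ>\<open>'e\<close>, i.e. a copy of \<open>\<real>\<^sup>n\<close> with \<open>n = card model\<close>; so dimension zero and manifolds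
  of different dimensions over the same type are covered. The topology is part of the data, since
  an immersed submanifold need not carry the subspace topology.\<close>

type_synonym ('a, 'e) chart = "'a set \<times> ('a \<Rightarrow> 'e)"

record ('a, 'e) manifold =
  mtop :: "'a topology"
  model :: "'e set"
  atlas :: "('a, 'e) chart set"

abbreviation carrier :: "('a, 'e) manifold \<Rightarrow> 'a set" where
  "carrier M \<equiv> topspace (mtop M)"

definition chart_inv :: "('a, 'e) chart \<Rightarrow> 'e \<Rightarrow> 'a" where
  "chart_inv c = inv_into (fst c) (snd c)"

definition smooth_manifold :: "('a, 'e::euclidean_space) manifold \<Rightarrow> bool" where
  "smooth_manifold M \<longleftrightarrow>
     Hausdorff_space (mtop M) \<and> second_countable (mtop M) \<and>
     model M \<subseteq> Basis \<and>
     (\<forall>c\<in>atlas M.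
        openin (mtop M) (fst c) \<and>
        openin (top_of_set (span (model M))) (snd c ` fst c) \<and>
        homeomorphic_map (subtopology (mtop M) (fst c)) (top_of_set (snd c ` fst c)) (snd c)) \<and>
     (\<Union>c\<in>atlas M. fst c) = carrier M \<and>
     (\<forall>c\<in>atlas M. \<forall>d\<in>atlas M. smooth_on (snd c ` (fst c \<inter> fst d)) (snd d \<circ> chart_inv c))"

definition manifold_dim :: "('a, 'e) manifold \<Rightarrow> nat" where
  "manifold_dim M = card (model M)"

definition smooth_map ::
    "('a, 'e::euclidean_space) manifold \<Rightarrow> ('b, 'f::euclidean_space) manifold \<Rightarrow> ('a \<Rightarrow> 'b) \<Rightarrow> bool" where
  "smooth_map M N f \<longleftrightarrow>
     continuous_map (mtop M) (mtop N) f \<and>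
     (\<forall>c\<in>atlas M. \<forall>d\<in>atlas N.
        smooth_on (snd c ` {p \<in> fst c. f p \<in> fst d}) (snd d \<circ> f \<circ> chart_inv c))"

definition diffeomorphism ::
    "('a, 'e::euclidean_space) manifold \<Rightarrow> ('b, 'f::euclidean_space) manifold \<Rightarrow> ('a \<Rightarrow> 'b) \<Rightarrow> bool" where
  "diffeomorphism M N f \<longleftrightarrow>
     bij_betw f (carrier M) (carrier N) \<and> smooth_map M N f \<and>
     smooth_map N M (inv_into (carrier M) f)"

definition smooth_function ::
    "('a, 'e::euclidean_space) manifold \<Rightarrow> 'a set \<Rightarrow> ('a \<Rightarrow> real) \<Rightarrow> bool" where
  "smooth_function M U f \<longleftrightarrow> (\<forall>c\<in>atlas M. smooth_on (snd c ` (fst c \<inter> U)) (f \<circ> chart_inv c))"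

definition open_submanifold :: "('a, 'e) manifold \<Rightarrow> 'a set \<Rightarrow> ('a, 'e) manifold" where
  "open_submanifold M W =
     \<lparr>mtop = subtopology (mtop M) W, model = model M, atlas = (\<lambda>c. (fst c \<inter> W, snd c)) ` atlas M\<rparr>"

definition prod_manifold ::
    "('a, 'e::euclidean_space) manifold \<Rightarrow> ('b, 'f::euclidean_space) manifold \<Rightarrow> ('a \<times> 'b, 'e \<times> 'f) manifold" where
  "prod_manifold M N =
     \<lparr>mtop = prod_topology (mtop M) (mtop N),
      model = (\<lambda>b. (b, 0)) ` model M \<union> (\<lambda>b. (0, b)) ` model N,
      atlas = {(fst c \<times> fst d, map_prod (snd c) (snd d)) |c d. c \<in> atlas M \<and> d \<in> atlas N}\<rparr>"

definition real_line :: "(real, real) manifold" where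
  "real_line = \<lparr>mtop = euclideanreal, model = {1}, atlas = {(UNIV, id)}\<rparr>"


section \<open>Tangent and cotangent vectors\<close>

definition charts_at :: "('a, 'e) manifold \<Rightarrow> 'a \<Rightarrow> ('a, 'e) chart set" where
  "charts_at M p = {c \<in> atlas M. p \<in> fst c}"

text \<open>A tangent vector at \<open>p\<close> is the compatible family of its coordinate representations in the
  charts around \<open>p\<close> (set to zero at all other charts, so that equality of tangent vectors is
  equality of functions). The vector space operations are pointwise. Covectors are linear
  functionals on the tangent space, set to zero outside of it.\<close>

type_synonym ('a, 'e) tangent = "('a, 'e) chart \<Rightarrow> 'e"
type_synonym ('a, 'e) cotangent = "('a, 'e) tangent \<Rightarrow> real"

definition tangent_space :: "('a, 'e::euclidean_space) manifold \<Rightarrow> 'a \<Rightarrow> ('a, 'e) tangent set" where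
  "tangent_space M p = {v.
     (\<forall>c\<in>charts_at M p. v c \<in> span (model M)) \<and>
     (\<forall>c\<in>charts_at M p. \<forall>d\<in>charts_at M p. v d = dir_deriv (snd d \<circ> chart_inv c) (snd c p) (v c)) \<and>
     (\<forall>c. c \<notin> charts_at M p \<longrightarrow> v c = 0)}"

definition linear_form :: "('x \<Rightarrow> 'y::real_vector) set \<Rightarrow> (('x \<Rightarrow> 'y) \<Rightarrow> real) \<Rightarrow> bool" where
  "linear_form V \<alpha> \<longleftrightarrow>
     (\<forall>v\<in>V. \<forall>w\<in>V. \<forall>r s. \<alpha> (\<lambda>x. r *\<^sub>R v x + s *\<^sub>R w x) = r * \<alpha> v + s * \<alpha> w)"

definition bilinear_form ::
    "('x \<Rightarrow> 'y::real_vector) set \<Rightarrow> (('x \<Rightarrow> 'y) \<Rightarrow> ('x \<Rightarrow> 'y) \<Rightarrow> real) \<Rightarrow> bool" where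
  "bilinear_form V B \<longleftrightarrow> (\<forall>v\<in>V. linear_form V (B v)) \<and> (\<forall>w\<in>V. linear_form V (\<lambda>v. B v w))"

definition cotangent_space :: "('a, 'e::euclidean_space) manifold \<Rightarrow> 'a \<Rightarrow> ('a, 'e) cotangent set" where
  "cotangent_space M p =
     {\<alpha>. linear_form (tangent_space M p) \<alpha> \<and> (\<forall>v. v \<notin> tangent_space M p \<longrightarrow> \<alpha> v = 0)}"

text \<open>The coordinate frame \<open>\<partial>\<^sub>b\<close> and coframe \<open>dx\<^sup>b\<close> of a chart \<open>c\<close>, for \<open>b \<in> model M\<close>.\<close>

definition coord_vector ::
    "('a, 'e::euclidean_space) manifold \<Rightarrow> ('a, 'e) chart \<Rightarrow> 'a \<Rightarrow> 'e \<Rightarrow> ('a, 'e) tangent" where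
  "coord_vector M c p b =
     (\<lambda>d. if d \<in> charts_at M p then dir_deriv (snd d \<circ> chart_inv c) (snd c p) b else 0)"

definition coord_covector ::
    "('a, 'e::euclidean_space) manifold \<Rightarrow> ('a, 'e) chart \<Rightarrow> 'a \<Rightarrow> 'e \<Rightarrow> ('a, 'e) cotangent" where
  "coord_covector M c p b = (\<lambda>v. if v \<in> tangent_space M p then v c \<bullet> b else 0)"

text \<open>The following two notions do not depend on the chosen chart.\<close>

definition differential ::
    "('a, 'e::euclidean_space) manifold \<Rightarrow> ('b, 'f::euclidean_space) manifold \<Rightarrow> ('a \<Rightarrow> 'b) \<Rightarrow> 'a \<Rightarrow>
     ('a, 'e) tangent \<Rightarrow> ('b, 'f) tangent" where
  "differential M N f p v =
     (let c = (SOME c. c \<in> charts_at M p) in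
      (\<lambda>d. if d \<in> charts_at N (f p) then dir_deriv (snd d \<circ> f \<circ> chart_inv c) (snd c p) (v c) else 0))"

definition function_differential ::
    "('a, 'e::euclidean_space) manifold \<Rightarrow> ('a \<Rightarrow> real) \<Rightarrow> 'a \<Rightarrow> ('a, 'e) cotangent" where
  "function_differential M f p =
     (let c = (SOME c. c \<in> charts_at M p) in
      (\<lambda>v. if v \<in> tangent_space M p then dir_deriv (f \<circ> chart_inv c) (snd c p) (v c) else 0))"

definition pullback_covector ::
    "('a, 'e::euclidean_space) manifold \<Rightarrow> ('b, 'f::euclidean_space) manifold \<Rightarrow> ('a \<Rightarrow> 'b) \<Rightarrow> 'a \<Rightarrow>
     ('b, 'f) cotangent \<Rightarrow> ('a, 'e) cotangent" where
  "pullback_covector M N f p \<alpha> = (\<lambda>v. if v \<in> tangent_space M p then \<alpha> (differential M N f p v) else 0)"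


section \<open>Tensor fields\<close>

type_synonym ('a, 'e) one_form = "'a \<Rightarrow> ('a, 'e) cotangent"
type_synonym ('a, 'e) two_tensor = "'a \<Rightarrow> ('a, 'e) tangent \<Rightarrow> ('a, 'e) tangent \<Rightarrow> real"
type_synonym ('a, 'e) bivector = "'a \<Rightarrow> ('a, 'e) cotangent \<Rightarrow> ('a, 'e) cotangent \<Rightarrow> real"

definition smooth_one_form :: "('a, 'e::euclidean_space) manifold \<Rightarrow> ('a, 'e) one_form \<Rightarrow> bool" where
  "smooth_one_form M \<tau> \<longleftrightarrow>
     (\<forall>p\<in>carrier M. \<tau> p \<in> cotangent_space M p) \<and>
     (\<forall>c\<in>atlas M. \<forall>i\<in>model M. smooth_function M (fst c) (\<lambda>p. \<tau> p (coord_vector M c p i)))"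

definition symmetric_two_tensor :: "('a, 'e::euclidean_space) manifold \<Rightarrow> ('a, 'e) two_tensor \<Rightarrow> bool" where
  "symmetric_two_tensor M g \<longleftrightarrow>
     (\<forall>p\<in>carrier M. bilinear_form (tangent_space M p) (g p) \<and>
        (\<forall>v\<in>tangent_space M p. \<forall>w\<in>tangent_space M p. g p v w = g p w v)) \<and>
     (\<forall>c\<in>atlas M. \<forall>i\<in>model M. \<forall>j\<in>model M.
        smooth_function M (fst c) (\<lambda>p. g p (coord_vector M c p i) (coord_vector M c p j)))"

definition bivector_component ::
    "('a, 'e::euclidean_space) manifold \<Rightarrow> ('a, 'e) bivector \<Rightarrow> ('a, 'e) chart \<Rightarrow> 'e \<Rightarrow> 'e \<Rightarrow> 'a \<Rightarrow> real" where
  "bivector_component M P c i j p = P p (coord_covector M c p i) (coord_covector M c p j)"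

definition bivector_field :: "('a, 'e::euclidean_space) manifold \<Rightarrow> ('a, 'e) bivector \<Rightarrow> bool" where
  "bivector_field M P \<longleftrightarrow>
     (\<forall>p\<in>carrier M. bilinear_form (cotangent_space M p) (P p) \<and>
        (\<forall>\<alpha>\<in>cotangent_space M p. P p \<alpha> \<alpha> = 0)) \<and>
     (\<forall>c\<in>atlas M. \<forall>i\<in>model M. \<forall>j\<in>model M. smooth_function M (fst c) (bivector_component M P c i j))"


section \<open>Poisson structures\<close>

text \<open>Components, in a chart \<open>c\<close>, of the Schouten--Nijenhuis bracket of two bivector fields:
  \<open>[[P,Q]]\<^sup>i\<^sup>j\<^sup>k\<close> is the cyclic sum over \<open>i, j, k\<close> of
  \<open>\<Sum>\<^sub>l (P\<^sup>i\<^sup>l \<partial>\<^sub>l Q\<^sup>j\<^sup>k + Q\<^sup>i\<^sup>l \<partial>\<^sub>l P\<^sup>j\<^sup>k)\<close>. The sign is that of the convention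
  \<open>[[X\<^sub>1 \<and> X\<^sub>2, Y\<^sub>1 \<and> Y\<^sub>2]] = \<Sum>\<^sub>a\<^sub>,\<^sub>b (-1)\<^sup>a\<^sup>+\<^sup>b [X\<^sub>a, Y\<^sub>b] \<and> X\<^sub>3\<^sub>-\<^sub>a \<and> Y\<^sub>3\<^sub>-\<^sub>b\<close>.\<close>

definition schouten_bracket ::
    "('a, 'e::euclidean_space) manifold \<Rightarrow> ('a, 'e) bivector \<Rightarrow> ('a, 'e) bivector \<Rightarrow> ('a, 'e) chart \<Rightarrow>
     'e \<Rightarrow> 'e \<Rightarrow> 'e \<Rightarrow> 'a \<Rightarrow> real" where
  "schouten_bracket M P Q c i j k p =
     (let P' = bivector_component M P c; Q' = bivector_component M Q c;
          D = (\<lambda>l f. dir_deriv (f \<circ> chart_inv c) (snd c p) l);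
          T = (\<lambda>i j k. \<Sum>l\<in>model M. P' i l p * D l (Q' j k) + Q' i l p * D l (P' j k))
      in T i j k + T j k i + T k i j)"

definition poisson_structure :: "('a, 'e::euclidean_space) manifold \<Rightarrow> ('a, 'e) bivector \<Rightarrow> bool" where
  "poisson_structure M P \<longleftrightarrow>
     bivector_field M P \<and>
     (\<forall>c\<in>atlas M. \<forall>p\<in>fst c. \<forall>i\<in>model M. \<forall>j\<in>model M. \<forall>k\<in>model M. schouten_bracket M P P c i j k p = 0)"

definition anchor ::
    "('a, 'e::euclidean_space) manifold \<Rightarrow> ('a, 'e) bivector \<Rightarrow> 'a \<Rightarrow> ('a, 'e) cotangent \<Rightarrow> ('a, 'e) tangent" where
  "anchor M P p \<alpha> =
     (THE v. v \<in> tangent_space M p \<and> (\<forall>\<beta>\<in>cotangent_space M p. \<beta> v = P p \<alpha> \<beta>))"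

definition anchor_image ::
    "('a, 'e::euclidean_space) manifold \<Rightarrow> ('a, 'e) bivector \<Rightarrow> 'a \<Rightarrow> ('a, 'e) tangent set" where
  "anchor_image M P p = anchor M P p ` cotangent_space M p"

text \<open>Evaluation at any chart around \<open>p\<close> is an injective linear map on the tangent space, so the
  rank of the anchor is the dimension of the image read in such a chart.\<close>

definition anchor_rank :: "('a, 'e::euclidean_space) manifold \<Rightarrow> ('a, 'e) bivector \<Rightarrow> 'a \<Rightarrow> nat" where
  "anchor_rank M P p = dim ((\<lambda>v. v (SOME c. c \<in> charts_at M p)) ` anchor_image M P p)"

definition poisson_map ::
    "('a, 'e::euclidean_space) manifold \<Rightarrow> ('a, 'e) bivector \<Rightarrow>
     ('b, 'f::euclidean_space) manifold \<Rightarrow> ('b, 'f) bivector \<Rightarrow> ('a \<Rightarrow> 'b) \<Rightarrow> bool" where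
  "poisson_map M P N Q f \<longleftrightarrow>
     smooth_map M N f \<and>
     (\<forall>p\<in>carrier M. \<forall>\<alpha>\<in>cotangent_space N (f p). \<forall>\<beta>\<in>cotangent_space N (f p).
        Q (f p) \<alpha> \<beta> = P p (pullback_covector M N f p \<alpha>) (pullback_covector M N f p \<beta>))"

text \<open>\<open>S\<close> is an immersed submanifold of \<open>M\<close> (in general with a topology finer than the subspace
  topology), connected, whose tangent spaces are the images of the anchor.\<close>

definition integral_manifold ::
    "('a, 'e::euclidean_space) manifold \<Rightarrow> ('a, 'e) bivector \<Rightarrow> ('a, 'e) manifold \<Rightarrow> bool" where
  "integral_manifold M P S \<longleftrightarrow>
     smooth_manifold S \<and> carrier S \<noteq> {} \<and> carrier S \<subseteq> carrier M \<and> connected_space (mtop S) \<and>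
     smooth_map S M id \<and>
     (\<forall>p\<in>carrier S. inj_on (differential S M id p) (tangent_space S p) \<and>
        differential S M id p ` tangent_space S p = anchor_image M P p)"

definition symplectic_leaf ::
    "('a, 'e::euclidean_space) manifold \<Rightarrow> ('a, 'e) bivector \<Rightarrow> ('a, 'e) manifold \<Rightarrow> bool" where
  "symplectic_leaf M P S \<longleftrightarrow>
     integral_manifold M P S \<and>
     (\<forall>N. integral_manifold M P N \<and> carrier S \<subseteq> carrier N \<longrightarrow> carrier N = carrier S)"

text \<open>The bivector \<open>P\<^sub>S\<close> on a leaf \<open>S\<close>, determined by \<open>P\<^sub>S(\<iota>\<^sup>*\<alpha>, \<iota>\<^sup>*\<beta>) = P(\<alpha>, \<beta>)\<close> for the
  inclusion \<open>\<iota>\<close>.\<close>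

definition restrict_bivector ::
    "('a, 'e::euclidean_space) manifold \<Rightarrow> ('a, 'e) bivector \<Rightarrow> ('a, 'e) manifold \<Rightarrow> ('a, 'e) bivector" where
  "restrict_bivector M P S p a b =
     (THE r. \<exists>\<alpha>\<in>cotangent_space M p. \<exists>\<beta>\<in>cotangent_space M p.
        a = pullback_covector S M id p \<alpha> \<and> b = pullback_covector S M id p \<beta> \<and> r = P p \<alpha> \<beta>)"

text \<open>Vectors tangent to \<open>S\<close> are compared inside the tangent spaces of \<open>M\<close>, via the differential
  of the inclusion.\<close>

definition locally_hamiltonian ::
    "('a, 'e::euclidean_space) manifold \<Rightarrow> ('a, 'e) bivector \<Rightarrow> ('a, 'e) manifold \<Rightarrow>
     ('a \<Rightarrow> ('a, 'e) tangent) \<Rightarrow> bool" where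
  "locally_hamiltonian M P S X \<longleftrightarrow>
     (\<forall>p\<in>carrier S. X p \<in> differential S M id p ` tangent_space S p) \<and>
     (\<forall>p\<in>carrier S. \<exists>U f. openin (mtop S) U \<and> p \<in> U \<and> smooth_function S U f \<and>
        (\<forall>q\<in>U. X q =
           differential S M id q (anchor S (restrict_bivector M P S) q (function_differential S f q))))"


section \<open>Carrollian bundles\<close>

definition principal_R_bundle ::
    "('a, 'e::euclidean_space) manifold \<Rightarrow> ('b, 'f::euclidean_space) manifold \<Rightarrow> ('a \<Rightarrow> 'b) \<Rightarrow>
     (real \<Rightarrow> 'a \<Rightarrow> 'a) \<Rightarrow> bool" where
  "principal_R_bundle M B \<pi> act \<longleftrightarrow>
     smooth_manifold M \<and> smooth_manifold B \<and> smooth_map M B \<pi> \<and>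
     smooth_map (prod_manifold real_line M) M (\<lambda>(t, p). act t p) \<and>
     (\<forall>p\<in>carrier M. act 0 p = p) \<and>
     (\<forall>s t. \<forall>p\<in>carrier M. act (s + t) p = act s (act t p)) \<and>
     (\<forall>t. \<forall>p\<in>carrier M. \<pi> (act t p) = \<pi> p) \<and>
     (\<forall>x\<in>carrier B. \<exists>W \<psi>. openin (mtop B) W \<and> x \<in> W \<and>
        (let E = {p \<in> carrier M. \<pi> p \<in> W} in
          diffeomorphism (open_submanifold M E) (prod_manifold (open_submanifold B W) real_line)
            (\<lambda>p. (\<pi> p, \<psi> p)) \<and>
          (\<forall>p\<in>E. \<forall>t. \<psi> (act t p) = \<psi> p + t)))"

definition vertical_space ::
    "('a, 'e::euclidean_space) manifold \<Rightarrow> ('b, 'f::euclidean_space) manifold \<Rightarrow> ('a \<Rightarrow> 'b) \<Rightarrow> 'a \<Rightarrow>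
     ('a, 'e) tangent set" where
  "vertical_space M B \<pi> p = {v \<in> tangent_space M p. differential M B \<pi> p v = (\<lambda>_. 0)}"

definition fundamental_field ::
    "('a, 'e::euclidean_space) manifold \<Rightarrow> (real \<Rightarrow> 'a \<Rightarrow> 'a) \<Rightarrow> 'a \<Rightarrow> ('a, 'e) tangent" where
  "fundamental_field M act p =
     (\<lambda>c. if c \<in> charts_at M p then vector_derivative (\<lambda>t. snd c (act t p)) (at 0) else 0)"

definition metric_kernel ::
    "('a, 'e::euclidean_space) manifold \<Rightarrow> ('a, 'e) two_tensor \<Rightarrow> 'a \<Rightarrow> ('a, 'e) tangent set" where
  "metric_kernel M g p = {v \<in> tangent_space M p. \<forall>w\<in>tangent_space M p. g p v w = 0}"

text \<open>The normalisation \<open>\<tau>(\<kappa>) = 1\<close> makes \<open>ker \<tau>\<close> a complement of the vertical bundle, i.e. \<open>\<tau>\<close> is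
  an Ehresmann connection form.\<close>

definition carrollian_bundle ::
    "('a, 'e::euclidean_space) manifold \<Rightarrow> ('b, 'f::euclidean_space) manifold \<Rightarrow> ('a \<Rightarrow> 'b) \<Rightarrow>
     (real \<Rightarrow> 'a \<Rightarrow> 'a) \<Rightarrow> ('a, 'e) two_tensor \<Rightarrow> ('a, 'e) one_form \<Rightarrow> bool" where
  "carrollian_bundle M B \<pi> act g \<tau> \<longleftrightarrow>
     principal_R_bundle M B \<pi> act \<and>
     symmetric_two_tensor M g \<and>
     (\<forall>p\<in>carrier M. metric_kernel M g p = vertical_space M B \<pi> p) \<and>
     smooth_one_form M \<tau> \<and>
     (\<forall>p\<in>carrier M. \<tau> p (fundamental_field M act p) = 1) \<and>
     (\<forall>p\<in>carrier M. \<forall>v\<in>tangent_space M p. \<tau> p v = 0 \<and> v \<noteq> (\<lambda>_. 0) \<longrightarrow> 0 < g p v v)"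

definition carrollian_poisson_bundle ::
    "('a, 'e::euclidean_space) manifold \<Rightarrow> ('b, 'f::euclidean_space) manifold \<Rightarrow> ('a \<Rightarrow> 'b) \<Rightarrow>
     (real \<Rightarrow> 'a \<Rightarrow> 'a) \<Rightarrow> ('a, 'e) two_tensor \<Rightarrow> ('a, 'e) one_form \<Rightarrow> ('a, 'e) bivector \<Rightarrow> bool" where
  "carrollian_poisson_bundle M B \<pi> act g \<tau> P \<longleftrightarrow>
     carrollian_bundle M B \<pi> act g \<tau> \<and> poisson_structure M P \<and>
     (\<forall>p\<in>carrier M. anchor_rank M P p \<noteq> 0 \<longrightarrow> metric_kernel M g p \<subseteq> anchor_image M P p)"

definition poisson_stationary ::
    "('a, 'e::euclidean_space) manifold \<Rightarrow> (real \<Rightarrow> 'a \<Rightarrow> 'a) \<Rightarrow> ('a, 'e) bivector \<Rightarrow> bool" where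
  "poisson_stationary M act P \<longleftrightarrow> (\<forall>t. poisson_map M P M P (act t))"

end

theory Submission
  imports Defs
begin

text \<open>
  Let \<open>\<kappa>\<close> be the Carroll vector field. At a point of a leaf \<open>S\<close> of non-zero dimension the anchor has
  non-zero rank, because the tangent space of \<open>S\<close> is its image. As \<open>\<kappa>\<close> is vertical, it lies in the
  kernel of \<open>g\<close>, hence in the image of the anchor: \<open>\<kappa>\<close> is tangent to \<open>S\<close>. There it is a symplectic vector
  field, since its flow preserves \<open>P\<close>; so its contraction with the symplectic form is a closed one-form,
  and by the Poincare lemma \<open>\<kappa>\<close> is locally Hamiltonian.

  The proof carries this out in a chart of \<open>S\<close> and a chart of \<open>M\<close>, with \<open>\<iota>\<close> the inclusion in these charts
  and \<open>A\<close> the matrix of \<open>P\<close>. It never inverts the bivector on the leaf. Instead, \<open>\<kappa>\<close> is written as \<open>A \<eta>\<close>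
  with covectors \<open>\<eta>\<close> of \<open>M\<close> depending smoothly on the point of the leaf; this is possible as the skew
  matrix \<open>A\<close> has constant rank along \<open>S\<close> (\<open>smooth_preimage_under_skew_family\<close>). A local Hamiltonian is a
  potential of \<open>\<iota>\<^sup>*\<eta>\<close>. The form is closed because of two identities: the Jacobi identity for \<open>A\<close>
  (\<open>jacobi_coords\<close>), and \<open>L\<^sub>\<kappa>P = 0\<close>, which arises by differentiating the invariance of \<open>P\<close> under the
  action with respect to time (\<open>lie_coords\<close>). Both enter only through derivatives in directions of the
  image of \<open>A\<close>, that is, along the leaf; this is the computation in \<open>local_potential\<close>. Finally,
  \<open>leaf_anchor\<close> identifies the Hamiltonian vector field on \<open>S\<close>, formed with the restricted bivector \<open>P\<^sub>S\<close>:
  the differential of the Hamiltonian is the pullback of \<open>\<eta>\<close>, so the inclusion maps its Hamiltonian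
  vector field to \<open>A \<eta> = \<kappa>\<close>.

  Functions on charts live on relatively open subsets of a coordinate subspace. They are extended to
  open sets by precomposition with the orthogonal projection, after which the calculus of total
  derivatives applies (\<open>dir_deriv_eq\<close>). Second derivatives are symmetric
  (\<open>second_derivative_symmetric\<close>) for the inclusion, where this is \<open>d\<^sup>2 = 0\<close>, and for the flow, where it
  exchanges time and space derivatives.
\<close>

section \<open>Calculus of smooth functions on open sets\<close>

abbreviation D :: "('e::euclidean_space \<Rightarrow> 'f::real_normed_vector) \<Rightarrow> 'e \<Rightarrow> 'e \<Rightarrow> 'f" where
  "D f x \<equiv> frechet_derivative f (at x)"

lemma D_eqI: "(f has_derivative f') (at x) \<Longrightarrow> D f x = f'"
  using frechet_derivative_at by metis

lemma D_works: "f differentiable (at x) \<Longrightarrow> (f has_derivative D f x) (at x)"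
  using frechet_derivative_works by blast

lemma Ck_on_cong:
  assumes "open O'" "\<And>x. x \<in> O' \<Longrightarrow> f x = g x" "Ck_on k O' f"
  shows "Ck_on k O' g"
  using assms(2,3)
proof (induction k arbitrary: f g)
  case 0
  then show ?case using continuous_on_cong by fastforce
next
  case (Suc k)
  have *: "(g has_derivative D f x) (at x)" if "x \<in> O'" for x
  proof -
    have "(f has_derivative D f x) (at x)"
      using Suc.prems that by (intro D_works) auto
    then show ?thesis
      using has_derivative_transform_within_open[OF _ \<open>open O'\<close> that] Suc.prems(1) by metis
  qed
  have "Ck_on k O' (\<lambda>x. D g x v)" for v
    using Suc.IH[of "\<lambda>x. D f x v" "\<lambda>x. D g x v"] Suc.prems D_eqI[OF *] by auto
  then show ?case using * by (auto simp: differentiable_def)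
qed

lemma Ck_on_subset: "Ck_on k X f \<Longrightarrow> Y \<subseteq> X \<Longrightarrow> Ck_on k Y f"
  by (induction k arbitrary: f) (auto intro: continuous_on_subset)

lemma Ck_on_local:
  assumes "\<And>x. x \<in> X \<Longrightarrow> \<exists>U. open U \<and> x \<in> U \<and> Ck_on k U f"
  shows "Ck_on k X f"
  using assms
proof (induction k arbitrary: f)
  case 0
  show ?case
    unfolding Ck_on.simps
  proof (rule continuous_at_imp_continuous_on, rule ballI)
    fix x assume "x \<in> X"
    then show "isCont f x"
      using 0 continuous_on_eq_continuous_at by fastforce
  qed
next
  case (Suc k)
  then show ?case unfolding Ck_on.simps by (meson)
qed

lemma Ck_on_SucD: "Ck_on (Suc k) X f \<Longrightarrow> Ck_on k X f"
proof (induction k arbitrary: f)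
  case 0
  then show ?case
    by (auto intro!: continuous_at_imp_continuous_on differentiable_imp_continuous_within)
next
  case (Suc k)
  then show ?case by simp
qed

text \<open>The working form of the recursive clause: exhibit a derivative and check its directional
  values.\<close>

lemma Ck_on_SucI:
  assumes "open X" "\<And>x. x \<in> X \<Longrightarrow> (f has_derivative f' x) (at x)"
    "\<And>v. Ck_on k X (\<lambda>x. f' x v)"
  shows "Ck_on (Suc k) X f"
proof -
  have "Ck_on k X (\<lambda>x. D f x v)" for v
    by (rule Ck_on_cong[OF assms(1) _ assms(3)[of v]]) (simp add: D_eqI[OF assms(2)])
  moreover have "\<forall>x\<in>X. f differentiable (at x)"
    using assms(2) differentiable_def by blast
  ultimately show ?thesis by simp
qed

lemma Ck_on_const: "Ck_on k X (\<lambda>x. c)"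
proof (induction k arbitrary: c)
  case (Suc k)
  then show ?case by (simp add: frechet_derivative_const)
qed auto

lemma Ck_on_bounded_linear_compose:
  assumes "bounded_linear h" "open X" "Ck_on k X f"
  shows "Ck_on k X (\<lambda>x. h (f x))"
  using assms(3)
proof (induction k arbitrary: f)
  case 0
  then show ?case using linear_continuous_on_compose bounded_linear.linear assms(1)
    by (auto intro: bounded_linear.continuous_on)
next
  case (Suc k)
  show ?case
  proof (rule Ck_on_SucI[OF \<open>open X\<close>])
    show "((\<lambda>x. h (f x)) has_derivative (\<lambda>v. h (D f x v))) (at x)" if "x \<in> X" for x
      using Suc.prems that by (intro bounded_linear.has_derivative[OF assms(1)] D_works) simp
    show "Ck_on k X (\<lambda>x. h (D f x v))" for v
      using Suc by auto
  qed
qed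

lemma Ck_on_bounded_linear:
  assumes "bounded_linear h" "open X"
  shows "Ck_on k X h"
proof (cases k)
  case 0
  then show ?thesis using assms(1) by (simp add: linear_continuous_on)
next
  case (Suc k')
  then show ?thesis using Ck_on_SucI[OF assms(2), of h "\<lambda>_. h"] Ck_on_const
      bounded_linear_imp_has_derivative[OF assms(1)] by blast
qed

lemma Ck_on_add:
  assumes "open X" "Ck_on k X f" "Ck_on k X g"
  shows "Ck_on k X (\<lambda>x. f x + g x)"
  using assms(2,3)
proof (induction k arbitrary: f g)
  case 0
  then show ?case by (auto intro: continuous_intros)
next
  case (Suc k)
  show ?case
  proof (rule Ck_on_SucI[OF \<open>open X\<close>])
    show "((\<lambda>x. f x + g x) has_derivative (\<lambda>v. D f x v + D g x v)) (at x)" if "x \<in> X" for x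
      using Suc.prems that by (intro has_derivative_add D_works) simp_all
    show "Ck_on k X (\<lambda>x. D f x v + D g x v)" for v
      using Suc by auto
  qed
qed

lemma Ck_on_bilinear:
  assumes "bounded_bilinear h" "open X" "Ck_on k X f" "Ck_on k X g"
  shows "Ck_on k X (\<lambda>x. h (f x) (g x))"
  using assms(3,4)
proof (induction k arbitrary: f g)
  case 0
  then show ?case using bounded_bilinear.continuous_on[OF assms(1)] by auto
next
  case (Suc k)
  show ?case
  proof (rule Ck_on_SucI[OF \<open>open X\<close>])
    show "((\<lambda>x. h (f x) (g x)) has_derivative (\<lambda>v. h (f x) (D g x v) + h (D f x v) (g x))) (at x)"
      if "x \<in> X" for x
      using Suc.prems that by (intro bounded_bilinear.FDERIV[OF assms(1)] D_works) simp_all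
    show "Ck_on k X (\<lambda>x. h (f x) (D g x v) + h (D f x v) (g x))" for v
      using Suc.prems Ck_on_SucD[OF Suc.prems(1)] Ck_on_SucD[OF Suc.prems(2)]
      by (intro Ck_on_add[OF \<open>open X\<close>] Suc.IH) auto
  qed
qed

lemmas Ck_on_scaleR = Ck_on_bilinear[OF bounded_bilinear_scaleR]
lemmas Ck_on_inner = Ck_on_bilinear[OF bounded_bilinear_inner]

lemma Ck_on_minus: "open X \<Longrightarrow> Ck_on k X f \<Longrightarrow> Ck_on k X (\<lambda>x. - f x)"
  by (rule Ck_on_bounded_linear_compose[OF bounded_linear_minus[OF bounded_linear_ident]])

lemma Ck_on_diff: "open X \<Longrightarrow> Ck_on k X f \<Longrightarrow> Ck_on k X g \<Longrightarrow> Ck_on k X (\<lambda>x. f x - g x)"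
  using Ck_on_add[OF _ _ Ck_on_minus] by fastforce

lemma Ck_on_sum:
  assumes "open X" "\<And>i. i \<in> I \<Longrightarrow> Ck_on k X (f i)"
  shows "Ck_on k X (\<lambda>x. \<Sum>i\<in>I. f i x)"
  using assms(2)
  by (induction I rule: infinite_finite_induct) (auto intro!: Ck_on_const Ck_on_add assms(1))

lemma linear_euclidean_sum:
  assumes "linear L"
  shows "L v = (\<Sum>b\<in>Basis. (v \<bullet> b) *\<^sub>R L b)"
proof -
  have "L v = L (\<Sum>b\<in>Basis. (v \<bullet> b) *\<^sub>R b)" by (simp add: euclidean_representation)
  then show ?thesis by (simp only: linear_sum[OF assms] linear_cmul[OF assms])
qed

text \<open>By the chain rule, a directional derivative of \<open>g \<circ> f\<close> is a sum of products of components of a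
directional derivative of \<open>f\<close> with partial derivatives of \<open>g\<close> along \<open>f\<close>. The latter are compositions
again, of one order less, so the induction is over all pairs \<open>f, g\<close>.\<close>

lemma Ck_on_compose:
  assumes "open X" "open Y" "f ` X \<subseteq> Y" "Ck_on k X f" "Ck_on k Y g"
  shows "Ck_on k X (\<lambda>x. g (f x))"
  using assms(3-)
proof (induction k arbitrary: f g)
  case 0
  then show ?case using continuous_on_compose2[of Y g X f] by simp
next
  case (Suc k)
  have f: "(f has_derivative D f x) (at x)" if "x \<in> X" for x
    using Suc.prems that by (intro D_works) auto
  have g: "(g has_derivative D g x) (at x)" if "x \<in> Y" for x
    using Suc.prems that by (intro D_works) auto
  show ?case
  proof (rule Ck_on_SucI[OF \<open>open X\<close>])
    show "((\<lambda>x. g (f x)) has_derivative (\<lambda>v. \<Sum>b\<in>Basis. (D f x v \<bullet> b) *\<^sub>R D g (f x) b)) (at x)"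
      if "x \<in> X" for x
    proof -
      have "((\<lambda>x. g (f x)) has_derivative (\<lambda>v. D g (f x) (D f x v))) (at x)"
        using has_derivative_compose[OF f[OF that] g] Suc.prems(1) that by (auto simp: o_def)
      moreover have "(\<lambda>v. D g (f x) (D f x v)) = (\<lambda>v. \<Sum>b\<in>Basis. (D f x v \<bullet> b) *\<^sub>R D g (f x) b)"
        using Suc.prems(1) that by (intro ext linear_euclidean_sum has_derivative_linear[OF g]) auto
      ultimately show ?thesis by simp
    qed
    show "Ck_on k X (\<lambda>x. \<Sum>b\<in>Basis. (D f x v \<bullet> b) *\<^sub>R D g (f x) b)" for v
      using Suc.prems Ck_on_SucD[OF Suc.prems(2)]
      by (intro Ck_on_sum[OF \<open>open X\<close>] Ck_on_scaleR[OF \<open>open X\<close>] Ck_on_inner[OF \<open>open X\<close>] Ck_on_const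
          Suc.IH) auto
  qed
qed

definition smooth_open :: "'e::euclidean_space set \<Rightarrow> ('e \<Rightarrow> 'f::real_normed_vector) \<Rightarrow> bool" where
  "smooth_open X f \<longleftrightarrow> open X \<and> (\<forall>k. Ck_on k X f)"

lemma smooth_open_open: "smooth_open X f \<Longrightarrow> open X"
  by (simp add: smooth_open_def)

lemma smooth_open_D:
  assumes "smooth_open X f" "x \<in> X"
  shows "(f has_derivative D f x) (at x)"
proof -
  have "Ck_on (Suc 0) X f" using assms unfolding smooth_open_def by blast
  then show ?thesis using assms(2) by (intro D_works) simp
qed

lemma smooth_open_linear_D:
  assumes "smooth_open X f" "x \<in> X"
  shows "linear (D f x)"
  using smooth_open_D[OF assms] has_derivative_bounded_linear bounded_linear.linear by blast

lemma smooth_open_cont: "smooth_open X f \<Longrightarrow> continuous_on X f"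
  unfolding smooth_open_def by (auto dest: spec[of _ 0])

lemma smooth_open_D_smooth: "smooth_open X f \<Longrightarrow> smooth_open X (\<lambda>x. D f x v)"
  unfolding smooth_open_def using Ck_on.simps(2) by blast

text \<open>A potential of a smooth one-form is smooth for this reason: the form is its derivative.\<close>

lemma smooth_openI_D:
  assumes "open X" "\<And>x. x \<in> X \<Longrightarrow> (f has_derivative f' x) (at x)"
    "\<And>v. smooth_open X (\<lambda>x. f' x v)"
  shows "smooth_open X f"
  unfolding smooth_open_def
proof (intro conjI allI)
  fix k show "Ck_on k X f"
    using Ck_on_SucD Ck_on_SucI[OF assms(1,2)] assms(3) unfolding smooth_open_def by blast
qed (rule assms)

lemma smooth_open_cong:
  "smooth_open X f \<Longrightarrow> (\<And>x. x \<in> X \<Longrightarrow> f x = g x) \<Longrightarrow> smooth_open X g"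
  unfolding smooth_open_def using Ck_on_cong by blast

lemma smooth_open_subset: "smooth_open X f \<Longrightarrow> Y \<subseteq> X \<Longrightarrow> open Y \<Longrightarrow> smooth_open Y f"
  unfolding smooth_open_def using Ck_on_subset by blast

lemma smooth_open_const: "open X \<Longrightarrow> smooth_open X (\<lambda>x. c)"
  unfolding smooth_open_def using Ck_on_const by blast

lemma smooth_open_bounded_linear: "bounded_linear h \<Longrightarrow> open X \<Longrightarrow> smooth_open X h"
  unfolding smooth_open_def using Ck_on_bounded_linear by blast

lemma smooth_open_add: "smooth_open X f \<Longrightarrow> smooth_open X g \<Longrightarrow> smooth_open X (\<lambda>x. f x + g x)"
  unfolding smooth_open_def using Ck_on_add by blast

lemma smooth_open_scaleR: "smooth_open X f \<Longrightarrow> smooth_open X g \<Longrightarrow> smooth_open X (\<lambda>x. f x *\<^sub>R g x)"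
  unfolding smooth_open_def using Ck_on_scaleR by blast

lemma smooth_open_inner: "smooth_open X f \<Longrightarrow> smooth_open X g \<Longrightarrow> smooth_open X (\<lambda>x. f x \<bullet> g x)"
  unfolding smooth_open_def using Ck_on_inner by blast

lemma smooth_open_sum:
  "open X \<Longrightarrow> (\<And>i. i \<in> I \<Longrightarrow> smooth_open X (f i)) \<Longrightarrow> smooth_open X (\<lambda>x. \<Sum>i\<in>I. f i x)"
  unfolding smooth_open_def by (auto intro!: Ck_on_sum)

lemma smooth_open_compose:
  "smooth_open X f \<Longrightarrow> smooth_open Y g \<Longrightarrow> f ` X \<subseteq> Y \<Longrightarrow> smooth_open X (\<lambda>x. g (f x))"
  unfolding smooth_open_def by (auto intro!: Ck_on_compose[where X=X and Y=Y and f=f and g=g])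

lemma smooth_open_linear_compose:
  "bounded_linear h \<Longrightarrow> smooth_open X f \<Longrightarrow> smooth_open X (\<lambda>x. h (f x))"
  unfolding smooth_open_def by (auto intro!: Ck_on_bounded_linear_compose[where h=h and f=f])

section \<open>Symmetry of second derivatives\<close>

lemma has_vector_derivative_D_line:
  assumes "smooth_open X f" "x + t *\<^sub>R v \<in> X"
  shows "((\<lambda>t. f (x + t *\<^sub>R v)) has_vector_derivative D f (x + t *\<^sub>R v) v) (at t within T)"
proof -
  have 1: "((\<lambda>t. x + t *\<^sub>R v) has_derivative (\<lambda>h. h *\<^sub>R v)) (at t within T)"
    by (auto intro!: derivative_eq_intros)
  have "((\<lambda>t. f (x + t *\<^sub>R v)) has_derivative (\<lambda>h. D f (x + t *\<^sub>R v) (h *\<^sub>R v))) (at t within T)"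
    using has_derivative_compose[OF 1 smooth_open_D[OF assms]] by (simp add: o_def)
  then show ?thesis
    using linear_cmul[OF smooth_open_linear_D[OF assms]]
    by (simp add: has_vector_derivative_def)
qed

text \<open>Integrate \<open>\<partial>\<^sub>w f\<close> along a segment in direction \<open>w\<close> and differentiate the resulting identity
  first in direction \<open>v\<close> under the integral and then at the endpoint.\<close>

lemma second_derivative_symmetric:
  fixes f :: "'e::euclidean_space \<Rightarrow> 'f::euclidean_space"
  assumes f: "smooth_open X f" and x: "x \<in> X"
  shows "D (\<lambda>x. D f x v) x w = D (\<lambda>x. D f x w) x v"
proof -
  let ?z = "\<lambda>r s. x + r *\<^sub>R v + s *\<^sub>R w"
  have openX: "open X" using f smooth_open_open by blast
  have "\<exists>e>0. \<forall>r s. \<bar>r\<bar> \<le> e \<longrightarrow> \<bar>s\<bar> \<le> e \<longrightarrow> ?z r s \<in> X"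
  proof -
    obtain \<delta> where \<delta>: "\<delta> > 0" "ball x \<delta> \<subseteq> X"
      using openX x open_contains_ball by blast
    define N where "N = norm v + norm w + 1"
    define e where "e = \<delta> / (2 * N)"
    have n: "N > 0" by (simp add: add_nonneg_pos N_def)
    have "e > 0" unfolding e_def using \<delta> n by (intro divide_pos_pos mult_pos_pos) auto
    moreover have "?z r s \<in> X" if "\<bar>r\<bar> \<le> e" "\<bar>s\<bar> \<le> e" for r s
    proof -
      have "norm (r *\<^sub>R v + s *\<^sub>R w) \<le> \<bar>r\<bar> * norm v + \<bar>s\<bar> * norm w"
        by (metis norm_scaleR norm_triangle_ineq)
      also have "\<dots> \<le> e * norm v + e * norm w"
        using that by (intro add_mono mult_right_mono) auto
      also have "\<dots> < e * N" using \<open>e > 0\<close> by (simp add: N_def algebra_simps)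
      also have "\<dots> = \<delta> / 2" using n by (simp add: e_def field_simps)
      also have "\<dots> < \<delta>" using \<delta> by simp
      finally have "dist x (?z r s) < \<delta>" 
        by (metis add.assoc add_diff_cancel_left' dist_commute dist_norm)
      then show ?thesis using \<delta> by auto
    qed
    ultimately show ?thesis by blast
  qed
  then obtain e where e: "e > 0" "\<And>r s. \<bar>r\<bar> \<le> e \<Longrightarrow> \<bar>s\<bar> \<le> e \<Longrightarrow> ?z r s \<in> X" by blast
  let ?g = "\<lambda>x. D f x w" and ?h = "\<lambda>x. D f x v"
  let ?G = "\<lambda>x. D ?g x v"
  have g: "smooth_open X ?g" and h: "smooth_open X ?h" and G: "smooth_open X ?G"
    using f smooth_open_D_smooth by blast+
  have contz: "continuous_on ({-e..e} \<times> {0..t}) (\<lambda>(r,s). F (?z r s))"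
    if F: "smooth_open X F" and t: "t \<in> {0..e}" for F :: "'e \<Rightarrow> 'f" and t
  proof -
    have "continuous_on ({-e..e} \<times> {0..t}) (\<lambda>p. F (?z (fst p) (snd p)))"
      using e(2) t by (intro continuous_on_compose2[OF smooth_open_cont[OF F]] continuous_intros) auto
    then show ?thesis by (simp add: case_prod_unfold)
  qed
  have contz1: "continuous_on {0..t} (\<lambda>s. F (?z r s))"
    if F: "smooth_open X F" and t: "t \<in> {0..e}" and "r \<in> {-e..e}" for F :: "'e \<Rightarrow> 'f" and t r
      using e(2) that by (intro continuous_on_compose2[OF smooth_open_cont[OF F]] continuous_intros) auto
  have key: "?h (x + t *\<^sub>R w) = ?h x + integral {0..t} (\<lambda>s. ?G (x + s *\<^sub>R w))" if t: "t \<in> {0..e}" for t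
  proof -
    have int: "integral {0..t} (\<lambda>s. ?g (?z r s)) = f (?z r t) - f (?z r 0)" if r: "r \<in> {-e..e}" for r
    proof (rule integral_unique)
      have "((\<lambda>s. ?g (?z r s)) has_integral f (?z r t) - f (?z r 0)) {0..t}"
        using e t r by (intro fundamental_theorem_of_calculus has_vector_derivative_D_line[OF f]) auto
      then show "((\<lambda>s. ?g (?z r s)) has_integral f (?z r t) - f (?z r 0)) {0..t}" .
    qed
    have L: "((\<lambda>r. f (?z r t) - f (?z r 0)) has_vector_derivative ?h (?z 0 t) - ?h (?z 0 0)) (at 0 within {-e..e})"
    proof -
      have "((\<lambda>r. f ((x + s *\<^sub>R w) + r *\<^sub>R v)) has_vector_derivative ?h (x + s *\<^sub>R w + 0 *\<^sub>R v)) (at 0 within {-e..e})"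
        if "s \<in> {0..e}" for s
        using e(2)[of 0 s] that e(1) by (intro has_vector_derivative_D_line[OF f]) (auto simp:)
      from has_vector_derivative_diff[OF this[OF t] this[of 0]] e(1)
      show ?thesis by (simp add: algebra_simps)
    qed
    have "((\<lambda>r. integral (cbox 0 t) (\<lambda>s. ?g (?z r s))) has_vector_derivative
        integral (cbox 0 t) (\<lambda>s. ?G (?z 0 s))) (at 0 within {-e..e})"
    proof (rule leibniz_rule_vector_derivative)
      show "((\<lambda>r. ?g (?z r s)) has_vector_derivative ?G (?z r s)) (at r within {-e..e})"
        if "r \<in> {-e..e}" "s \<in> cbox 0 t" for r s
      proof -
        have "((\<lambda>r. ?g ((x + s *\<^sub>R w) + r *\<^sub>R v)) has_vector_derivative ?G (x + s *\<^sub>R w + r *\<^sub>R v)) (at r within {-e..e})"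
          using e(2)[of r s] that t by (intro has_vector_derivative_D_line[OF g]) (auto simp: algebra_simps)
        then show ?thesis by (simp add: algebra_simps)
      qed
      show "(\<lambda>s. ?g (?z r s)) integrable_on cbox 0 t" if "r \<in> {-e..e}" for r
        using contz1[OF g t that] integrable_continuous_real by auto
      show "continuous_on ({-e..e} \<times> cbox 0 t) (\<lambda>(r, s). ?G (?z r s))"
        using contz[OF G t] by simp
    qed (use e in auto)
    then have "((\<lambda>r. f (?z r t) - f (?z r 0)) has_vector_derivative
        integral {0..t} (\<lambda>s. ?G (?z 0 s))) (at 0 within {-e..e})"
      using int e(1) by (auto intro: has_vector_derivative_transform[rotated 2])
    then have "?h (?z 0 t) - ?h (?z 0 0) = integral {0..t} (\<lambda>s. ?G (?z 0 s))"
      using L e(1) vector_derivative_unique_within_closed_interval[of "-e" e 0] by auto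
    then show ?thesis by (simp add: algebra_simps)
  qed
  have "((\<lambda>t. integral {0..t} (\<lambda>s. ?G (x + s *\<^sub>R w))) has_vector_derivative ?G (x + 0 *\<^sub>R w)) (at 0 within {0..e})"
    using contz1[OF G, of e 0] e(1) by (intro integral_has_vector_derivative) auto
  then have "((\<lambda>t. ?h x + integral {0..t} (\<lambda>s. ?G (x + s *\<^sub>R w))) has_vector_derivative ?G x) (at 0 within {0..e})"
    by (auto intro!: derivative_eq_intros)
  then have "((\<lambda>t. ?h (x + t *\<^sub>R w)) has_vector_derivative ?G x) (at 0 within {0..e})"
    using e(1) by (rule_tac has_vector_derivative_transform[rotated 2]) (auto simp: key)
  moreover have "((\<lambda>t. ?h (x + t *\<^sub>R w)) has_vector_derivative D ?h (x + 0 *\<^sub>R w) w) (at 0 within {0..e})"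
    using x by (intro has_vector_derivative_D_line[OF h]) auto
  ultimately show ?thesis
    using vector_derivative_unique_within_closed_interval[of 0 e 0] e(1) by auto
qed

section \<open>Smooth dependence of solutions of linear systems\<close>

text \<open>For a function that is only known through an equation it satisfies, the remainder of the first-order
expansion is estimated by the defect of the expansion in the equation, here \<open>G\<close>.\<close>

lemma has_derivative_by_domination:
  assumes G: "(G has_derivative (\<lambda>_. 0)) (at x)" "G x = 0"
    and f': "bounded_linear f'" and X: "open X" "x \<in> X"
    and dom: "\<And>z. z \<in> X \<Longrightarrow> norm (f z - f x - f' (z - x)) \<le> C * norm (G z)"
  shows "(f has_derivative f') (at x)"
proof -
  have "((\<lambda>z. norm (G z) / norm (z - x)) \<longlongrightarrow> 0) (at x)"
    using G unfolding has_derivative_iff_norm by simp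
  then have lim: "((\<lambda>z. C * (norm (G z) / norm (z - x))) \<longlongrightarrow> 0) (at x)"
    using tendsto_mult_right_zero by blast
  have ev: "\<forall>\<^sub>F z in at x. norm (f z - f x - f' (z - x)) / norm (z - x) \<le> C * (norm (G z) / norm (z - x))"
    unfolding eventually_at_topological
    using X dom divide_right_mono[of "norm (f z - f x - f' (z - x))" "C * norm (G z)" "norm (z - x)" for z]
    by (intro exI[of _ X]) auto
  have "((\<lambda>z. norm (f z - f x - f' (z - x)) / norm (z - x)) \<longlongrightarrow> 0) (at x)"
    by (rule tendsto_sandwich[OF _ ev tendsto_const lim]) simp
  then show ?thesis unfolding has_derivative_iff_norm using f' by simp
qed

lemma has_derivative_linear_family:
  assumes "open X" "x \<in> X" "\<And>y. y \<in> X \<Longrightarrow> linear (B y)"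
    "\<And>a. ((\<lambda>y. B y a) has_derivative B' a) (at x)" "(v has_derivative v') (at x)"
  shows "((\<lambda>y. B y (v y :: 'f::euclidean_space)) has_derivative (\<lambda>h. B x (v' h) + (\<Sum>b\<in>Basis. (v x \<bullet> b) *\<^sub>R B' b h))) (at x)"
proof (rule has_derivative_transform_within_open[OF _ assms(1,2)])
  have "((\<lambda>y. \<Sum>b\<in>Basis. (v y \<bullet> b) *\<^sub>R B y b) has_derivative
     (\<lambda>h. \<Sum>b\<in>Basis. (v x \<bullet> b) *\<^sub>R B' b h + (v' h \<bullet> b) *\<^sub>R B x b)) (at x)"
    by (intro has_derivative_sum has_derivative_scaleR has_derivative_inner_left assms)
  moreover have "(\<lambda>h. \<Sum>b\<in>Basis. (v x \<bullet> b) *\<^sub>R B' b h + (v' h \<bullet> b) *\<^sub>R B x b) =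
     (\<lambda>h. B x (v' h) + (\<Sum>b\<in>Basis. (v x \<bullet> b) *\<^sub>R B' b h))"
    by (auto simp: sum.distrib linear_euclidean_sum[OF assms(3)[OF assms(2)], symmetric])
  ultimately show "((\<lambda>y. \<Sum>b\<in>Basis. (v y \<bullet> b) *\<^sub>R B y b) has_derivative
     (\<lambda>h. B x (v' h) + (\<Sum>b\<in>Basis. (v x \<bullet> b) *\<^sub>R B' b h))) (at x)" by simp
  show "(\<Sum>b\<in>Basis. (v y \<bullet> b) *\<^sub>R B y b) = B y (v y)" if "y \<in> X" for y
    by (rule linear_euclidean_sum[OF assms(3)[OF that], symmetric])
qed

text \<open>The bound from below plays the role of the inverse matrix: it makes the solution continuous and
  differentiable. Differentiating \<open>B u = b\<close> gives the system \<open>B (D u v) = D b v - (D B v) u\<close> with the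
  same operators, so the order of smoothness increases by induction.\<close>

lemma Ck_on_linear_solution:
  fixes B :: "'e::euclidean_space \<Rightarrow> 'f::euclidean_space \<Rightarrow> 'f"
  assumes X: "open X" and lin: "\<And>y. y \<in> X \<Longrightarrow> linear (B y)"
    and m: "m > 0" "\<And>y a. y \<in> X \<Longrightarrow> m * norm a \<le> norm (B y a)"
    and "\<And>a. Ck_on k X (\<lambda>y. B y a)" "Ck_on k X b" "\<And>y. y \<in> X \<Longrightarrow> B y (u y) = b y"
  shows "Ck_on k X u"
  using assms(5-)
proof (induction k arbitrary: b u)
  have le: "norm a \<le> (1/m) * norm (B y a)" if "y \<in> X" for y a
    using m(2)[OF that, of a] m(1) by (simp add: field_simps)
  case 0
  show ?case unfolding Ck_on.simps
  proof (rule continuous_at_imp_continuous_on, rule ballI)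
    fix y assume y: "y \<in> X"
    have "((\<lambda>z. b z - (\<Sum>e\<in>Basis. (u y \<bullet> e) *\<^sub>R B z e)) \<longlongrightarrow> b y - (\<Sum>e\<in>Basis. (u y \<bullet> e) *\<^sub>R B y e)) (at y)"
    proof -
      have "isCont b y" "\<And>a. isCont (\<lambda>z. B z a) y"
        using 0 y by (simp_all add: continuous_on_eq_continuous_at[OF X])
      then show ?thesis unfolding isCont_def by (intro tendsto_intros)
    qed
    moreover have "b y - (\<Sum>e\<in>Basis. (u y \<bullet> e) *\<^sub>R B y e) = 0"
      by (simp add: 0(3)[OF y] linear_euclidean_sum[OF lin[OF y], symmetric])
    ultimately have "((\<lambda>z. (1/m) * norm (b z - (\<Sum>e\<in>Basis. (u y \<bullet> e) *\<^sub>R B z e))) \<longlongrightarrow> 0) (at y)"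
      by (intro tendsto_mult_right_zero tendsto_norm_zero) simp
    moreover have "norm (u z - u y) \<le> (1/m) * norm (b z - (\<Sum>e\<in>Basis. (u y \<bullet> e) *\<^sub>R B z e))" if "z \<in> X" for z
      using le[OF that, of "u z - u y"]
      by (simp add: linear_diff[OF lin[OF that]] 0(3)[OF that] linear_euclidean_sum[OF lin[OF that], symmetric])
    then have "\<forall>\<^sub>F z in at y. norm (u z - u y) \<le> (1/m) * norm (b z - (\<Sum>e\<in>Basis. (u y \<bullet> e) *\<^sub>R B z e))"
      unfolding eventually_at_topological using X y by (intro exI[of _ X]) auto
    ultimately have "((\<lambda>z. norm (u z - u y)) \<longlongrightarrow> 0) (at y)"
      by (rule_tac tendsto_sandwich[of "\<lambda>_. 0"]) auto
    then show "isCont u y"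
      unfolding isCont_def using LIM_zero_cancel tendsto_norm_zero_iff by blast
  qed
next
  case (Suc k)
  have le: "norm a \<le> (1/m) * norm (B y a)" if "y \<in> X" for y a
    using m(2)[OF that, of a] m(1) by (simp add: field_simps)
  have B: "((\<lambda>y. B y a) has_derivative D (\<lambda>y. B y a) y) (at y)" if "y \<in> X" for a y
    using Suc.prems(1) that by (intro D_works) auto
  have b: "(b has_derivative D b y) (at y)" if "y \<in> X" for y
    using Suc.prems(2) that by (intro D_works) auto
  have inj: "inj (B y)" if "y \<in> X" for y
    unfolding linear_injective_0[OF lin[OF that]]
  proof (intro allI impI)
    fix a assume "B y a = 0"
    then show "a = 0" using le[OF that, of a] by simp
  qed
  define R where "R y h = D b y h - (\<Sum>e\<in>Basis. (u y \<bullet> e) *\<^sub>R D (\<lambda>z. B z e) y h)" for y h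
  define u' where "u' y h = inv (B y) (R y h)" for y h
  have Bu': "B y (u' y h) = R y h" if "y \<in> X" for y h
    unfolding u'_def using linear_injective_imp_surjective[OF lin[OF that] inj[OF that]]
    by (simp add: surj_f_inv_f)
  have R: "((\<lambda>z. b z - B z (u y)) has_derivative R y) (at y)" if "y \<in> X" for y
  proof -
    have "((\<lambda>z. B z (u y)) has_derivative (\<lambda>h. B y 0 + (\<Sum>e\<in>Basis. (u y \<bullet> e) *\<^sub>R D (\<lambda>z. B z e) y h))) (at y)"
      by (rule has_derivative_linear_family[OF X that lin B[OF that]]) auto
    then have "((\<lambda>z. b z - B z (u y)) has_derivative (\<lambda>h. D b y h -
        (B y 0 + (\<Sum>e\<in>Basis. (u y \<bullet> e) *\<^sub>R D (\<lambda>z. B z e) y h)))) (at y)"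
      using b[OF that] by (rule has_derivative_diff[rotated])
    moreover have "(\<lambda>h. D b y h -
        (B y 0 + (\<Sum>e\<in>Basis. (u y \<bullet> e) *\<^sub>R D (\<lambda>z. B z e) y h))) = R y"
      using linear_0[OF lin[OF that]] by (auto simp: R_def)
    ultimately show ?thesis by simp
  qed
  have linu': "linear (u' y)" if "y \<in> X" for y
  proof (rule linearI)
    have lR: "linear (R y)" using R[OF that] has_derivative_linear by blast
    note l = lin[OF that] and i = injD[OF inj[OF that]]
    show "u' y (v + w) = u' y v + u' y w" for v w
      by (rule i) (simp add: Bu'[OF that] linear_add[OF l] linear_add[OF lR])
    show "u' y (c *\<^sub>R v) = c *\<^sub>R u' y v" for c v
      by (rule i) (simp add: Bu'[OF that] linear_cmul[OF l] linear_cmul[OF lR])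
  qed
  show ?case
  proof (rule Ck_on_SucI[OF X])
    fix y assume y: "y \<in> X"
    \<comment> \<open>The defect \<open>B z (u z - u y - u' y (z - y))\<close>, written without \<open>u z\<close> by means of the equation.\<close>
    let ?G = "\<lambda>z. (b z - B z (u y)) - B z (u' y (z - y))"
    have bl: "bounded_linear (u' y)" using linu'[OF y] linear_conv_bounded_linear by blast
    show "(u has_derivative u' y) (at y)"
    proof (rule has_derivative_by_domination[where G = ?G and C = "1/m", OF _ _ bl X y])
      have du: "((\<lambda>z. u' y (z - y)) has_derivative u' y) (at y)"
        by (rule bounded_linear.has_derivative[OF bl, of "\<lambda>z. z - y" "\<lambda>z. z" "at y", simplified])
          (auto intro!: derivative_eq_intros)
      have "((\<lambda>z. B z (u' y (z - y))) has_derivative (\<lambda>h. B y (u' y h) +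
         (\<Sum>e\<in>Basis. (u' y (y - y) \<bullet> e) *\<^sub>R D (\<lambda>z. B z e) y h))) (at y)"
        by (rule has_derivative_linear_family[OF X y lin B[OF y] du])
      then have "((\<lambda>z. B z (u' y (z - y))) has_derivative R y) (at y)"
        using linear_0[OF linu'[OF y]] Bu'[OF y] by simp
      from has_derivative_diff[OF R[OF y] this]
      show "(?G has_derivative (\<lambda>_. 0)) (at y)" by simp
      show "?G y = 0"
        using Suc.prems(3)[OF y] linear_0[OF linu'[OF y]] linear_0[OF lin[OF y]] by simp
      show "norm (u z - u y - u' y (z - y)) \<le> 1 / m * norm (?G z)" if "z \<in> X" for z
        using le[OF that, of "u z - u y - u' y (z - y)"]
        by (simp add: linear_diff[OF lin[OF that]] Suc.prems(3)[OF that])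
    qed
  next
    fix v
    have uk: "Ck_on k X u"
      using Suc.IH[of b u] Suc.prems Ck_on_SucD[OF Suc.prems(1)] Ck_on_SucD[OF Suc.prems(2)] by blast
    show "Ck_on k X (\<lambda>y. u' y v)"
    proof (rule Suc.IH[of "\<lambda>y. R y v"])
      show "Ck_on k X (\<lambda>y. R y v)" unfolding R_def
        using Suc.prems uk by (intro Ck_on_diff Ck_on_sum Ck_on_scaleR Ck_on_inner Ck_on_const X) auto
      show "B y (u' y v) = R y v" if "y \<in> X" for y by (rule Bu'[OF that])
      show "Ck_on k X (\<lambda>y. B y a)" for a by (rule Ck_on_SucD[OF Suc.prems(1)])
    qed
  qed
qed

text \<open>An injective linear map is bounded below; by expansion in a basis, the perturbation \<open>B y - B x\<close> is
small in operator norm as soon as it is small on the finitely many basis vectors.\<close>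

lemma linear_family_bounded_below_near:
  fixes B :: "'e::euclidean_space \<Rightarrow> 'f::euclidean_space \<Rightarrow> 'f"
  assumes X: "open X" "x \<in> X" and lin: "\<And>y. y \<in> X \<Longrightarrow> linear (B y)"
    and cont: "\<And>a. continuous_on X (\<lambda>y. B y a)" and inj: "inj (B x)"
  shows "\<exists>U m. open U \<and> x \<in> U \<and> U \<subseteq> X \<and> m > 0 \<and> (\<forall>y\<in>U. \<forall>a. m * norm a \<le> norm (B y a))"
proof -
  obtain c where c: "c > 0" "\<And>a. c * norm a \<le> norm (B x a)"
    using linear_inj_bounded_below_pos[OF lin[OF X(2)] inj] by auto
  define s where "s y = (\<Sum>e\<in>Basis. norm (B y e - B x e))" for y
  have "continuous_on X s" unfolding s_def by (intro continuous_intros cont)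
  then have "open (X \<inter> s -` {..<c/2})"
    using X(1) by (simp add: continuous_open_preimage)
  moreover have "x \<in> X \<inter> s -` {..<c/2}" using X c by (simp add: s_def)
  moreover have "c/2 * norm a \<le> norm (B y a)" if y: "y \<in> X \<inter> s -` {..<c/2}" for y a
  proof -
    have "norm (B y a - B x a) = norm (\<Sum>e\<in>Basis. (a \<bullet> e) *\<^sub>R (B y e - B x e))"
      using y by (simp add: sum_subtractf scaleR_diff_right linear_euclidean_sum[OF lin, symmetric] X(2))
    also have "\<dots> \<le> (\<Sum>e\<in>Basis. norm a * norm (B y e - B x e))"
      by (rule sum_norm_le) (auto intro!: mult_right_mono Basis_le_norm)
    also have "\<dots> = norm a * s y" by (simp add: s_def sum_distrib_left)
    also have "\<dots> \<le> norm a * (c/2)" using y by (intro mult_left_mono) auto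
    finally have 1: "norm (B y a - B x a) \<le> norm a * (c/2)" .
    have "norm (B x a) \<le> norm (B y a) + norm (B y a - B x a)"
      by (metis norm_minus_commute norm_triangle_sub)
    then show ?thesis using 1 c(2)[of a] by (simp add: algebra_simps)
  qed
  ultimately show ?thesis using c(1)
    by (intro exI[of _ "X \<inter> s -` {..<c/2}"] exI[of _ "c/2"]) auto
qed

section \<open>The Poincare lemma for one-forms\<close>

lemma D_as_sum:
  "smooth_open X f \<Longrightarrow> x \<in> X \<Longrightarrow> D f x v = (\<Sum>b\<in>Basis. (v \<bullet> b) *\<^sub>R D f x b)"
  by (rule linear_euclidean_sum[OF smooth_open_linear_D])

text \<open>The potential is the integral of the form along rays from the centre. Closedness turns the derivative
of the integrand in a direction \<open>h\<close> into \<open>G \<bullet> h\<close> with \<open>G y t = d/dt (t \<Theta>(y0 + t (y - y0)))\<close>, so that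
differentiation under the integral leaves the value of \<open>\<Theta>\<close> at the end of the ray.\<close>

lemma closed_one_form_has_potential:
  fixes \<Theta> :: "'e::euclidean_space \<Rightarrow> 'e"
  assumes \<Theta>: "smooth_open (ball y0 \<rho>) \<Theta>" and \<rho>: "\<rho> > 0"
    and closed: "\<And>y v w. y \<in> ball y0 \<rho> \<Longrightarrow> D \<Theta> y v \<bullet> w = D \<Theta> y w \<bullet> v"
  shows "\<exists>f. smooth_open (ball y0 \<rho>) f \<and> (\<forall>y\<in>ball y0 \<rho>. (f has_derivative (\<lambda>w. \<Theta> y \<bullet> w)) (at y))"
proof -
  let ?U = "ball y0 \<rho>"
  let ?z = "\<lambda>y t. y0 + t *\<^sub>R (y - y0)"
  have z: "?z y t \<in> ?U" if "y \<in> ?U" "t \<in> cbox 0 (1::real)" for y t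
  proof -
    have "norm (t *\<^sub>R (y - y0)) \<le> norm (y - y0)"
      using that by (simp add: mult_left_le_one_le)
    then show ?thesis using that(1) by (simp add: dist_norm norm_minus_commute)
  qed
  define G where "G y t = t *\<^sub>R D \<Theta> (?z y t) (y - y0) + \<Theta> (?z y t)" for y t
  define f where "f y = integral (cbox 0 1) (\<lambda>t. \<Theta> (?z y t) \<bullet> (y - y0))" for y
  have z': "((\<lambda>p. ?z (fst p) (snd p)) ` (?U \<times> cbox 0 1)) \<subseteq> ?U" using z by auto
  have comp: "continuous_on (?U \<times> cbox 0 1) (\<lambda>p. F (?z (fst p) (snd p)))"
    if "smooth_open ?U F" for F :: "'e \<Rightarrow> 'e"
    using z' by (intro continuous_on_compose2[OF smooth_open_cont[OF that]] continuous_intros) auto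
  have contG: "continuous_on (?U \<times> cbox 0 1) (\<lambda>(y,t). G y t)"
  proof -
    have "continuous_on (?U \<times> cbox 0 1) (\<lambda>p. snd p *\<^sub>R (\<Sum>b\<in>Basis. ((fst p - y0) \<bullet> b) *\<^sub>R D \<Theta> (?z (fst p) (snd p)) b)
      + \<Theta> (?z (fst p) (snd p)))"
      by (intro continuous_intros comp[OF \<Theta>] comp[OF smooth_open_D_smooth[OF \<Theta>]])
    then show ?thesis
      unfolding case_prod_unfold G_def
      using D_as_sum[OF \<Theta> z] by (auto elim!: continuous_on_eq)
  qed
  have "(f has_derivative (\<lambda>w. \<Theta> y \<bullet> w)) (at y)" if y: "y \<in> ?U" for y
  proof -
    have der: "((\<lambda>y. integral (cbox 0 1) (\<lambda>t. \<Theta> (?z y t) \<bullet> (y - y0))) has_derivative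
        integral (cbox 0 1) (\<lambda>t. blinfun_inner_right (G y t))) (at y within ?U)"
    proof (rule leibniz_rule)
      fix x t assume x: "x \<in> ?U" and t: "t \<in> cbox 0 (1::real)"
      have 1: "((\<lambda>x. ?z x t) has_derivative (\<lambda>h. t *\<^sub>R h)) (at x within ?U)"
        by (auto intro!: derivative_eq_intros)
      have lin: "linear (D \<Theta> (?z x t))" using smooth_open_linear_D[OF \<Theta> z[OF x t]] .
      have 2: "((\<lambda>x. \<Theta> (?z x t)) has_derivative (\<lambda>h. D \<Theta> (?z x t) (t *\<^sub>R h))) (at x within ?U)"
        using has_derivative_compose[OF 1 smooth_open_D[OF \<Theta> z[OF x t]]] by (simp add: o_def)
      have "((\<lambda>x. \<Theta> (?z x t) \<bullet> (x - y0)) has_derivative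
        (\<lambda>h. \<Theta> (?z x t) \<bullet> h + D \<Theta> (?z x t) (t *\<^sub>R h) \<bullet> (x - y0))) (at x within ?U)"
        by (rule has_derivative_inner[OF 2]) (auto intro!: derivative_eq_intros)
      moreover have "\<Theta> (?z x t) \<bullet> h + D \<Theta> (?z x t) (t *\<^sub>R h) \<bullet> (x - y0) = blinfun_inner_right (G x t) h" for h
        using closed[OF z[OF x t], of h "x - y0"]
        by (simp add: G_def inner_add_left linear_cmul[OF lin])
      ultimately show "((\<lambda>x. \<Theta> (?z x t) \<bullet> (x - y0)) has_derivative blinfun_inner_right (G x t)) (at x within ?U)"
        by simp
    next
      fix x assume x: "x \<in> ?U"
      have "continuous_on (cbox 0 1) (\<lambda>t. \<Theta> (?z x t) \<bullet> (x - y0))"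
        using z[OF x] by (intro continuous_intros continuous_on_compose2[OF smooth_open_cont[OF \<Theta>]]) auto
      then show "(\<lambda>t. \<Theta> (?z x t) \<bullet> (x - y0)) integrable_on cbox 0 1"
        by (rule integrable_continuous)
    next
      show "continuous_on (?U \<times> cbox 0 1) (\<lambda>(x, t). blinfun_inner_right (G x t))"
        using bounded_linear.continuous_on[OF bounded_linear_blinfun_inner_right contG]
        by (simp add: case_prod_unfold)
    qed (use y in auto)
    have contGy: "continuous_on (cbox 0 1) (G y)"
    proof -
      have "continuous_on (cbox 0 1) (\<lambda>t. case (y, t) of (y, t) \<Rightarrow> G y t)"
        by (rule continuous_on_compose2[OF contG]) (use y in \<open>auto intro!: continuous_intros\<close>)
      then show ?thesis by simp
    qed
    have intG: "integral (cbox 0 1) (G y) = \<Theta> y"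
    proof -
      have "((\<lambda>t. t *\<^sub>R \<Theta> (?z y t)) has_vector_derivative G y t) (at t within {0..1})"
        if t: "t \<in> {0..1}" for t
      proof -
        have "((\<lambda>t. \<Theta> (?z y t)) has_vector_derivative D \<Theta> (?z y t) (y - y0)) (at t within {0..1})"
          using t by (intro has_vector_derivative_D_line[OF \<Theta>] z[OF y]) auto
        from has_vector_derivative_scaleR[OF DERIV_ident this]
        show ?thesis by (simp add: G_def)
      qed
      from fundamental_theorem_of_calculus[OF _ this]
      have "(G y has_integral \<Theta> y) {0..1}" by simp
      then show ?thesis by (simp add: integral_unique)
    qed
    have int: "integral (cbox 0 1) (\<lambda>t. blinfun_inner_right (G y t)) = blinfun_inner_right (\<Theta> y)"
      using integral_linear[OF integrable_continuous[OF contGy] bounded_linear_blinfun_inner_right] intG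
      by (simp add: o_def)
    have eq: "blinfun_apply (blinfun_inner_right (\<Theta> y)) = (\<lambda>w. \<Theta> y \<bullet> w)" by auto
    show ?thesis
      using der unfolding int eq f_def[abs_def, symmetric] at_within_open[OF y open_ball] .
  qed
  moreover from this have "smooth_open ?U f"
    by (rule smooth_openI_D[OF open_ball]) (auto intro!: smooth_open_inner \<Theta> smooth_open_const)
  ultimately show ?thesis by blast
qed

section \<open>The local problem in coordinates\<close>

lemma orthogonal_projection_exists:
  fixes N :: "'e::euclidean_space set"
  assumes "subspace N"
  obtains Q where "linear Q" "\<And>x. Q x \<in> N" "\<And>x. x \<in> N \<Longrightarrow> Q x = x" "\<And>x n. n \<in> N \<Longrightarrow> (x - Q x) \<bullet> n = 0"
proof -
  obtain B where B: "B \<subseteq> N" "pairwise orthogonal B" "\<And>x. x \<in> B \<Longrightarrow> norm x = 1" "independent B" "span B = N"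
    using orthonormal_basis_subspace[OF assms] by metis
  have finB: "finite B" using B(4) independent_imp_finite by blast
  define Q where "Q x = (\<Sum>b\<in>B. (x \<bullet> b) *\<^sub>R b)" for x
  have lin: "linear Q" unfolding Q_def
    by (rule linearI) (auto simp: inner_add_left scaleR_add_left sum.distrib scaleR_sum_right)
  have QN: "Q x \<in> N" for x unfolding Q_def
    using B(1) by (intro subspace_sum[OF assms] subspace_scale[OF assms]) auto
  have Qb: "(x - Q x) \<bullet> b = 0" if "b \<in> B" for x b
  proof -
    have "Q x \<bullet> b = (\<Sum>c\<in>B. (x \<bullet> c) * (c \<bullet> b))" by (simp add: Q_def inner_sum_left)
    also have "\<dots> = (\<Sum>c\<in>B. if c = b then x \<bullet> b else 0)"
      using B(2,3) that by (intro sum.cong) (auto simp: pairwise_def orthogonal_def dot_square_norm)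
    also have "\<dots> = x \<bullet> b" using finB that by simp
    finally show ?thesis by (simp add: inner_diff_left)
  qed
  have orth: "(x - Q x) \<bullet> n = 0" if "n \<in> N" for x n
  proof -
    have "n \<in> span B" using B(5) that by simp
    then show ?thesis
      by (induction rule: span_induct_alt) (auto simp: inner_add_right Qb)
  qed
  have "Q x = x" if "x \<in> N" for x
  proof -
    have "x - Q x \<in> N" using that QN subspace_diff[OF assms] by blast
    then have "(x - Q x) \<bullet> (x - Q x) = 0" by (rule orth)
    then show ?thesis by simp
  qed
  then show ?thesis using that lin QN orth by blast
qed

lemma linear_inj_on_of_dim:
  fixes f :: "'e::euclidean_space \<Rightarrow> 'f::euclidean_space"
  assumes "linear f" "subspace R" "N \<subseteq> f ` R" "dim N = dim R"
  shows "inj_on f R"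
proof -
  obtain B where B: "B \<subseteq> R" "independent B" "R \<subseteq> span B" "card B = dim R"
    using basis_exists by metis
  have spB: "span B = R" using B assms(2) by (metis span_subspace)
  have fin: "finite B" using B(2) independent_imp_finite by blast
  have N: "N \<subseteq> span (f ` B)" using assms(3) spB linear_span_image[OF assms(1)] by metis
  have "card (f ` B) \<le> dim N" using card_image_le[OF fin, of f] B(4) assms(4) by simp
  moreover have "dim N \<le> card (f ` B)"
    using N fin by (meson dim_le_card finite_imageI)
  ultimately have card: "card (f ` B) = card B" using B(4) assms(4) by simp
  then have "inj_on f B" using fin eq_card_imp_inj_on by blast
  moreover have "independent (f ` B)"
  proof (rule card_le_dim_spanning[of _ "span (f ` B)"])
    have "dim N \<le> dim (span (f ` B))" using N dim_subset by blast
    then show "card (f ` B) \<le> dim (span (f ` B))" using card B(4) assms(4) by simp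
  qed (use fin in \<open>auto intro: span_base\<close>)
  ultimately show ?thesis
    using linear_inj_on_span_independent_image[OF assms(1)] spB by metis
qed

text \<open>The kernel of a skew map is orthogonal to its range.\<close>

lemma skew_kernel_range_trivial:
  fixes A :: "'e::euclidean_space \<Rightarrow> 'e"
  assumes skew: "\<And>a b. A a \<bullet> b = - (A b \<bullet> a)" and "A (A a) = 0"
  shows "A a = 0"
proof -
  have "A a \<bullet> A a = - (A (A a) \<bullet> a)" by (rule skew)
  then show ?thesis using assms(2) by simp
qed

text \<open>The rank of the skew map \<open>A y\<close> is constant, so its range stays transversal to the orthogonal
  complement of \<open>N = range (A y0)\<close> near \<open>y0\<close>. Hence it suffices to solve the equation projected to \<open>N\<close>, whose
  unknown may also be taken in \<open>N\<close>: there the system is invertible at \<open>y0\<close>, thus nearby.\<close>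

lemma smooth_preimage_under_skew_family:
  fixes A :: "'e::euclidean_space \<Rightarrow> 'f::euclidean_space \<Rightarrow> 'f"
  assumes V: "open V" "y0 \<in> V"
    and lin: "\<And>y. y \<in> V \<Longrightarrow> linear (A y)" and smooth: "\<And>a. smooth_open V (\<lambda>y. A y a)"
    and skew: "\<And>y a b. y \<in> V \<Longrightarrow> A y a \<bullet> b = - (A y b \<bullet> a)"
    and rank: "\<And>y. y \<in> V \<Longrightarrow> dim (range (A y)) = r"
    and k: "smooth_open V k" "\<And>y. y \<in> V \<Longrightarrow> k y \<in> range (A y)"
  shows "\<exists>U u. open U \<and> y0 \<in> U \<and> U \<subseteq> V \<and> smooth_open U u \<and> (\<forall>y\<in>U. A y (u y) = k y)"
proof -
  let ?N = "range (A y0)"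
  have subN: "subspace (range (A y))" if "y \<in> V" for y
    using lin[OF that] linear_subspace_image subspace_UNIV by blast
  obtain Q where Q: "linear Q" "\<And>x. Q x \<in> ?N" "\<And>x. x \<in> ?N \<Longrightarrow> Q x = x" "\<And>x n. n \<in> ?N \<Longrightarrow> (x - Q x) \<bullet> n = 0"
    using orthogonal_projection_exists[OF subN[OF V(2)]] by blast
  define B where "B y a = Q (A y (Q a)) + (a - Q a)" for y a
  have blQ: "bounded_linear Q" using Q(1) linear_conv_bounded_linear by blast
  have linB: "linear (B y)" if "y \<in> V" for y
    unfolding B_def using linear_compose[OF linear_compose[OF Q(1) lin[OF that]] Q(1)]
    by (intro linear_compose_add linear_compose_sub linear_ident Q(1)) (simp add: o_def)
  have smB: "smooth_open V (\<lambda>y. B y a)" for a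
    unfolding B_def by (intro smooth_open_add smooth_open_const V smooth_open_linear_compose[OF blQ] smooth)
  have unproj: "Q a = a" "Q (A y a) = n" if "B y a = n" "n \<in> ?N" for y a n
  proof -
    have "a - Q a = n - Q (A y (Q a))" using that(1) by (auto simp: B_def)
    then have "a - Q a \<in> ?N" using subspace_diff[OF subN[OF V(2)] that(2) Q(2)] by simp
    then have "(a - Q a) \<bullet> (a - Q a) = 0" by (rule Q(4))
    then show 1: "Q a = a" by simp
    then show "Q (A y a) = n" using that(1) by (simp add: B_def)
  qed
  \<comment> \<open>An \<open>a\<close> with \<open>B y0 a = 0\<close> lies in \<open>N\<close> and in the kernel of the skew map \<open>A y0\<close>.\<close>
  have "inj (B y0)"
    unfolding linear_injective_0[OF linB[OF V(2)]]
  proof (intro allI impI)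
    fix a assume "B y0 a = 0"
    moreover have "0 \<in> ?N" using subspace_0[OF subN[OF V(2)]] .
    ultimately have a: "Q a = a" "Q (A y0 a) = 0" using unproj by blast+
    then have "A y0 a = 0" using Q(3) by auto
    moreover obtain c where "a = A y0 c" using a(1) Q(2) by (metis rangeE)
    ultimately show "a = 0" using skew_kernel_range_trivial[of "A y0", OF skew[OF V(2)]] by blast
  qed
  then obtain U m where U: "open U" "y0 \<in> U" "U \<subseteq> V" "m > 0" "\<And>y a. y \<in> U \<Longrightarrow> m * norm a \<le> norm (B y a)"
    using linear_family_bounded_below_near[of V y0 B, OF V linB smooth_open_cont[OF smB]] by blast
  have surj: "\<exists>a. B y a = n" if "y \<in> U" for y n
  proof -
    have "linear (B y)" using linB U that by blast
    moreover have "inj (B y)"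
      unfolding linear_injective_0[OF \<open>linear (B y)\<close>]
    proof (intro allI impI)
      fix a assume "B y a = 0"
      then have "m * norm a \<le> 0" using U(5)[OF that, of a] by simp
      then show "a = 0" using U(4) by (simp add: mult_le_0_iff)
    qed
    ultimately show ?thesis using linear_injective_imp_surjective by (metis surjD)
  qed
  define u where "u y = (SOME a. B y a = Q (k y))" for y
  have u: "B y (u y) = Q (k y)" if "y \<in> U" for y
    unfolding u_def using someI_ex[OF surj[OF that]] .
  have "A y (u y) = k y" if y: "y \<in> U" for y
  proof -
    have yV: "y \<in> V" using y U by blast
    \<comment> \<open>\<open>Q\<close> maps the range of \<open>A y\<close> onto \<open>N\<close>, which has the same dimension. Hence the difference of
      \<open>A y (u y)\<close> and \<open>k y\<close>, killed by \<open>Q\<close>, vanishes.\<close>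
    have "inj_on Q (range (A y))"
    proof (rule linear_inj_on_of_dim[OF Q(1) subN[OF yV]])
      show "?N \<subseteq> Q ` range (A y)"
      proof
        fix n assume n: "n \<in> ?N"
        obtain a where "B y a = n" using surj[OF y] by blast
        then have "Q (A y a) = n" using unproj(2) n by blast
        then show "n \<in> Q ` range (A y)" by blast
      qed
      show "dim ?N = dim (range (A y))" using rank yV V(2) by simp
    qed
    moreover have "Q (A y (u y)) = Q (k y)" using unproj(2)[OF u[OF y] Q(2)] .
    ultimately show ?thesis using k(2)[OF yV] by (auto dest: inj_onD)
  qed
  moreover have "smooth_open U u"
    unfolding smooth_open_def
  proof (intro conjI allI)
    fix j
    have sub: "smooth_open V f \<Longrightarrow> Ck_on j U f" for f :: "'e \<Rightarrow> 'f"
      using smooth_open_subset U unfolding smooth_open_def by blast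
    show "Ck_on j U u"
      using U u linB smooth_open_linear_compose[OF blQ k(1)]
      by (intro Ck_on_linear_solution[of U B m j "\<lambda>y. Q (k y)" u] sub smB) auto
  qed (rule U)
  ultimately show ?thesis using U by blast
qed

text \<open>Here \<open>A x\<close> is the matrix of a bivector \<open>P\<close>, \<open>\<iota>\<close> an inclusion of a leaf in coordinates, and the
  hypotheses \<open>jacobi\<close> and \<open>lie\<close> express \<open>[[P,P]] = 0\<close> and \<open>L\<^sub>\<kappa>P = 0\<close>. Let \<open>\<eta>\<close> satisfy \<open>A \<eta> = \<kappa>\<close> along
  \<open>\<iota>\<close>. The pulled-back form \<open>\<Theta> = \<iota>\<^sup>*\<eta>\<close> is, up to sign, the contraction of \<open>\<kappa>\<close> with the symplectic form
  of the leaf, and has to be closed. Second derivatives of \<open>\<iota>\<close> cancel in \<open>d\<Theta>\<close>; as all vectors tangent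
  to the leaf are of the form \<open>A a\<close>, what remains contains only derivatives along the leaf, and these
  are known from differentiating \<open>A \<eta> = \<kappa>\<close>. With this equation, \<open>L\<^sub>\<kappa>P = 0\<close> reduces \<open>d\<Theta>\<close> on the pair
  \<open>A a, A b\<close> to the Jacobi identity for \<open>a, b, \<eta>\<close>.\<close>

lemma local_potential:
  fixes A :: "'f::euclidean_space \<Rightarrow> 'f \<Rightarrow> 'f" and \<iota> :: "'e::euclidean_space \<Rightarrow> 'f"
  assumes smooth: "\<And>a. smooth_open X (\<lambda>x. A x a)" "smooth_open X \<kappa>"
    and lin: "\<And>x. x \<in> X \<Longrightarrow> linear (A x)"
    and skew: "\<And>x a b. x \<in> X \<Longrightarrow> A x a \<bullet> b = - (A x b \<bullet> a)"
    and \<iota>: "smooth_open V \<iota>" "\<iota> ` V \<subseteq> X" and y0: "y0 \<in> V"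
    and jacobi: "\<And>x a b e. x \<in> \<iota> ` V \<Longrightarrow> D (\<lambda>x. A x b) x (A x a) \<bullet> e + D (\<lambda>x. A x e) x (A x b) \<bullet> a
       + D (\<lambda>x. A x a) x (A x e) \<bullet> b = 0"
    and lie: "\<And>x a b. x \<in> \<iota> ` V \<Longrightarrow> D (\<lambda>x. A x a) x (\<kappa> x) \<bullet> b = D \<kappa> x (A x a) \<bullet> b - D \<kappa> x (A x b) \<bullet> a"
    and range: "\<And>y. y \<in> V \<Longrightarrow> range (D \<iota> y) = range (A (\<iota> y))"
    and rank: "\<And>y. y \<in> V \<Longrightarrow> dim (range (A (\<iota> y))) = r"
    and tang: "\<And>y. y \<in> V \<Longrightarrow> \<kappa> (\<iota> y) \<in> range (A (\<iota> y))"
  shows "\<exists>U f \<eta>. open U \<and> y0 \<in> U \<and> U \<subseteq> V \<and> smooth_open U f \<and>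
    (\<forall>y\<in>U. A (\<iota> y) (\<eta> y) = \<kappa> (\<iota> y) \<and> (f has_derivative (\<lambda>w. \<eta> y \<bullet> D \<iota> y w)) (at y))"
proof -
  have V: "open V" using \<iota>(1) smooth_open_open by blast
  have X: "open X" using smooth(2) smooth_open_open by blast
  have smA: "smooth_open V (\<lambda>y. A (\<iota> y) a)" for a
    by (rule smooth_open_compose[OF \<iota>(1) smooth(1) \<iota>(2)])
  have sm\<kappa>: "smooth_open V (\<lambda>y. \<kappa> (\<iota> y))"
    by (rule smooth_open_compose[OF \<iota>(1) smooth(2) \<iota>(2)])
  have \<iota>X: "\<iota> y \<in> X" if "y \<in> V" for y using \<iota>(2) that by blast
  have "\<exists>U u. open U \<and> y0 \<in> U \<and> U \<subseteq> V \<and> smooth_open U u \<and> (\<forall>y\<in>U. A (\<iota> y) (u y) = \<kappa> (\<iota> y))"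
  proof (rule smooth_preimage_under_skew_family[where r = r])
    show "linear (A (\<iota> y))" if "y \<in> V" for y by (rule lin[OF \<iota>X[OF that]])
    show "A (\<iota> y) a \<bullet> b = - (A (\<iota> y) b \<bullet> a)" if "y \<in> V" for y a b by (rule skew[OF \<iota>X[OF that]])
  qed (fact V y0 smA sm\<kappa> | erule rank tang)+
  then obtain U0 \<eta> where U0: "open U0" "y0 \<in> U0" "U0 \<subseteq> V" "smooth_open U0 \<eta>"
    "\<And>y. y \<in> U0 \<Longrightarrow> A (\<iota> y) (\<eta> y) = \<kappa> (\<iota> y)" by blast
  obtain \<rho> where \<rho>: "\<rho> > 0" "ball y0 \<rho> \<subseteq> U0" using U0(1,2) open_contains_ball by blast
  let ?U = "ball y0 \<rho>"
  have UV: "y \<in> V" "y \<in> U0" if "y \<in> ?U" for y using that \<rho> U0 by auto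
  have \<eta>: "smooth_open ?U \<eta>" using smooth_open_subset[OF U0(4) \<rho>(2)] by simp
  have \<iota>U: "smooth_open ?U \<iota>" using smooth_open_subset[OF \<iota>(1), of ?U] UV by blast
  \<comment> \<open>The gradient vector of the form \<open>\<iota>\<^sup>*\<eta>\<close>: the transpose of \<open>D \<iota> y\<close> applied to \<open>\<eta> y\<close>.\<close>
  define \<Theta> where "\<Theta> y = (\<Sum>b\<in>Basis. (\<eta> y \<bullet> D \<iota> y b) *\<^sub>R b)" for y
  have \<Theta>w: "\<Theta> y \<bullet> w = \<eta> y \<bullet> D \<iota> y w" if "y \<in> ?U" for y w
    unfolding \<Theta>_def
    by (subst D_as_sum[OF \<iota>U that, of w])
      (simp add: inner_sum_left inner_sum_right inner_commute mult.commute)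
  have sm\<Theta>: "smooth_open ?U \<Theta>"
    unfolding \<Theta>_def
    by (intro smooth_open_sum smooth_open_scaleR smooth_open_inner smooth_open_const \<eta>
        smooth_open_D_smooth[OF \<iota>U] open_ball)
  have D\<Theta>: "D \<Theta> y v \<bullet> w = D \<eta> y v \<bullet> D \<iota> y w + \<eta> y \<bullet> D (\<lambda>y. D \<iota> y w) y v" if y: "y \<in> ?U" for y v w
  proof -
    have "((\<lambda>y. \<eta> y \<bullet> D \<iota> y w) has_derivative (\<lambda>v. \<eta> y \<bullet> D (\<lambda>y. D \<iota> y w) y v + D \<eta> y v \<bullet> D \<iota> y w)) (at y)"
      using y by (intro has_derivative_inner smooth_open_D[OF \<eta>] smooth_open_D[OF smooth_open_D_smooth[OF \<iota>U]])
    moreover have "((\<lambda>y. \<eta> y \<bullet> D \<iota> y w) has_derivative (\<lambda>v. D \<Theta> y v \<bullet> w)) (at y)"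
      by (rule has_derivative_transform_within_open[OF has_derivative_inner_left[OF smooth_open_D[OF sm\<Theta> y]] open_ball y])
        (simp add: \<Theta>w)
    ultimately have "(\<lambda>v. \<eta> y \<bullet> D (\<lambda>y. D \<iota> y w) y v + D \<eta> y v \<bullet> D \<iota> y w) = (\<lambda>v. D \<Theta> y v \<bullet> w)"
      by (rule has_derivative_unique)
    from fun_cong[OF this, of v] show ?thesis by simp
  qed
  have closed: "D \<Theta> y v \<bullet> w = D \<Theta> y w \<bullet> v" if y: "y \<in> ?U" for y v w
  proof -
    let ?x = "\<iota> y"
    let ?A = "A ?x"
    define T where "T a u = D (\<lambda>x. A x a) ?x u" for a u
    have xX: "?x \<in> X" using \<iota>X UV y by blast
    have xV: "?x \<in> \<iota> ` V" using UV y by blast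
    have "D \<iota> y h \<in> Set.range ?A" for h
      using range[OF UV(1)[OF y]] rangeI[of "D \<iota> y" h] by simp
    then obtain a b where a: "D \<iota> y v = ?A a" and b: "D \<iota> y w = ?A b"
      by (meson rangeE)
    have Tsum: "T c u = (\<Sum>e\<in>Basis. (c \<bullet> e) *\<^sub>R T e u)" for c u
    proof -
      have "((\<lambda>x. A x c) has_derivative (\<lambda>h. ?A 0 + (\<Sum>e\<in>Basis. (c \<bullet> e) *\<^sub>R T e h))) (at ?x)"
        unfolding T_def
        by (rule has_derivative_linear_family[OF X xX lin smooth_open_D[OF smooth(1) xX]]) auto
      from fun_cong[OF D_eqI[OF this], of u] show ?thesis
        using linear_0[OF lin[OF xX]] by (simp add: T_def)
    qed
    have Tskew: "T c u \<bullet> e = - (T e u \<bullet> c)" for c e u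
    proof -
      have 1: "((\<lambda>x. A x c \<bullet> e) has_derivative (\<lambda>u. T c u \<bullet> e)) (at ?x)" for c e
        unfolding T_def by (rule has_derivative_inner_left[OF smooth_open_D[OF smooth(1) xX]])
      have "((\<lambda>x. A x c \<bullet> e) has_derivative (\<lambda>u. - (T e u \<bullet> c))) (at ?x)"
        by (rule has_derivative_transform_within_open[OF has_derivative_minus[OF 1] X xX])
          (metis skew)
      from has_derivative_unique[OF 1 this] show ?thesis by metis
    qed
    have d: "?A (D \<eta> y h) + T (\<eta> y) (D \<iota> y h) = D \<kappa> ?x (D \<iota> y h)" for h
    proof -
      have "((\<lambda>y. A (\<iota> y) e) has_derivative (\<lambda>h. T e (D \<iota> y h))) (at y)" for e
        unfolding T_def
        using has_derivative_compose[OF smooth_open_D[OF \<iota>U y] smooth_open_D[OF smooth(1) xX]]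
        by (simp add: o_def)
      then have "((\<lambda>y. A (\<iota> y) (\<eta> y)) has_derivative
         (\<lambda>h. ?A (D \<eta> y h) + (\<Sum>e\<in>Basis. (\<eta> y \<bullet> e) *\<^sub>R T e (D \<iota> y h)))) (at y)"
        using \<iota>X[OF UV(1)] by (intro has_derivative_linear_family[OF open_ball y lin _ smooth_open_D[OF \<eta> y]]) auto
      moreover have "((\<lambda>y. A (\<iota> y) (\<eta> y)) has_derivative (\<lambda>h. D \<kappa> ?x (D \<iota> y h))) (at y)"
      proof (rule has_derivative_transform_within_open[OF _ open_ball y])
        show "((\<lambda>y. \<kappa> (\<iota> y)) has_derivative (\<lambda>h. D \<kappa> ?x (D \<iota> y h))) (at y)"
          using has_derivative_compose[OF smooth_open_D[OF \<iota>U y] smooth_open_D[OF smooth(2) xX]]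
          by (simp add: o_def)
      qed (use U0(5) UV(2) in auto)
      ultimately have "(\<lambda>h. ?A (D \<eta> y h) + (\<Sum>e\<in>Basis. (\<eta> y \<bullet> e) *\<^sub>R T e (D \<iota> y h))) = (\<lambda>h. D \<kappa> ?x (D \<iota> y h))"
        by (rule has_derivative_unique)
      from fun_cong[OF this, of h] show ?thesis
        by (simp only: Tsum[of "\<eta> y"])
    qed
    have \<kappa>: "\<kappa> ?x = ?A (\<eta> y)" using U0(5) UV(2)[OF y] by simp
    have 1: "D \<eta> y v \<bullet> ?A b = T (\<eta> y) (?A a) \<bullet> b - D \<kappa> ?x (?A a) \<bullet> b"
    proof -
      have "D \<eta> y v \<bullet> ?A b = - (?A (D \<eta> y v) \<bullet> b)" using skew[OF xX, of "D \<eta> y v" b] by (simp add: inner_commute)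
      also have "?A (D \<eta> y v) = D \<kappa> ?x (?A a) - T (\<eta> y) (?A a)" using d[of v] a by (simp add: algebra_simps)
      finally show ?thesis by (simp add: inner_diff_left)
    qed
    have 2: "D \<eta> y w \<bullet> ?A a = T (\<eta> y) (?A b) \<bullet> a - D \<kappa> ?x (?A b) \<bullet> a"
    proof -
      have "D \<eta> y w \<bullet> ?A a = - (?A (D \<eta> y w) \<bullet> a)" using skew[OF xX, of "D \<eta> y w" a] by (simp add: inner_commute)
      also have "?A (D \<eta> y w) = D \<kappa> ?x (?A b) - T (\<eta> y) (?A b)" using d[of w] b by (simp add: algebra_simps)
      finally show ?thesis by (simp add: inner_diff_left)
    qed
    have 3: "T a (?A (\<eta> y)) \<bullet> b = D \<kappa> ?x (?A a) \<bullet> b - D \<kappa> ?x (?A b) \<bullet> a"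
      using lie[OF xV, of a b] unfolding T_def \<kappa> .
    have 4: "T b (?A a) \<bullet> \<eta> y + T (\<eta> y) (?A b) \<bullet> a + T a (?A (\<eta> y)) \<bullet> b = 0"
      using jacobi[OF xV, of b a "\<eta> y"] unfolding T_def .
    have "D \<eta> y v \<bullet> D \<iota> y w = D \<eta> y w \<bullet> D \<iota> y v"
      unfolding a b 1 2 using 3 4 Tskew[of b "?A a" "\<eta> y"] by linarith
    then show ?thesis
      using D\<Theta>[OF y] second_derivative_symmetric[OF \<iota>U y, of v w] by simp
  qed
  obtain f where f: "smooth_open ?U f" "\<And>y. y \<in> ?U \<Longrightarrow> (f has_derivative (\<lambda>w. \<Theta> y \<bullet> w)) (at y)"
    using closed_one_form_has_potential[OF sm\<Theta> \<rho>(1) closed] by blast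
  have "A (\<iota> y) (\<eta> y) = \<kappa> (\<iota> y) \<and> (f has_derivative (\<lambda>w. \<eta> y \<bullet> D \<iota> y w)) (at y)" if "y \<in> ?U" for y
    using f(2)[OF that] \<Theta>w[OF that] U0(5)[OF UV(2)[OF that]] by simp
  then show ?thesis using f(1) \<rho>(1) UV(1) by (intro exI[of _ ?U] exI[of _ f] exI[of _ \<eta>]) auto
qed

section \<open>Smoothness on coordinate subspaces\<close>

text \<open>Precomposition with the projection onto the model space turns functions on relatively open
  subsets of it into functions on open sets, with the same derivatives along the model space.\<close>

definition coord_proj :: "'e::euclidean_space set \<Rightarrow> 'e \<Rightarrow> 'e" where
  "coord_proj E x = (\<Sum>b\<in>E. (x \<bullet> b) *\<^sub>R b)"

lemma coord_proj_linear: "bounded_linear (coord_proj E)"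
  unfolding coord_proj_def by (intro bounded_linear_sum bounded_linear_scaleR_const bounded_linear_inner_left)

lemma coord_proj_in: "coord_proj E x \<in> span E"
  unfolding coord_proj_def by (intro span_sum span_scale span_base)

lemma coord_proj_id:
  assumes "E \<subseteq> Basis" "x \<in> span E"
  shows "coord_proj E x = x"
  using assms(2)
proof (induction rule: span_induct_alt)
  case base
  then show ?case by (simp add: coord_proj_def)
next
  case (step c b y)
  have "finite E" using assms(1) finite_subset finite_Basis by blast
  have "(\<Sum>a\<in>E. (b \<bullet> a) *\<^sub>R a) = (\<Sum>a\<in>E. if a = b then b else 0)"
    using assms(1) step(1) by (intro sum.cong) (auto simp: subset_iff inner_Basis)
  also have "\<dots> = b" using \<open>finite E\<close> step(1) by simp
  finally have "coord_proj E b = b" by (simp add: coord_proj_def)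
  moreover have "linear (coord_proj E)" using coord_proj_linear bounded_linear.linear by blast
  ultimately show ?case using step(2) by (simp add: linear_add linear_cmul)
qed

lemma smooth_on_retract:
  assumes "smooth_on X F" "bounded_linear r" "open X'" "r ` X' \<subseteq> X"
  shows "smooth_open X' (\<lambda>x. F (r x))"
  unfolding smooth_open_def
proof (intro conjI allI)
  fix k
  show "Ck_on k X' (\<lambda>x. F (r x))"
  proof (rule Ck_on_local)
    fix x assume x: "x \<in> X'"
    then have "r x \<in> X" using assms(4) by blast
    from assms(1)[unfolded smooth_on_def, rule_format, OF this]
    obtain U h where U: "open U" "r x \<in> U" "\<And>k. Ck_on k U h" "\<And>y. y \<in> X \<inter> U \<Longrightarrow> h y = F y"
      by blast
    have op: "open (X' \<inter> r -` U)"
      using assms(2,3) U(1) linear_continuous_on by (intro continuous_open_preimage) auto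
    have "Ck_on k (X' \<inter> r -` U) (\<lambda>x. h (r x))"
      using op U Ck_on_bounded_linear[OF assms(2)] by (intro Ck_on_compose[where Y = U and f = r and g = h]) auto
    then have "Ck_on k (X' \<inter> r -` U) (\<lambda>x. F (r x))"
      by (rule Ck_on_cong[OF op, rotated]) (use U(4) assms(4) in auto)
    then show "\<exists>U. open U \<and> x \<in> U \<and> Ck_on k U (\<lambda>x. F (r x))"
      using op x U(2) by blast
  qed
qed (rule assms)

lemma smooth_on_compose_open:
  assumes "smooth_on X F" "smooth_open Y G" "F ` X \<subseteq> Y"
  shows "smooth_on X (G \<circ> F)"
  unfolding smooth_on_def
proof
  fix x assume x: "x \<in> X"
  from assms(1)[unfolded smooth_on_def, rule_format, OF this]
  obtain U h where U: "open U" "x \<in> U" "\<And>k. Ck_on k U h" "\<And>y. y \<in> X \<inter> U \<Longrightarrow> h y = F y"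
    by blast
  have "Ck_on 0 U h" by (rule U(3))
  then have op: "open (U \<inter> h -` Y)"
    using U(1) smooth_open_open[OF assms(2)] continuous_open_preimage by auto
  have "Ck_on k (U \<inter> h -` Y) (\<lambda>x. G (h x))" for k
    using op assms(2) Ck_on_subset[OF U(3)]
    by (intro Ck_on_compose[where Y = Y and f = h and g = G]) (auto simp: smooth_open_def)
  moreover have "x \<in> U \<inter> h -` Y" using U x assms(3) by auto
  ultimately show "\<exists>U h. open U \<and> x \<in> U \<and> (\<forall>k. Ck_on k U h) \<and> (\<forall>y\<in>X \<inter> U. h y = (G \<circ> F) y)"
    using op U(4) by (intro exI[of _ "U \<inter> h -` Y"] exI[of _ "\<lambda>x. G (h x)"]) auto
qed

text \<open>The cylinder over a subset of the model space.\<close>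

definition ambient :: "'e::euclidean_space set \<Rightarrow> 'e set \<Rightarrow> 'e set" where
  "ambient E X = coord_proj E -` X"

lemma ambient_open:
  assumes "openin (top_of_set (span E)) X"
  shows "open (ambient E X)"
proof -
  obtain T where T: "open T" "X = span E \<inter> T" using assms openin_open by metis
  have "ambient E X = coord_proj E -` T" using T(2) coord_proj_in by (auto simp: ambient_def)
  then show ?thesis
    using continuous_open_vimage[OF T(1)] coord_proj_linear linear_continuous_at by metis
qed

lemma ambient_image: "coord_proj E ` ambient E X \<subseteq> X"
  by (auto simp: ambient_def)

lemma ambient_superset: "E \<subseteq> Basis \<Longrightarrow> X \<subseteq> span E \<Longrightarrow> X \<subseteq> ambient E X"
  by (auto simp: ambient_def coord_proj_id subset_iff)

definition extend :: "'e::euclidean_space set \<Rightarrow> ('e \<Rightarrow> 'f) \<Rightarrow> 'e \<Rightarrow> 'f" where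
  "extend E F x = F (coord_proj E x)"

lemma smooth_extend:
  assumes "openin (top_of_set (span E)) X" "smooth_on X F"
  shows "smooth_open (ambient E X) (extend E F)"
  unfolding extend_def[abs_def]
  using smooth_on_retract[OF assms(2) coord_proj_linear ambient_open[OF assms(1)] ambient_image] .

text \<open>Curves within the model space do not see the extension, so the chain rule for \<open>extend E F\<close>, which
is smooth on an open set, is one for \<open>F\<close>.\<close>

lemma dir_deriv_curve:
  fixes F :: "'e::euclidean_space \<Rightarrow> 'f::euclidean_space"
  assumes E: "E \<subseteq> Basis" and X: "openin (top_of_set (span E)) X" and F: "smooth_on X F"
    and \<gamma>: "(\<gamma> has_vector_derivative \<gamma>') (at t0)" "\<gamma> t0 \<in> X" "\<forall>\<^sub>F t in nhds t0. \<gamma> t \<in> span E"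
  shows "((\<lambda>t. F (\<gamma> t)) has_vector_derivative D (extend E F) (\<gamma> t0) \<gamma>') (at t0)"
proof -
  have XE: "X \<subseteq> span E" using X by (rule openin_imp_subset)
  have amb: "\<gamma> t0 \<in> ambient E X" using \<gamma>(2) ambient_superset[OF E XE] by blast
  have "((\<lambda>t. extend E F (\<gamma> t)) has_derivative (\<lambda>h. D (extend E F) (\<gamma> t0) (h *\<^sub>R \<gamma>'))) (at t0)"
    using has_derivative_compose[OF \<gamma>(1)[unfolded has_vector_derivative_def]
      smooth_open_D[OF smooth_extend[OF X F] amb]] by (simp add: o_def)
  then have 1: "((\<lambda>t. extend E F (\<gamma> t)) has_vector_derivative D (extend E F) (\<gamma> t0) \<gamma>') (at t0)"
    using linear_cmul[OF smooth_open_linear_D[OF smooth_extend[OF X F] amb]]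
    by (simp add: has_vector_derivative_def)
  obtain S where S: "open S" "t0 \<in> S" "\<And>t. t \<in> S \<Longrightarrow> \<gamma> t \<in> span E"
    using \<gamma>(3) unfolding eventually_nhds by blast
  show ?thesis
    using has_vector_derivative_transform_within_open[OF 1 S(1,2)] S(3) coord_proj_id[OF E]
    by (simp add: extend_def)
qed

lemma dir_deriv_eq:
  fixes F :: "'e::euclidean_space \<Rightarrow> 'f::euclidean_space"
  assumes E: "E \<subseteq> Basis" and X: "openin (top_of_set (span E)) X" and F: "smooth_on X F"
    and x: "x \<in> X" "v \<in> span E"
  shows "dir_deriv F x v = D (extend E F) x v"
proof -
  have "((\<lambda>t. F (x + t *\<^sub>R v)) has_vector_derivative D (extend E F) (x + 0 *\<^sub>R v) v) (at 0)"
  proof (rule dir_deriv_curve[OF E X F])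
    show "((\<lambda>t. x + t *\<^sub>R v) has_vector_derivative v) (at 0)"
      by (auto intro!: derivative_eq_intros)
    have "x \<in> span E" using x openin_imp_subset[OF X] by blast
    then show "\<forall>\<^sub>F t in nhds 0. x + t *\<^sub>R v \<in> span E"
      using x by (intro always_eventually allI span_add span_scale)
  qed (use x in simp)
  then show ?thesis unfolding dir_deriv_def by (simp add: vector_derivative_at)
qed

lemma dir_deriv_linear:
  fixes F :: "'e::euclidean_space \<Rightarrow> 'f::euclidean_space"
  assumes "E \<subseteq> Basis" "openin (top_of_set (span E)) X" "smooth_on X F" "x \<in> X" "v \<in> span E" "w \<in> span E"
  shows "dir_deriv F x (r *\<^sub>R v + s *\<^sub>R w) = r *\<^sub>R dir_deriv F x v + s *\<^sub>R dir_deriv F x w"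
proof -
  have "X \<subseteq> span E" using assms(2) by (rule openin_imp_subset)
  then have "linear (D (extend E F) x)"
    using smooth_open_linear_D[OF smooth_extend[OF assms(2,3)]] ambient_superset[OF assms(1)] assms(4) by blast
  then show ?thesis
    using dir_deriv_eq[OF assms(1-4)] assms(5,6)
    by (simp add: span_add span_scale linear_add linear_cmul)
qed

lemma dir_deriv_cong:
  assumes X: "openin (top_of_set (span E)) X" and eq: "\<And>y. y \<in> X \<Longrightarrow> F y = G y"
    and x: "x \<in> X" "v \<in> span E"
  shows "dir_deriv F x v = dir_deriv G x v"
proof -
  obtain T where T: "open T" "X = span E \<inter> T" using X openin_open by metis
  have "open ((\<lambda>t. x + t *\<^sub>R v) -` T)"
    by (intro continuous_open_vimage T continuous_intros)
  moreover have "0 \<in> (\<lambda>t. x + t *\<^sub>R v) -` T" using T x by simp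
  moreover have "F (x + t *\<^sub>R v) = G (x + t *\<^sub>R v)" if "t \<in> (\<lambda>t. x + t *\<^sub>R v) -` T" for t
    using that x T by (intro eq) (auto intro: span_add span_scale)
  ultimately have "\<forall>\<^sub>F t in nhds 0. F (x + t *\<^sub>R v) = G (x + t *\<^sub>R v)"
    unfolding eventually_nhds by blast
  then show ?thesis unfolding dir_deriv_def by (intro vector_derivative_cong_eq) auto
qed

lemma dir_deriv_chain:
  fixes F :: "'e::euclidean_space \<Rightarrow> 'f::euclidean_space" and G :: "'f \<Rightarrow> 'g::euclidean_space"
  assumes E: "E \<subseteq> Basis" "E' \<subseteq> Basis" and X: "openin (top_of_set (span E)) X" and F: "smooth_on X F"
    and Y: "openin (top_of_set (span E')) Y" and G: "smooth_on Y G"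
    and x: "x \<in> X" "v \<in> span E" "F x \<in> Y" "F ` X \<subseteq> span E'"
  shows "dir_deriv (G \<circ> F) x v = dir_deriv G (F x) (dir_deriv F x v)" (is ?thesis1)
    and "dir_deriv F x v \<in> span E'" (is ?thesis2)
proof -
  obtain T where T: "open T" "X = span E \<inter> T" using X openin_open by metis
  define S where "S = (\<lambda>t. x + t *\<^sub>R v) -` T"
  have S: "open S" "0 \<in> S" unfolding S_def
    using T x by (auto intro!: continuous_open_vimage continuous_intros)
  have SX: "x + t *\<^sub>R v \<in> X" if "t \<in> S" for t
    using that x T by (auto simp: S_def intro: span_add span_scale)
  have 1: "((\<lambda>t. F (x + t *\<^sub>R v)) has_vector_derivative D (extend E F) (x + 0 *\<^sub>R v) v) (at 0)"
  proof (rule dir_deriv_curve[OF E(1) X F])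
    show "((\<lambda>t. x + t *\<^sub>R v) has_vector_derivative v) (at 0)"
      by (auto intro!: derivative_eq_intros)
    show "\<forall>\<^sub>F t in nhds 0. x + t *\<^sub>R v \<in> span E"
      unfolding eventually_nhds using S SX openin_imp_subset[OF X] by blast
  qed (use x in simp)
  then have 1: "((\<lambda>t. F (x + t *\<^sub>R v)) has_vector_derivative dir_deriv F x v) (at 0)"
    using dir_deriv_eq[OF E(1) X F x(1,2)] by simp
  have ev: "\<forall>\<^sub>F t in nhds 0. F (x + t *\<^sub>R v) \<in> span E'"
    unfolding eventually_nhds using S SX x(4) by blast
  have "((\<lambda>t. coord_proj E' (F (x + t *\<^sub>R v))) has_vector_derivative coord_proj E' (dir_deriv F x v)) (at 0)"
    using bounded_linear.has_vector_derivative[OF coord_proj_linear 1] .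
  moreover have "((\<lambda>t. coord_proj E' (F (x + t *\<^sub>R v))) has_vector_derivative dir_deriv F x v) (at 0)"
    by (rule has_vector_derivative_transform_within_open[OF 1 S])
      (use SX x(4) coord_proj_id[OF E(2)] in \<open>auto simp: image_subset_iff\<close>)
  ultimately have "coord_proj E' (dir_deriv F x v) = dir_deriv F x v"
    using vector_derivative_unique_at by blast
  then show 2: ?thesis2 using coord_proj_in by metis
  have "((\<lambda>t. G (F (x + t *\<^sub>R v))) has_vector_derivative D (extend E' G) (F (x + 0 *\<^sub>R v)) (dir_deriv F x v)) (at 0)"
    by (rule dir_deriv_curve[OF E(2) Y G 1 _ ev]) (use x in simp)
  then have "dir_deriv (G \<circ> F) x v = D (extend E' G) (F x) (dir_deriv F x v)"
    unfolding dir_deriv_def[of "G \<circ> F"] by (simp add: vector_derivative_at)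
  then show ?thesis1 using dir_deriv_eq[OF E(2) Y G x(3) 2] by simp
qed

section \<open>Charts and tangent vectors\<close>

lemma chart_open: "smooth_manifold M \<Longrightarrow> c \<in> atlas M \<Longrightarrow> openin (mtop M) (fst c)"
  by (simp add: smooth_manifold_def)

lemma model_Basis: "smooth_manifold M \<Longrightarrow> model M \<subseteq> Basis"
  by (simp add: smooth_manifold_def)

lemma chart_homeo: "smooth_manifold M \<Longrightarrow> c \<in> atlas M \<Longrightarrow>
   homeomorphic_map (subtopology (mtop M) (fst c)) (top_of_set (snd c ` fst c)) (snd c)"
  by (simp add: smooth_manifold_def)

lemma chart_subset: "smooth_manifold M \<Longrightarrow> c \<in> atlas M \<Longrightarrow> fst c \<subseteq> carrier M"
  using chart_open openin_subset by blast

lemma chart_inj: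
  assumes "smooth_manifold M" "c \<in> atlas M"
  shows "inj_on (snd c) (fst c)"
  using homeomorphic_imp_injective_map[OF chart_homeo[OF assms]] chart_subset[OF assms]
  by (simp add: inf.absorb_iff2)

lemma chart_inv_chart [simp]:
  "smooth_manifold M \<Longrightarrow> c \<in> atlas M \<Longrightarrow> p \<in> fst c \<Longrightarrow> chart_inv c (snd c p) = p"
  unfolding chart_inv_def using chart_inj by (metis inv_into_f_f)

lemma chart_image_open:
  assumes "smooth_manifold M" "c \<in> atlas M" "openin (mtop M) U"
  shows "openin (top_of_set (span (model M))) (snd c ` (fst c \<inter> U))"
proof -
  have "openin (subtopology (mtop M) (fst c)) (fst c \<inter> U)"
    using assms(3) by (metis inf_commute openin_subtopology_Int)
  then have "openin (top_of_set (snd c ` fst c)) (snd c ` (fst c \<inter> U))"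
    using homeomorphic_imp_open_map[OF chart_homeo[OF assms(1,2)]] by (simp add: open_map_def)
  moreover have "openin (top_of_set (span (model M))) (snd c ` fst c)"
    using assms(1,2) by (simp add: smooth_manifold_def)
  ultimately show ?thesis by (meson openin_trans)
qed

lemma chart_preimage_open:
  assumes "smooth_manifold M" "c \<in> atlas M" "open T"
  shows "openin (mtop M) {p \<in> fst c. snd c p \<in> T}"
proof -
  have "continuous_map (subtopology (mtop M) (fst c)) euclidean (snd c)"
    using homeomorphic_imp_continuous_map[OF chart_homeo[OF assms(1,2)]]
    by (simp add: continuous_map_in_subtopology)
  then have "openin (subtopology (mtop M) (fst c)) {p \<in> topspace (subtopology (mtop M) (fst c)). snd c p \<in> T}"
    using assms(3) openin_continuous_map_preimage by fastforce
  moreover have "topspace (subtopology (mtop M) (fst c)) = fst c"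
    using chart_subset[OF assms(1,2)] by auto
  ultimately show ?thesis
    using openin_trans_full[OF _ chart_open[OF assms(1,2)]] by metis
qed

lemma charts_atD: "c \<in> charts_at M p \<Longrightarrow> c \<in> atlas M" "c \<in> charts_at M p \<Longrightarrow> p \<in> fst c"
  by (auto simp: charts_at_def)

lemma charts_at_nonempty: "smooth_manifold M \<Longrightarrow> p \<in> carrier M \<Longrightarrow> \<exists>c. c \<in> charts_at M p"
  unfolding smooth_manifold_def charts_at_def by blast

lemma chart_in_span: "smooth_manifold M \<Longrightarrow> c \<in> charts_at M p \<Longrightarrow> snd c p \<in> span (model M)"
  using openin_imp_subset[OF chart_image_open[of M c "topspace (mtop M)"]] charts_atD[of c M p]
    chart_subset[of M c] by auto

text \<open>The largest set on which the coordinate representation of \<open>f\<close> in the charts \<open>c\<close>, \<open>d\<close> is meaningful: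
  outside of it, \<open>chart_inv c\<close> or \<open>snd d\<close> takes arbitrary values.\<close>

definition overlap :: "('a, 'e) chart \<Rightarrow> ('b, 'f) chart \<Rightarrow> ('a \<Rightarrow> 'b) \<Rightarrow> 'e set" where
  "overlap c d f = snd c ` {q \<in> fst c. f q \<in> fst d}"

lemma overlap_open:
  assumes "smooth_manifold M" "smooth_manifold N" "smooth_map M N f" "c \<in> atlas M" "d \<in> atlas N"
  shows "openin (top_of_set (span (model M))) (overlap c d f)"
proof -
  have "openin (mtop M) {q \<in> carrier M. f q \<in> fst d}"
    by (rule openin_continuous_map_preimage[OF _ chart_open[OF assms(2,5)]])
      (use assms(3) in \<open>simp add: smooth_map_def\<close>)
  from chart_image_open[OF assms(1,4) this]
  have "openin (top_of_set (span (model M))) (snd c ` (fst c \<inter> {q \<in> carrier M. f q \<in> fst d}))" .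
  moreover have "fst c \<inter> {q \<in> carrier M. f q \<in> fst d} = {q \<in> fst c. f q \<in> fst d}"
    using chart_subset[OF assms(1,4)] by auto
  ultimately show ?thesis by (simp add: overlap_def)
qed

lemma overlap_smooth:
  assumes "smooth_map M N f" "c \<in> atlas M" "d \<in> atlas N"
  shows "smooth_on (overlap c d f) (snd d \<circ> f \<circ> chart_inv c)"
  using assms by (auto simp: smooth_map_def overlap_def)

lemma smooth_map_id: "smooth_manifold M \<Longrightarrow> smooth_map M M id"
proof -
  assume M: "smooth_manifold M"
  have "{p \<in> fst c. id p \<in> fst d} = fst c \<inter> fst d" for c d :: "'a set \<times> ('a \<Rightarrow> 'b)" by auto
  then show ?thesis using M unfolding smooth_map_def smooth_manifold_def by auto
qed

lemma overlap_mem: "c \<in> charts_at M p \<Longrightarrow> d \<in> charts_at N (f p) \<Longrightarrow> snd c p \<in> overlap c d f"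
  by (auto simp: charts_at_def overlap_def)

text \<open>With one or both maps equal to the identity this also contains the compatibility of derivatives
with changes of charts.\<close>

lemma chart_chain_rule:
  fixes M :: "('a, 'e::euclidean_space) manifold" and N :: "('b, 'f::euclidean_space) manifold"
    and L :: "('c, 'g::euclidean_space) manifold"
  assumes mf: "smooth_manifold M" "smooth_manifold N" "smooth_manifold L"
    and f: "smooth_map M N f" and g: "smooth_map N L g"
    and c: "c \<in> charts_at M p" and d: "d \<in> charts_at N (f p)" and e: "e \<in> charts_at L (g (f p))"
    and v: "v \<in> span (model M)"
  shows "dir_deriv (snd e \<circ> (g \<circ> f) \<circ> chart_inv c) (snd c p) v =
      dir_deriv (snd e \<circ> g \<circ> chart_inv d) (snd d (f p)) (dir_deriv (snd d \<circ> f \<circ> chart_inv c) (snd c p) v)"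
    (is ?thesis1)
    and "dir_deriv (snd d \<circ> f \<circ> chart_inv c) (snd c p) v \<in> span (model N)" (is ?thesis2)
proof -
  note at = charts_atD[OF c] charts_atD[OF d] charts_atD[OF e]
  let ?F = "snd d \<circ> f \<circ> chart_inv c" and ?G = "snd e \<circ> g \<circ> chart_inv d"
  let ?X = "overlap c d f" and ?Y = "overlap d e g"
  have x: "snd c p \<in> ?X" by (rule overlap_mem[where f = f, OF c d])
  have inv: "chart_inv c (snd c p) = p" using chart_inv_chart[OF mf(1) at(1,2)] .
  have y: "?F (snd c p) \<in> ?Y" using overlap_mem[where f = g, OF d e] inv by simp
  have sub: "?F ` ?X \<subseteq> span (model N)"
  proof -
    have "?F z \<in> span (model N)" if z: "z \<in> ?X" for z
    proof -
      obtain q where q: "q \<in> fst c" "f q \<in> fst d" "z = snd c q" using z by (auto simp: overlap_def)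
      then show ?thesis
        using chart_inv_chart[OF mf(1) at(1) q(1)] chart_in_span[OF mf(2), of d "f q"] at(3)
        by (simp add: charts_at_def)
    qed
    then show ?thesis by blast
  qed
  have "dir_deriv (?G \<circ> ?F) (snd c p) v = dir_deriv ?G (?F (snd c p)) (dir_deriv ?F (snd c p) v)"
    and 2: "dir_deriv ?F (snd c p) v \<in> span (model N)"
    using dir_deriv_chain[OF model_Basis[OF mf(1)] model_Basis[OF mf(2)]
      overlap_open[OF mf(1,2) f at(1,3)] overlap_smooth[OF f at(1,3)]
      overlap_open[OF mf(2,3) g at(3,5)] overlap_smooth[OF g at(3,5)] x v y sub] by blast+
  moreover have "dir_deriv (snd e \<circ> (g \<circ> f) \<circ> chart_inv c) (snd c p) v = dir_deriv (?G \<circ> ?F) (snd c p) v"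
  proof (rule dir_deriv_cong[OF overlap_open[OF mf(1,2) f at(1,3)] _ x v])
    fix z assume "z \<in> ?X"
    then obtain q where q: "q \<in> fst c" "f q \<in> fst d" "z = snd c q" by (auto simp: overlap_def)
    then show "(snd e \<circ> (g \<circ> f) \<circ> chart_inv c) z = (?G \<circ> ?F) z"
      using chart_inv_chart[OF mf(1) at(1) q(1)] chart_inv_chart[OF mf(2) at(3) q(2)] by simp
  qed
  ultimately show ?thesis1 ?thesis2 using inv by auto
qed

lemma transition_in_span:
  assumes "smooth_manifold M" "c \<in> charts_at M p" "d \<in> charts_at M p" "w \<in> span (model M)"
  shows "dir_deriv (snd d \<circ> chart_inv c) (snd c p) w \<in> span (model M)"
  using chart_chain_rule(2)[OF assms(1,1,1) smooth_map_id[OF assms(1)] smooth_map_id[OF assms(1)] assms(2), of d d w] assms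
  by (simp add: comp_def)

lemma transition_cocycle:
  assumes "smooth_manifold M" "c \<in> charts_at M p" "d \<in> charts_at M p" "e \<in> charts_at M p" "w \<in> span (model M)"
  shows "dir_deriv (snd e \<circ> chart_inv c) (snd c p) w =
    dir_deriv (snd e \<circ> chart_inv d) (snd d p) (dir_deriv (snd d \<circ> chart_inv c) (snd c p) w)"
  using chart_chain_rule(1)[OF assms(1,1,1) smooth_map_id[OF assms(1)] smooth_map_id[OF assms(1)] assms(2), of d e w] assms
  by (simp add: comp_def)

lemma transition_self:
  assumes "smooth_manifold M" "c \<in> charts_at M p" "w \<in> span (model M)"
  shows "dir_deriv (snd c \<circ> chart_inv c) (snd c p) w = w"
proof -
  note at = charts_atD[OF assms(2)]
  have "dir_deriv (snd c \<circ> chart_inv c) (snd c p) w = dir_deriv (\<lambda>x. x) (snd c p) w"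
  proof (rule dir_deriv_cong[OF chart_image_open[OF assms(1) at(1) openin_topspace] _ _ assms(3)])
    show "(snd c \<circ> chart_inv c) y = y" if "y \<in> snd c ` (fst c \<inter> carrier M)" for y
      using that chart_inv_chart[OF assms(1) at(1)] by auto
    show "snd c p \<in> snd c ` (fst c \<inter> carrier M)"
      using at chart_subset[OF assms(1)] by blast
  qed
  also have "\<dots> = w"
    unfolding dir_deriv_def by (rule vector_derivative_at) (auto intro!: derivative_eq_intros)
  finally show ?thesis .
qed

lemma tangent_transition:
  "v \<in> tangent_space M p \<Longrightarrow> c \<in> charts_at M p \<Longrightarrow> d \<in> charts_at M p \<Longrightarrow>
    v d = dir_deriv (snd d \<circ> chart_inv c) (snd c p) (v c)"
  unfolding tangent_space_def by blast

lemma tangent_in_span: "v \<in> tangent_space M p \<Longrightarrow> c \<in> charts_at M p \<Longrightarrow> v c \<in> span (model M)"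
  unfolding tangent_space_def by blast

text \<open>The cocycle identity makes the coordinate formula a compatible family, so that evaluation in a chart
identifies the tangent space with the model space.\<close>

lemma coord_vector_tangent:
  assumes "smooth_manifold M" "c \<in> charts_at M p" "w \<in> span (model M)"
  shows "coord_vector M c p w \<in> tangent_space M p" "coord_vector M c p w c = w"
proof -
  let ?v = "coord_vector M c p w"
  have v: "?v d = dir_deriv (snd d \<circ> chart_inv c) (snd c p) w" if "d \<in> charts_at M p" for d
    unfolding coord_vector_def using that by (rule if_P)
  show "?v c = w" unfolding v[OF assms(2)] by (rule transition_self[OF assms])
  show "?v \<in> tangent_space M p"
    unfolding tangent_space_def mem_Collect_eq
  proof (intro conjI ballI allI impI)
    fix d assume d: "d \<in> charts_at M p"
    show "?v d \<in> span (model M)"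
      unfolding v[OF d] by (rule transition_in_span[OF assms(1,2) d assms(3)])
    fix e assume e: "e \<in> charts_at M p"
    show "?v e = dir_deriv (snd e \<circ> chart_inv d) (snd d p) (?v d)"
      unfolding v[OF d] v[OF e] by (rule transition_cocycle[OF assms(1,2) d e assms(3)])
  qed (simp add: coord_vector_def)
qed

lemma tangent_eq_coord_vector:
  assumes "v \<in> tangent_space M p" "c \<in> charts_at M p"
  shows "v = coord_vector M c p (v c)"
proof
  fix d show "v d = coord_vector M c p (v c) d"
  proof (cases "d \<in> charts_at M p")
    case True
    then show ?thesis using tangent_transition[OF assms True] by (simp add: coord_vector_def)
  next
    case False
    then have "v d = 0" using assms(1) unfolding tangent_space_def by blast
    then show ?thesis using False by (simp add: coord_vector_def)
  qed
qed

lemma tangent_eqI: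
  assumes "v \<in> tangent_space M p" "w \<in> tangent_space M p" "c \<in> charts_at M p" "v c = w c"
  shows "v = w"
  using tangent_eq_coord_vector[OF assms(1,3)] tangent_eq_coord_vector[OF assms(2,3)] assms(4) by simp

lemma tangent_lincomb:
  assumes M: "smooth_manifold M" and "v \<in> tangent_space M p" "w \<in> tangent_space M p"
  shows "(\<lambda>x. r *\<^sub>R v x + s *\<^sub>R w x) \<in> tangent_space M p"
proof -
  have "dir_deriv (snd d \<circ> chart_inv c) (snd c p) (r *\<^sub>R v c + s *\<^sub>R w c) =
    r *\<^sub>R dir_deriv (snd d \<circ> chart_inv c) (snd c p) (v c) + s *\<^sub>R dir_deriv (snd d \<circ> chart_inv c) (snd c p) (w c)"
    if c: "c \<in> charts_at M p" and d: "d \<in> charts_at M p" for c d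
  proof (rule dir_deriv_linear[OF model_Basis[OF M] overlap_open[OF M M smooth_map_id[OF M] charts_atD(1)[OF c] charts_atD(1)[OF d]]])
    show "smooth_on (overlap c d id) (snd d \<circ> chart_inv c)"
      using overlap_smooth[OF smooth_map_id[OF M] charts_atD(1)[OF c] charts_atD(1)[OF d]] by simp
    show "snd c p \<in> overlap c d id" using overlap_mem[where f = id and N = M, OF c] d by simp
  qed (rule tangent_in_span[OF assms(2) c] tangent_in_span[OF assms(3) c])+
  note lin = this
  have 1: "r *\<^sub>R v d + s *\<^sub>R w d =
      dir_deriv (snd d \<circ> chart_inv c) (snd c p) (r *\<^sub>R v c + s *\<^sub>R w c)"
    if "c \<in> charts_at M p" "d \<in> charts_at M p" for c d
    by (simp only: lin[OF that] tangent_transition[OF assms(2) that] tangent_transition[OF assms(3) that])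
  have 2: "r *\<^sub>R v c + s *\<^sub>R w c \<in> span (model M)" if "c \<in> charts_at M p" for c
    using tangent_in_span[OF assms(2) that] tangent_in_span[OF assms(3) that] by (intro span_add span_scale)
  have 3: "v c = 0" "w c = 0" if "c \<notin> charts_at M p" for c
    using assms(2,3) that unfolding tangent_space_def by blast+
  show ?thesis unfolding tangent_space_def mem_Collect_eq
  proof (intro conjI ballI allI impI)
    fix c d assume "c \<in> charts_at M p" "d \<in> charts_at M p"
    then show "r *\<^sub>R v d + s *\<^sub>R w d = dir_deriv (snd d \<circ> chart_inv c) (snd c p) (r *\<^sub>R v c + s *\<^sub>R w c)"
      by (rule 1)
  qed (simp_all add: 2 3)
qed

lemma tangent_zero:
  assumes "smooth_manifold M" "c \<in> charts_at M p"
  shows "(\<lambda>_. 0) \<in> tangent_space M p"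
proof -
  have "coord_vector M c p 0 \<in> tangent_space M p"
    by (rule coord_vector_tangent(1)[OF assms span_0])
  from tangent_lincomb[OF assms(1) this this, of 0 0] show ?thesis by simp
qed

lemma smooth_on_subset:
  assumes "smooth_on X F" "Y \<subseteq> X"
  shows "smooth_on Y F"
  unfolding smooth_on_def
proof
  fix x assume "x \<in> Y"
  then have "x \<in> X" using assms(2) by blast
  from assms(1)[unfolded smooth_on_def, rule_format, OF this]
  obtain U h where U: "open U" "x \<in> U" "\<forall>k. Ck_on k U h" "\<forall>y\<in>X \<inter> U. h y = F y"
    by blast
  then have "\<forall>y\<in>Y \<inter> U. h y = F y" using assms(2) by auto
  then show "\<exists>U h. open U \<and> x \<in> U \<and> (\<forall>k. Ck_on k U h) \<and> (\<forall>y\<in>Y \<inter> U. h y = F y)"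
    using U by (intro exI[of _ U] exI[of _ h]) simp
qed

text \<open>The chart selected in the definition may be replaced by any other one, since the change of charts
acts on the two factors of the chain rule in opposite ways.\<close>

lemma differential_chart:
  assumes mf: "smooth_manifold M" "smooth_manifold N" and f: "smooth_map M N f"
    and c: "c \<in> charts_at M p" and d: "d \<in> charts_at N (f p)" and v: "v \<in> tangent_space M p"
  shows "differential M N f p v d = dir_deriv (snd d \<circ> f \<circ> chart_inv c) (snd c p) (v c)"
proof -
  define c0 where "c0 = (SOME c. c \<in> charts_at M p)"
  have c0: "c0 \<in> charts_at M p" unfolding c0_def using c by (rule someI)
  have "differential M N f p v d = dir_deriv (snd d \<circ> f \<circ> chart_inv c0) (snd c0 p) (v c0)"
    unfolding differential_def Let_def c0_def[symmetric] using d by simp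
  also have "\<dots> = dir_deriv (snd d \<circ> f \<circ> chart_inv c) (snd c p) (dir_deriv (snd c \<circ> chart_inv c0) (snd c0 p) (v c0))"
    using chart_chain_rule(1)[OF mf(1,1,2) smooth_map_id[OF mf(1)] f c0, of c d, simplified, OF c d tangent_in_span[OF v c0]]
    by (simp add: comp_def)
  also have "dir_deriv (snd c \<circ> chart_inv c0) (snd c0 p) (v c0) = v c"
    by (rule tangent_transition[OF v c0 c, symmetric])
  finally show ?thesis .
qed

lemma differential_tangent:
  assumes mf: "smooth_manifold M" "smooth_manifold N" and f: "smooth_map M N f"
    and p: "p \<in> carrier M" and v: "v \<in> tangent_space M p"
  shows "differential M N f p v \<in> tangent_space N (f p)"
proof -
  obtain c where c: "c \<in> charts_at M p" using charts_at_nonempty[OF mf(1) p] by blast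
  note ch = differential_chart[OF mf f c _ v]
  show ?thesis unfolding tangent_space_def mem_Collect_eq
  proof (intro conjI ballI allI impI)
    fix d assume d: "d \<in> charts_at N (f p)"
    show "differential M N f p v d \<in> span (model N)"
      unfolding ch[OF d]
      using chart_chain_rule(2)[OF mf(1,2,2) f smooth_map_id[OF mf(2)] c d, of d] d tangent_in_span[OF v c] by simp
    fix e assume e: "e \<in> charts_at N (f p)"
    show "differential M N f p v e = dir_deriv (snd e \<circ> chart_inv d) (snd d (f p)) (differential M N f p v d)"
      unfolding ch[OF d] ch[OF e]
      using chart_chain_rule(1)[OF mf(1,2,2) f smooth_map_id[OF mf(2)] c d, of e] e tangent_in_span[OF v c] by simp
  qed (simp add: differential_def Let_def)
qed

lemma function_differential_chart:
  fixes M :: "('a, 'e::euclidean_space) manifold"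
  assumes M: "smooth_manifold M" and U: "openin (mtop M) U" "p \<in> U"
    and c: "c \<in> charts_at M p" and f: "smooth_on (snd c ` (fst c \<inter> U)) (f \<circ> chart_inv c)"
    and v: "v \<in> tangent_space M p"
  shows "function_differential M f p v = dir_deriv (f \<circ> chart_inv c) (snd c p) (v c)"
proof -
  define c0 where "c0 = (SOME c. c \<in> charts_at M p)"
  have c0: "c0 \<in> charts_at M p" unfolding c0_def using c by (rule someI)
  note at = charts_atD[OF c] charts_atD[OF c0]
  let ?X = "snd c0 ` (fst c0 \<inter> (fst c \<inter> U))" and ?Y = "snd c ` (fst c \<inter> U)"
  have X: "openin (top_of_set (span (model M))) ?X"
    by (intro chart_image_open M at openin_Int chart_open U)
  have Y: "openin (top_of_set (span (model M))) ?Y"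
    by (intro chart_image_open M at U)
  have F: "smooth_on ?X (snd c \<circ> chart_inv c0)"
    by (rule smooth_on_subset[OF overlap_smooth[OF smooth_map_id[OF M] at(3,1), simplified]])
      (auto simp: overlap_def)
  have x: "snd c0 p \<in> ?X" using at U by blast
  have inv0: "chart_inv c0 (snd c0 q) = q" if "q \<in> fst c0" for q using chart_inv_chart[OF M at(3) that] .
  have inv: "chart_inv c (snd c q) = q" if "q \<in> fst c" for q using chart_inv_chart[OF M at(1) that] .
  have FX: "(snd c \<circ> chart_inv c0) ` ?X \<subseteq> ?Y" using inv0 by auto
  have y: "(snd c \<circ> chart_inv c0) (snd c0 p) \<in> ?Y" using FX x by blast
  have "function_differential M f p v = dir_deriv (f \<circ> chart_inv c0) (snd c0 p) (v c0)"
    unfolding function_differential_def Let_def c0_def[symmetric] using v by simp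
  also have "\<dots> = dir_deriv ((f \<circ> chart_inv c) \<circ> (snd c \<circ> chart_inv c0)) (snd c0 p) (v c0)"
    by (rule dir_deriv_cong[OF X _ x tangent_in_span[OF v c0]]) (auto simp: inv0 inv)
  also have "\<dots> = dir_deriv (f \<circ> chart_inv c) ((snd c \<circ> chart_inv c0) (snd c0 p))
      (dir_deriv (snd c \<circ> chart_inv c0) (snd c0 p) (v c0))"
    using dir_deriv_chain(1)[OF model_Basis[OF M] model_Basis[OF M] X F Y f x tangent_in_span[OF v c0] y]
      FX openin_imp_subset[OF Y] by (meson subset_trans)
  also have "dir_deriv (snd c \<circ> chart_inv c0) (snd c0 p) (v c0) = v c"
    by (rule tangent_transition[OF v c0 c, symmetric])
  also have "(snd c \<circ> chart_inv c0) (snd c0 p) = snd c p" using inv0[OF at(4)] by simp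
  finally show ?thesis .
qed

section \<open>Covectors and bivectors in coordinates\<close>

lemma linear_formD:
  "linear_form V \<alpha> \<Longrightarrow> v \<in> V \<Longrightarrow> w \<in> V \<Longrightarrow>
    \<alpha> (\<lambda>x. r *\<^sub>R v x + s *\<^sub>R w x) = r * \<alpha> v + s * \<alpha> w"
  by (simp add: linear_form_def)

lemma linear_form_sum:
  assumes lf: "linear_form V \<alpha>" and cl: "\<And>v w r s. v \<in> V \<Longrightarrow> w \<in> V \<Longrightarrow> (\<lambda>x. r *\<^sub>R v x + s *\<^sub>R w x) \<in> V"
    and z: "(\<lambda>_. 0) \<in> V" and f: "\<And>i. i \<in> I \<Longrightarrow> f i \<in> V"
  shows "(\<lambda>x. \<Sum>i\<in>I. r i *\<^sub>R f i x) \<in> V \<and> \<alpha> (\<lambda>x. \<Sum>i\<in>I. r i *\<^sub>R f i x) = (\<Sum>i\<in>I. r i * \<alpha> (f i))"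
proof -
  have z0: "\<alpha> (\<lambda>_. 0) = 0"
    using lf[unfolded linear_form_def, rule_format, OF z z, of 0 0] by simp
  show ?thesis using f
  proof (induction I rule: infinite_finite_induct)
    case (insert i I)
    let ?g = "\<lambda>x. \<Sum>i\<in>I. r i *\<^sub>R f i x"
    have IH: "?g \<in> V" "\<alpha> ?g = (\<Sum>i\<in>I. r i * \<alpha> (f i))" and fi: "f i \<in> V"
      using insert by auto
    have "(\<lambda>x. r i *\<^sub>R f i x + 1 *\<^sub>R ?g x) \<in> V" by (rule cl[OF fi IH(1)])
    moreover have "\<alpha> (\<lambda>x. r i *\<^sub>R f i x + 1 *\<^sub>R ?g x) = r i * \<alpha> (f i) + 1 * \<alpha> ?g"
      by (rule linear_formD[OF lf fi IH(1)])
    ultimately show ?case using insert.hyps IH(2) by simp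
  qed (simp_all add: z z0)
qed

lemma cotangent_lincomb:
  assumes "\<alpha> \<in> cotangent_space M p" "\<beta> \<in> cotangent_space M p"
  shows "(\<lambda>x. r *\<^sub>R \<alpha> x + s *\<^sub>R \<beta> x) \<in> cotangent_space M p"
  using assms unfolding cotangent_space_def linear_form_def by (auto simp: algebra_simps)

lemma cotangent_zero: "(\<lambda>_. 0) \<in> cotangent_space M p"
  unfolding cotangent_space_def linear_form_def by simp

lemma coord_covector_cotangent:
  "smooth_manifold M \<Longrightarrow> coord_covector M c p a \<in> cotangent_space M p"
  unfolding cotangent_space_def linear_form_def coord_covector_def
  by (simp add: tangent_lincomb inner_add_left)

lemma span_model_inner:
  assumes "smooth_manifold M" "w \<in> span (model M)"
  shows "w \<bullet> a = (\<Sum>b\<in>model M. (w \<bullet> b) * (a \<bullet> b))"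
proof -
  have "coord_proj (model M) w = w" by (rule coord_proj_id[OF model_Basis[OF assms(1)] assms(2)])
  then have "w \<bullet> a = coord_proj (model M) w \<bullet> a" by simp
  also have "\<dots> = (\<Sum>b\<in>model M. (w \<bullet> b) * (a \<bullet> b))"
    by (simp add: coord_proj_def inner_sum_left inner_commute[of a])
  finally show ?thesis .
qed

text \<open>As \<open>coord_covector M c p a\<close> makes sense for every vector \<open>a\<close>, not only for the basis vectors of the
coframe, a covector is represented by a single vector.\<close>

lemma covector_coords:
  assumes M: "smooth_manifold M" and \<alpha>: "\<alpha> \<in> cotangent_space M p" and c: "c \<in> charts_at M p"
  shows "\<alpha> = coord_covector M c p (\<Sum>b\<in>model M. \<alpha> (coord_vector M c p b) *\<^sub>R b)"
proof
  fix v
  show "\<alpha> v = coord_covector M c p (\<Sum>b\<in>model M. \<alpha> (coord_vector M c p b) *\<^sub>R b) v"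
  proof (cases "v \<in> tangent_space M p")
    case True
    let ?w = "\<lambda>x. \<Sum>b\<in>model M. (v c \<bullet> b) *\<^sub>R coord_vector M c p b x"
    have lf: "linear_form (tangent_space M p) \<alpha>" using \<alpha> by (simp add: cotangent_space_def)
    have b: "coord_vector M c p b \<in> tangent_space M p" "coord_vector M c p b c = b" if "b \<in> model M" for b
      using coord_vector_tangent[OF M c] span_base[OF that] by auto
    have s: "?w \<in> tangent_space M p \<and> \<alpha> ?w = (\<Sum>b\<in>model M. (v c \<bullet> b) * \<alpha> (coord_vector M c p b))"
      by (rule linear_form_sum[OF lf]) (rule tangent_zero[OF M c] | erule b(1) | erule (1) tangent_lincomb[OF M])+
    have "?w c = coord_proj (model M) (v c)" by (simp add: coord_proj_def b(2))
    also have "\<dots> = v c" by (rule coord_proj_id[OF model_Basis[OF M] tangent_in_span[OF True c]])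
    finally have "v = ?w" using tangent_eqI[OF True _ c, of ?w] s by simp
    then have "\<alpha> v = (\<Sum>b\<in>model M. (v c \<bullet> b) * \<alpha> (coord_vector M c p b))" using s by simp
    then show ?thesis using True by (simp add: coord_covector_def inner_sum_right mult.commute)
  next
    case False
    then show ?thesis using \<alpha> by (simp add: cotangent_space_def coord_covector_def)
  qed
qed

text \<open>The anchor in coordinates: it sends the vector representing \<open>\<alpha>\<close> to that of \<open>P\<^sup>#(\<alpha>)\<close>.\<close>

definition bivector_matrix ::
    "('a, 'e::euclidean_space) manifold \<Rightarrow> ('a, 'e) bivector \<Rightarrow> ('a, 'e) chart \<Rightarrow> 'a \<Rightarrow> 'e \<Rightarrow> 'e" where
  "bivector_matrix M P c p a = (\<Sum>i\<in>model M. \<Sum>j\<in>model M. ((a \<bullet> i) * bivector_component M P c i j p) *\<^sub>R j)"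

lemma bivector_matrix_in_span: "bivector_matrix M P c p a \<in> span (model M)"
  unfolding bivector_matrix_def by (intro span_sum span_scale span_base)

lemma bivector_coords:
  assumes M: "smooth_manifold M" and P: "bivector_field M P" and c: "c \<in> charts_at M p"
  shows "P p (coord_covector M c p a) (coord_covector M c p b) = bivector_matrix M P c p a \<bullet> b"
proof -
  let ?cov = "coord_covector M c p"
  have p: "p \<in> carrier M" using charts_atD[OF c] chart_subset[OF M] by blast
  have bil: "bilinear_form (cotangent_space M p) (P p)" using P p by (simp add: bivector_field_def)
  have cov: "?cov a = (\<lambda>v. \<Sum>i\<in>model M. (a \<bullet> i) *\<^sub>R ?cov i v)" for a
  proof
    fix v show "?cov a v = (\<Sum>i\<in>model M. (a \<bullet> i) *\<^sub>R ?cov i v)"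
      using span_model_inner[OF M tangent_in_span[OF _ c], of v a]
      by (auto simp: coord_covector_def mult.commute)
  qed
  note ct = coord_covector_cotangent[OF M]
  have 1: "P p (?cov a) \<beta> = (\<Sum>i\<in>model M. (a \<bullet> i) * P p (?cov i) \<beta>)" if "\<beta> \<in> cotangent_space M p" for a \<beta>
  proof -
    have lf: "linear_form (cotangent_space M p) (\<lambda>\<alpha>. P p \<alpha> \<beta>)" using bil that by (simp add: bilinear_form_def)
    show ?thesis
      unfolding cov[of a]
      by (rule linear_form_sum[OF lf, THEN conjunct2]) (rule ct cotangent_zero | erule (1) cotangent_lincomb)+
  qed
  have 2: "P p \<alpha> (?cov b) = (\<Sum>i\<in>model M. (b \<bullet> i) * P p \<alpha> (?cov i))" if "\<alpha> \<in> cotangent_space M p" for b \<alpha>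
  proof -
    have lf: "linear_form (cotangent_space M p) (P p \<alpha>)" using bil that by (simp add: bilinear_form_def)
    show ?thesis
      unfolding cov[of b]
      by (rule linear_form_sum[OF lf, THEN conjunct2]) (rule ct cotangent_zero | erule (1) cotangent_lincomb)+
  qed
  have "P p (?cov a) (?cov b) = (\<Sum>i\<in>model M. (a \<bullet> i) * P p (?cov i) (?cov b))"
    by (rule 1[OF ct])
  also have "\<dots> = (\<Sum>i\<in>model M. (a \<bullet> i) * (\<Sum>j\<in>model M. (b \<bullet> j) * P p (?cov i) (?cov j)))"
    by (intro sum.cong refl arg_cong[where f = "(*) _"] 2[OF ct])
  finally show ?thesis
    by (simp add: bivector_matrix_def inner_sum_left bivector_component_def sum_distrib_left mult_ac
        inner_commute[of b])
qed

lemma bivector_skew: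
  assumes P: "bivector_field M P" and p: "p \<in> carrier M"
    and ab: "\<alpha> \<in> cotangent_space M p" "\<beta> \<in> cotangent_space M p"
  shows "P p \<alpha> \<beta> = - P p \<beta> \<alpha>"
proof -
  have bil: "bilinear_form (cotangent_space M p) (P p)"
    and alt: "\<And>\<alpha>. \<alpha> \<in> cotangent_space M p \<Longrightarrow> P p \<alpha> \<alpha> = 0" using P p by (auto simp: bivector_field_def)
  let ?s = "\<lambda>x. 1 *\<^sub>R \<alpha> x + 1 *\<^sub>R \<beta> x"
  have s: "?s \<in> cotangent_space M p" by (rule cotangent_lincomb[OF ab])
  have "P p ?s \<gamma> = 1 * P p \<alpha> \<gamma> + 1 * P p \<beta> \<gamma>" if "\<gamma> \<in> cotangent_space M p" for \<gamma>
    by (rule linear_formD[OF _ ab]) (use bil that in \<open>simp add: bilinear_form_def\<close>)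
  moreover have "P p \<gamma> ?s = 1 * P p \<gamma> \<alpha> + 1 * P p \<gamma> \<beta>" if "\<gamma> \<in> cotangent_space M p" for \<gamma>
    by (rule linear_formD[OF _ ab]) (use bil that in \<open>simp add: bilinear_form_def\<close>)
  ultimately have "P p ?s ?s = (P p \<alpha> \<alpha> + P p \<alpha> \<beta>) + (P p \<beta> \<alpha> + P p \<beta> \<beta>)"
    using s ab by simp
  then show ?thesis using alt s ab by simp
qed

lemma bivector_matrix_skew:
  assumes "smooth_manifold M" "bivector_field M P" "c \<in> charts_at M p"
  shows "bivector_matrix M P c p a \<bullet> b = - (bivector_matrix M P c p b \<bullet> a)"
proof -
  have "p \<in> carrier M" using charts_atD[OF assms(3)] chart_subset[OF assms(1)] by blast
  then show ?thesis
    using bivector_skew[OF assms(2) _ coord_covector_cotangent[OF assms(1), of c p a] coord_covector_cotangent[OF assms(1), of c p b]]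
      bivector_coords[OF assms] by simp
qed

text \<open>The condition in the definite description of the anchor determines its solution because covectors
separate tangent vectors.\<close>

lemma anchor_eqI:
  assumes M: "smooth_manifold M" and p: "p \<in> carrier M" and v: "v \<in> tangent_space M p"
    and eq: "\<And>\<beta>. \<beta> \<in> cotangent_space M p \<Longrightarrow> \<beta> v = P p \<alpha> \<beta>"
  shows "anchor M P p \<alpha> = v"
  unfolding anchor_def
proof (rule the_equality)
  show "v \<in> tangent_space M p \<and> (\<forall>\<beta>\<in>cotangent_space M p. \<beta> v = P p \<alpha> \<beta>)" using v eq by blast
next
  fix w assume w: "w \<in> tangent_space M p \<and> (\<forall>\<beta>\<in>cotangent_space M p. \<beta> w = P p \<alpha> \<beta>)"
  obtain c where c: "c \<in> charts_at M p" using charts_at_nonempty[OF M p] by blast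
  have "w c \<bullet> a = v c \<bullet> a" for a
  proof -
    have "coord_covector M c p a w = coord_covector M c p a v"
      using w eq coord_covector_cotangent[OF M, of c p a] by simp
    then show ?thesis using w v by (simp add: coord_covector_def)
  qed
  then have "w c = v c" by (metis vector_eq_rdot)
  then show "w = v" using tangent_eqI[OF _ v c] w by blast
qed

lemma anchor_coords:
  assumes M: "smooth_manifold M" and P: "bivector_field M P" and c: "c \<in> charts_at M p"
  shows "anchor M P p (coord_covector M c p a) = coord_vector M c p (bivector_matrix M P c p a)"
proof (rule anchor_eqI[OF M])
  show "p \<in> carrier M" using charts_atD[OF c] chart_subset[OF M] by blast
  note cv = coord_vector_tangent[OF M c bivector_matrix_in_span]
  show "coord_vector M c p (bivector_matrix M P c p a) \<in> tangent_space M p" by (rule cv)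
  fix \<beta> assume \<beta>: "\<beta> \<in> cotangent_space M p"
  obtain b where b: "\<beta> = coord_covector M c p b" using covector_coords[OF M \<beta> c] by blast
  show "\<beta> (coord_vector M c p (bivector_matrix M P c p a)) = P p (coord_covector M c p a) \<beta>"
    unfolding b bivector_coords[OF M P c] using cv by (simp add: coord_covector_def)
qed

lemma anchor_works:
  assumes M: "smooth_manifold M" and P: "bivector_field M P" and p: "p \<in> carrier M"
    and ab: "\<alpha> \<in> cotangent_space M p" "\<beta> \<in> cotangent_space M p"
  shows "\<beta> (anchor M P p \<alpha>) = P p \<alpha> \<beta>" "anchor M P p \<alpha> \<in> tangent_space M p"
proof -
  obtain c where c: "c \<in> charts_at M p" using charts_at_nonempty[OF M p] by blast
  obtain a where a: "\<alpha> = coord_covector M c p a" using covector_coords[OF M ab(1) c] by blast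
  obtain b where b: "\<beta> = coord_covector M c p b" using covector_coords[OF M ab(2) c] by blast
  note cv = coord_vector_tangent[OF M c bivector_matrix_in_span]
  show "anchor M P p \<alpha> \<in> tangent_space M p" unfolding a anchor_coords[OF M P c] by (rule cv)
  show "\<beta> (anchor M P p \<alpha>) = P p \<alpha> \<beta>"
    unfolding a b anchor_coords[OF M P c] bivector_coords[OF M P c] using cv by (simp add: coord_covector_def)
qed

lemma anchor_image_coords:
  assumes M: "smooth_manifold M" and P: "bivector_field M P" and c: "c \<in> charts_at M p"
  shows "anchor_image M P p = (\<lambda>a. coord_vector M c p (bivector_matrix M P c p a)) ` UNIV"
proof -
  have "cotangent_space M p = coord_covector M c p ` UNIV"
  proof (intro equalityI subsetI)
    fix \<alpha> assume "\<alpha> \<in> cotangent_space M p"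
    then show "\<alpha> \<in> coord_covector M c p ` UNIV" using covector_coords[OF M _ c] by blast
  next
    fix \<alpha> assume "\<alpha> \<in> coord_covector M c p ` UNIV"
    then show "\<alpha> \<in> cotangent_space M p" by (auto intro: coord_covector_cotangent[OF M])
  qed
  then show ?thesis
    unfolding anchor_image_def by (simp add: image_image anchor_coords[OF M P c])
qed

section \<open>The Poisson structure on a leaf\<close>

text \<open>The differential of the inclusion as a linear map between model spaces, given by a total derivative
and therefore defined on all of \<^typ>\<open>'e\<close>.\<close>

lemma immersion_coords:
  fixes M S :: "('a, 'e::euclidean_space) manifold"
  assumes M: "smooth_manifold M" and S: "smooth_manifold S" and \<iota>: "smooth_map S M id"
    and inj: "inj_on (differential S M id q) (tangent_space S q)"
    and c: "c \<in> charts_at M q" and d: "d \<in> charts_at S q"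
  defines "L \<equiv> D (extend (model S) (snd c \<circ> id \<circ> chart_inv d)) (snd d q)"
  shows "linear L" "inj_on L (span (model S))"
    "\<And>v. v \<in> tangent_space S q \<Longrightarrow> differential S M id q v c = L (v d)"
proof -
  have c': "c \<in> charts_at M (id q)" using c by simp
  let ?F = "snd c \<circ> id \<circ> chart_inv d" and ?W = "span (model S)"
  let ?X = "overlap d c id"
  note at = charts_atD[OF d] charts_atD[OF c]
  have q: "q \<in> carrier S" using at(2) chart_subset[OF S at(1)] by blast
  note X = overlap_open[OF S M \<iota> at(1,3)]
  note F = overlap_smooth[OF \<iota> at(1,3)]
  have x: "snd d q \<in> ?X" by (rule overlap_mem[where f = id, OF d c'])
  have L: "dir_deriv ?F (snd d q) w = L w" if "w \<in> ?W" for w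
    unfolding L_def by (rule dir_deriv_eq[OF model_Basis[OF S] X F x that])
  show "linear L" unfolding L_def
    using smooth_open_linear_D[OF smooth_extend[OF X F]] ambient_superset[OF model_Basis[OF S] openin_imp_subset[OF X]] x by blast
  show Lv: "differential S M id q v c = L (v d)" if "v \<in> tangent_space S q" for v
    by (rule trans[OF differential_chart[OF S M \<iota> d c' that] L[OF tangent_in_span[OF that d]]])
  show "inj_on L ?W"
  proof (rule inj_onI)
    fix w w' assume w: "w \<in> ?W" "w' \<in> ?W" "L w = L w'"
    let ?v = "coord_vector S d q w" and ?v' = "coord_vector S d q w'"
    note v = coord_vector_tangent[OF S d w(1)] coord_vector_tangent[OF S d w(2)]
    have "differential S M id q ?v c = differential S M id q ?v' c" using Lv v w(3) by simp
    then have "differential S M id q ?v = differential S M id q ?v'"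
      using tangent_eqI[OF _ _ c] differential_tangent[OF S M \<iota> q] v by simp
    then have "?v = ?v'" using inj v by (auto dest: inj_onD)
    then show "w = w'" using v by metis
  qed
qed

text \<open>The differential of an immersion has a linear left inverse, whose transpose extends covectors.\<close>

lemma covector_extends:
  fixes M S :: "('a, 'e::euclidean_space) manifold"
  assumes M: "smooth_manifold M" and S: "smooth_manifold S" and \<iota>: "smooth_map S M id"
    and q: "q \<in> carrier S" "q \<in> carrier M"
    and inj: "inj_on (differential S M id q) (tangent_space S q)"
    and \<beta>: "\<beta> \<in> cotangent_space S q"
  shows "\<exists>\<beta>'\<in>cotangent_space M q. pullback_covector S M id q \<beta>' = \<beta>"
proof -
  obtain d where d: "d \<in> charts_at S q" using charts_at_nonempty[OF S q(1)] by blast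
  obtain c where c: "c \<in> charts_at M q" using charts_at_nonempty[OF M q(2)] by blast
  define L where "L = D (extend (model S) (snd c \<circ> id \<circ> chart_inv d)) (snd d q)"
  note im = immersion_coords[OF M S \<iota> inj c d, folded L_def]
  note linL = im(1) and Lv = im(3)
  have "inj_on L (span (model S))" by (rule im(2))
  then obtain g where g: "linear g" "\<And>w. w \<in> span (model S) \<Longrightarrow> g (L w) = w"
    using linear_exists_left_inverse_on[OF linL subspace_span] by blast
  obtain b where b: "\<beta> = coord_covector S d q b" using covector_coords[OF S \<beta> d] by blast
  let ?\<beta>' = "coord_covector M c q (adjoint g b)"
  have "pullback_covector S M id q ?\<beta>' = \<beta>"
  proof
    fix v
    show "pullback_covector S M id q ?\<beta>' v = \<beta> v"
    proof (cases "v \<in> tangent_space S q")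
      case True
      have "differential S M id q v c \<bullet> adjoint g b = v d \<bullet> b"
        using adjoint_works[OF g(1), of "L (v d)" b] g(2)[OF tangent_in_span[OF True d]] Lv[OF True] by simp
      then show ?thesis
        using True differential_tangent[OF S M \<iota> q(1) True]
        by (simp add: b pullback_covector_def coord_covector_def)
    next
      case False
      then show ?thesis by (simp add: b pullback_covector_def coord_covector_def)
    qed
  qed
  then show ?thesis using coord_covector_cotangent[OF M] by blast
qed

text \<open>Covectors with the same pullback to the leaf agree on the image of \<open>P\<^sup>#\<close>. By skew-symmetry,
\<open>P(\<alpha>, \<beta>)\<close> can be read as the value of either argument on the image of the other one, hence it
depends on the pullbacks only. So \<open>P\<^sub>S\<close> is well defined, and \<open>P\<^sub>S\<^sup>#(\<iota>\<^sup>*\<alpha>)\<close> is the vector on the leaf which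
the inclusion maps to \<open>P\<^sup>#(\<alpha>)\<close>.\<close>

lemma leaf_anchor:
  fixes M S :: "('a, 'e::euclidean_space) manifold"
  assumes M: "smooth_manifold M" and S: "smooth_manifold S" and \<iota>: "smooth_map S M id"
    and P: "bivector_field M P" and q: "q \<in> carrier S" "q \<in> carrier M"
    and inj: "inj_on (differential S M id q) (tangent_space S q)"
    and im: "differential S M id q ` tangent_space S q = anchor_image M P q"
    and \<alpha>: "\<alpha> \<in> cotangent_space M q" and v: "v \<in> tangent_space S q"
    and eq: "differential S M id q v = anchor M P q \<alpha>"
  shows "anchor S (restrict_bivector M P S) q (pullback_covector S M id q \<alpha>) = v"
proof (rule anchor_eqI[OF S q(1) v])
  let ?\<iota> = "pullback_covector S M id q"
  fix \<beta> assume \<beta>: "\<beta> \<in> cotangent_space S q"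
  obtain \<beta>' where \<beta>': "\<beta>' \<in> cotangent_space M q" "?\<iota> \<beta>' = \<beta>"
    using covector_extends[OF M S \<iota> q inj \<beta>] by blast
  have agree: "\<gamma> (anchor M P q \<delta>) = \<gamma>' (anchor M P q \<delta>)"
    if "?\<iota> \<gamma> = ?\<iota> \<gamma>'" "\<delta> \<in> cotangent_space M q" for \<gamma> \<gamma>' \<delta>
  proof -
    have "anchor M P q \<delta> \<in> differential S M id q ` tangent_space S q"
      unfolding im anchor_image_def using that(2) by blast
    then obtain w where "w \<in> tangent_space S q" "anchor M P q \<delta> = differential S M id q w" by blast
    then show ?thesis using fun_cong[OF that(1), of w] by (simp add: pullback_covector_def)
  qed
  note aw = anchor_works(1)[OF M P q(2)]
  have "restrict_bivector M P S q (?\<iota> \<alpha>) \<beta> = P q \<alpha> \<beta>'"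
    unfolding restrict_bivector_def
  proof (rule the_equality)
    show "\<exists>\<alpha>'\<in>cotangent_space M q. \<exists>\<beta>''\<in>cotangent_space M q.
      ?\<iota> \<alpha> = ?\<iota> \<alpha>' \<and> \<beta> = ?\<iota> \<beta>'' \<and> P q \<alpha> \<beta>' = P q \<alpha>' \<beta>''"
      using \<alpha> \<beta>' by blast
  next
    fix r assume "\<exists>\<alpha>'\<in>cotangent_space M q. \<exists>\<beta>''\<in>cotangent_space M q.
      ?\<iota> \<alpha> = ?\<iota> \<alpha>' \<and> \<beta> = ?\<iota> \<beta>'' \<and> r = P q \<alpha>' \<beta>''"
    then obtain \<alpha>' \<beta>'' where r: "\<alpha>' \<in> cotangent_space M q" "\<beta>'' \<in> cotangent_space M q"
      "?\<iota> \<alpha> = ?\<iota> \<alpha>'" "\<beta> = ?\<iota> \<beta>''" "r = P q \<alpha>' \<beta>''" by blast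
    have "r = \<beta>'' (anchor M P q \<alpha>')" using aw[OF r(1,2)] r(5) by simp
    also have "\<dots> = \<beta>' (anchor M P q \<alpha>')" using agree[OF _ r(1)] r(4) \<beta>'(2) by simp
    also have "\<dots> = - P q \<beta>' \<alpha>'" using aw[OF r(1) \<beta>'(1)] bivector_skew[OF P q(2) r(1) \<beta>'(1)] by simp
    also have "\<dots> = - \<alpha>' (anchor M P q \<beta>')" using aw[OF \<beta>'(1) r(1)] by simp
    also have "\<dots> = - \<alpha> (anchor M P q \<beta>')" using agree[OF r(3) \<beta>'(1)] by simp
    also have "\<dots> = P q \<alpha> \<beta>'" using aw[OF \<beta>'(1) \<alpha>] bivector_skew[OF P q(2) \<alpha> \<beta>'(1)] by simp
    finally show "r = P q \<alpha> \<beta>'" .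
  qed
  also have "P q \<alpha> \<beta>' = \<beta>' (differential S M id q v)" using aw[OF \<alpha> \<beta>'(1)] eq by simp
  also have "\<dots> = \<beta> v" using fun_cong[OF \<beta>'(2), of v] v by (simp add: pullback_covector_def)
  finally show "\<beta> v = restrict_bivector M P S q (?\<iota> \<alpha>) \<beta>" by simp
qed

section \<open>A bivector field in a chart\<close>

definition chart_domain :: "('a, 'e::euclidean_space) manifold \<Rightarrow> ('a, 'e) chart \<Rightarrow> 'e set" where
  "chart_domain M c = ambient (model M) (snd c ` fst c)"

text \<open>The matrix \<open>bivector_matrix\<close> as a function of coordinates, extended to an open subset of \<^typ>\<open>'e\<close>.\<close>

definition coord_matrix ::
    "('a, 'e::euclidean_space) manifold \<Rightarrow> ('a, 'e) bivector \<Rightarrow> ('a, 'e) chart \<Rightarrow> 'e \<Rightarrow> 'e \<Rightarrow> 'e" where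
  "coord_matrix M P c x a = (\<Sum>i\<in>model M. \<Sum>j\<in>model M.
     ((a \<bullet> i) * extend (model M) (bivector_component M P c i j \<circ> chart_inv c) x) *\<^sub>R j)"

lemma chart_image_openin:
  "smooth_manifold M \<Longrightarrow> c \<in> atlas M \<Longrightarrow> openin (top_of_set (span (model M))) (snd c ` fst c)"
  by (simp add: smooth_manifold_def)

lemma chart_domain_open: "smooth_manifold M \<Longrightarrow> c \<in> atlas M \<Longrightarrow> open (chart_domain M c)"
  unfolding chart_domain_def by (intro ambient_open chart_image_openin)

lemma chart_domain_proj:
  assumes "x \<in> chart_domain M c"
  obtains p where "p \<in> fst c" "coord_proj (model M) x = snd c p"
  using assms by (auto simp: chart_domain_def ambient_def)

lemma chart_proj:
  assumes "smooth_manifold M" "c \<in> atlas M" "p \<in> fst c"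
  shows "coord_proj (model M) (snd c p) = snd c p" "snd c p \<in> chart_domain M c"
proof -
  have "snd c p \<in> span (model M)"
    using assms chart_in_span[of M c p] by (simp add: charts_at_def)
  then show 1: "coord_proj (model M) (snd c p) = snd c p"
    by (rule coord_proj_id[OF model_Basis[OF assms(1)]])
  show "snd c p \<in> chart_domain M c" using 1 assms(3) by (simp add: chart_domain_def ambient_def)
qed

lemma linear_coord_matrix: "linear (coord_matrix M P c x)"
  unfolding coord_matrix_def
  by (rule linearI) (simp_all add: inner_add_left algebra_simps sum.distrib scaleR_sum_right)

lemma component_smooth:
  assumes "bivector_field M P" "c \<in> atlas M" "i \<in> model M" "j \<in> model M"
  shows "smooth_on (snd c ` fst c) (bivector_component M P c i j \<circ> chart_inv c)"
proof -
  have "smooth_function M (fst c) (bivector_component M P c i j)"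
    using assms by (simp add: bivector_field_def)
  from this[unfolded smooth_function_def, rule_format, OF assms(2)] show ?thesis by simp
qed

lemma smooth_component_extend:
  assumes "smooth_manifold M" "bivector_field M P" "c \<in> atlas M" "i \<in> model M" "j \<in> model M"
  shows "smooth_open (chart_domain M c) (extend (model M) (bivector_component M P c i j \<circ> chart_inv c))"
  unfolding chart_domain_def
  by (rule smooth_extend[OF chart_image_openin[OF assms(1,3)] component_smooth[OF assms(2-5)]])

lemma smooth_open_mult:
  "smooth_open X f \<Longrightarrow> smooth_open X g \<Longrightarrow> smooth_open X (\<lambda>x. f x * g x :: real)"
  using smooth_open_scaleR[of X f g] by simp

lemma smooth_coord_matrix:
  assumes "smooth_manifold M" "bivector_field M P" "c \<in> atlas M"
  shows "smooth_open (chart_domain M c) (\<lambda>x. coord_matrix M P c x a)"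
  unfolding coord_matrix_def
  by (intro smooth_open_sum smooth_open_scaleR smooth_open_mult smooth_open_const
      smooth_component_extend assms chart_domain_open)

lemma coord_matrix_eq:
  assumes "smooth_manifold M" "c \<in> atlas M" "p \<in> fst c"
  shows "coord_matrix M P c (snd c p) = bivector_matrix M P c p"
  by (rule ext) (simp add: coord_matrix_def bivector_matrix_def extend_def chart_proj[OF assms]
      chart_inv_chart[OF assms])

lemma coord_matrix_in_span: "coord_matrix M P c x a \<in> span (model M)"
  unfolding coord_matrix_def by (intro span_sum span_scale span_base)

lemma coord_matrix_skew:
  assumes M: "smooth_manifold M" and P: "bivector_field M P" and c: "c \<in> atlas M" and x: "x \<in> chart_domain M c"
  shows "coord_matrix M P c x a \<bullet> b = - (coord_matrix M P c x b \<bullet> a)"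
proof -
  obtain p where p: "p \<in> fst c" "coord_proj (model M) x = snd c p" using chart_domain_proj[OF x] .
  have "coord_matrix M P c x = coord_matrix M P c (snd c p)"
    by (rule ext) (simp add: coord_matrix_def extend_def p(2) chart_proj[OF M c p(1)])
  also have "\<dots> = bivector_matrix M P c p" by (rule coord_matrix_eq[OF M c p(1)])
  finally have eq: "coord_matrix M P c x = bivector_matrix M P c p" .
  show ?thesis unfolding eq
    by (rule bivector_matrix_skew[OF M P]) (use c p in \<open>simp add: charts_at_def\<close>)
qed

lemma D_coord_matrix:
  assumes M: "smooth_manifold M" and P: "bivector_field M P" and c: "c \<in> atlas M" and x: "x \<in> chart_domain M c"
  shows "D (\<lambda>x. coord_matrix M P c x a) x u = (\<Sum>i\<in>model M. \<Sum>j\<in>model M.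
     ((a \<bullet> i) * D (extend (model M) (bivector_component M P c i j \<circ> chart_inv c)) x u) *\<^sub>R j)"
proof -
  let ?p = "\<lambda>i j. extend (model M) (bivector_component M P c i j \<circ> chart_inv c)"
  have "((\<lambda>x. \<Sum>i\<in>model M. \<Sum>j\<in>model M. ((a \<bullet> i) * ?p i j x) *\<^sub>R j) has_derivative
    (\<lambda>u. \<Sum>i\<in>model M. \<Sum>j\<in>model M. ((a \<bullet> i) * D (?p i j) x u) *\<^sub>R j)) (at x)"
    by (intro has_derivative_sum has_derivative_scaleR_left has_derivative_mult_right
        smooth_open_D[OF smooth_component_extend[OF M P c] x])
  then show ?thesis unfolding coord_matrix_def by (simp add: D_eqI)
qed

lemma sum_rotate3:
  "(\<Sum>i\<in>A. \<Sum>j\<in>A. \<Sum>k\<in>A. g i j k) = (\<Sum>i\<in>A. \<Sum>j\<in>A. \<Sum>k\<in>A. g j k i :: 'b::comm_monoid_add)"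
proof -
  have "(\<Sum>i\<in>A. \<Sum>j\<in>A. \<Sum>k\<in>A. g j k i) = (\<Sum>j\<in>A. \<Sum>i\<in>A. \<Sum>k\<in>A. g j k i)" by (rule sum.swap)
  also have "\<dots> = (\<Sum>j\<in>A. \<Sum>k\<in>A. \<Sum>i\<in>A. g j k i)" by (intro sum.cong refl sum.swap)
  finally show ?thesis by simp
qed

text \<open>By trilinearity this reduces to basis vectors \<open>i, j, k\<close>, for which the three terms are the cyclic
  permutations of \<open>\<Sum>\<^sub>l P\<^sup>i\<^sup>l \<partial>\<^sub>l P\<^sup>j\<^sup>k\<close>, with sum half the component of \<open>[[P,P]]\<close>.\<close>

lemma jacobi_coords:
  assumes M: "smooth_manifold M" and P: "poisson_structure M P" and c: "c \<in> atlas M" and p: "p \<in> fst c"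
    and x: "x = snd c p" and A: "A = coord_matrix M P c"
  shows "D (\<lambda>x. A x b) x (A x a) \<bullet> e + D (\<lambda>x. A x e) x (A x b) \<bullet> a + D (\<lambda>x. A x a) x (A x e) \<bullet> b = 0"
proof -
  have bf: "bivector_field M P" using P by (simp add: poisson_structure_def)
  have xd: "x \<in> chart_domain M c" unfolding x by (rule chart_proj[OF M c p])
  let ?E = "model M"
  let ?p = "\<lambda>i j. extend ?E (bivector_component M P c i j \<circ> chart_inv c)"
  define T where "T i j k = (\<Sum>l\<in>?E. bivector_component M P c i l p * D (?p j k) x l)" for i j k
  have Tsum: "D (\<lambda>x. A x b) x (A x a) \<bullet> e = (\<Sum>i\<in>?E. \<Sum>j\<in>?E. \<Sum>k\<in>?E. (a \<bullet> i) * (b \<bullet> j) * (e \<bullet> k) * T i j k)" for a b e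
  proof -
    have Aa: "A x a = (\<Sum>i\<in>?E. \<Sum>l\<in>?E. ((a \<bullet> i) * bivector_component M P c i l p) *\<^sub>R l)"
      unfolding A x coord_matrix_eq[OF M c p] by (simp add: bivector_matrix_def)
    have "D (?p j k) x (A x a) = (\<Sum>i\<in>?E. (a \<bullet> i) * T i j k)" if jk: "j \<in> ?E" "k \<in> ?E" for j k
    proof -
      have lin: "linear (D (?p j k) x)"
        by (rule smooth_open_linear_D[OF smooth_component_extend[OF M bf c jk] xd])
      show ?thesis unfolding Aa
        by (simp add: linear_sum[OF lin] linear_cmul[OF lin] T_def sum_distrib_left mult_ac)
    qed
    then have "D (\<lambda>x. A x b) x (A x a) \<bullet> e =
        (\<Sum>j\<in>?E. \<Sum>k\<in>?E. \<Sum>i\<in>?E. (a \<bullet> i) * (b \<bullet> j) * (e \<bullet> k) * T i j k)"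
      unfolding A by (subst D_coord_matrix[OF M bf c xd])
        (simp add: inner_sum_left sum_distrib_left sum_distrib_right mult_ac inner_commute[of e])
    also have "\<dots> = (\<Sum>i\<in>?E. \<Sum>j\<in>?E. \<Sum>k\<in>?E. (a \<bullet> i) * (b \<bullet> j) * (e \<bullet> k) * T i j k)"
      using sum_rotate3[of "\<lambda>i j k. (a \<bullet> i) * (b \<bullet> j) * (e \<bullet> k) * T i j k" ?E]
        sum_rotate3[of "\<lambda>j k i. (a \<bullet> i) * (b \<bullet> j) * (e \<bullet> k) * T i j k" ?E] by simp
    finally show ?thesis .
  qed
  have zero: "T i j k + T j k i + T k i j = 0" if ijk: "i \<in> ?E" "j \<in> ?E" "k \<in> ?E" for i j k
  proof -
    have Dl: "dir_deriv (bivector_component M P c j k \<circ> chart_inv c) (snd c p) l = D (?p j k) x l"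
      if "j \<in> ?E" "k \<in> ?E" "l \<in> ?E" for j k l
      unfolding x
      by (rule dir_deriv_eq[OF model_Basis[OF M] chart_image_openin[OF M c] component_smooth[OF bf c that(1,2)]])
        (use p that in \<open>auto intro: span_base\<close>)
    have "schouten_bracket M P P c i j k p = 0" using P c p ijk by (simp add: poisson_structure_def)
    then have "2 * (T i j k + T j k i + T k i j) = 0"
      by (simp add: schouten_bracket_def Let_def Dl ijk T_def sum.distrib)
    then show ?thesis by simp
  qed
  have "D (\<lambda>x. A x b) x (A x a) \<bullet> e + D (\<lambda>x. A x e) x (A x b) \<bullet> a + D (\<lambda>x. A x a) x (A x e) \<bullet> b =
    (\<Sum>i\<in>?E. \<Sum>j\<in>?E. \<Sum>k\<in>?E. (a \<bullet> i) * (b \<bullet> j) * (e \<bullet> k) * (T i j k + T j k i + T k i j))"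
  proof -
    have 1: "D (\<lambda>x. A x e) x (A x b) \<bullet> a = (\<Sum>i\<in>?E. \<Sum>j\<in>?E. \<Sum>k\<in>?E. (a \<bullet> i) * (b \<bullet> j) * (e \<bullet> k) * T j k i)"
      unfolding Tsum by (subst sum_rotate3) (simp add: mult_ac)
    have 2: "D (\<lambda>x. A x a) x (A x e) \<bullet> b = (\<Sum>i\<in>?E. \<Sum>j\<in>?E. \<Sum>k\<in>?E. (a \<bullet> i) * (b \<bullet> j) * (e \<bullet> k) * T k i j)"
      unfolding Tsum by (subst sum_rotate3, subst sum_rotate3) (simp add: mult_ac)
    show ?thesis unfolding 1 2 Tsum[of b a e] by (simp add: sum.distrib distrib_left)
  qed
  also have "\<dots> = 0" using zero by simp
  finally show ?thesis .
qed

section \<open>The flow of the Carroll vector field\<close>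

text \<open>Time and coordinates are kept in a single argument because the derivatives of the flow in both are
  to be interchanged.\<close>

definition chart_flow ::
    "('a, 'e::euclidean_space) manifold \<Rightarrow> (real \<Rightarrow> 'a \<Rightarrow> 'a) \<Rightarrow> ('a, 'e) chart \<Rightarrow> real \<times> 'e \<Rightarrow> 'e" where
  "chart_flow M act c z = snd c (act (fst z) (chart_inv c (coord_proj (model M) (snd z))))"

definition chart_flow_domain ::
    "('a, 'e::euclidean_space) manifold \<Rightarrow> (real \<Rightarrow> 'a \<Rightarrow> 'a) \<Rightarrow> ('a, 'e) chart \<Rightarrow> (real \<times> 'e) set" where
  "chart_flow_domain M act c =
     {z. snd z \<in> chart_domain M c \<and> act (fst z) (chart_inv c (coord_proj (model M) (snd z))) \<in> fst c}"

text \<open>The coordinates of the fundamental field, in a form that shows their smooth dependence on the point.\<close>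

definition chart_flow_field ::
    "('a, 'e::euclidean_space) manifold \<Rightarrow> (real \<Rightarrow> 'a \<Rightarrow> 'a) \<Rightarrow> ('a, 'e) chart \<Rightarrow> 'e \<Rightarrow> 'e" where
  "chart_flow_field M act c x = D (chart_flow M act c) (0, x) (1, 0)"

lemma chart_inv_continuous:
  assumes M: "smooth_manifold M" and c: "c \<in> atlas M"
  shows "continuous_map (top_of_set (chart_domain M c)) (mtop M) (\<lambda>x. chart_inv c (coord_proj (model M) x))"
  unfolding continuous_map_alt
proof (intro conjI allI impI)
  fix V assume V: "openin (mtop M) V"
  have "(\<lambda>x. chart_inv c (coord_proj (model M) x)) -` V \<inter> chart_domain M c = ambient (model M) (snd c ` (fst c \<inter> V))"
    using chart_inv_chart[OF M c] by (auto simp: chart_domain_def ambient_def)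
  moreover have "open (ambient (model M) (snd c ` (fst c \<inter> V)))"
    by (rule ambient_open[OF chart_image_open[OF M c V]])
  ultimately show "openin (top_of_set (chart_domain M c))
      ((\<lambda>x. chart_inv c (coord_proj (model M) x)) -` V \<inter> topspace (top_of_set (chart_domain M c)))"
    by (metis inf_le2 open_subset topspace_euclidean_subtopology)
next
  show "(\<lambda>x. chart_inv c (coord_proj (model M) x)) \<in> topspace (top_of_set (chart_domain M c)) \<rightarrow> carrier M"
    using chart_inv_chart[OF M c] chart_subset[OF M c] by (auto simp: chart_domain_def ambient_def)
qed

locale R_action =
  fixes M :: "('a, 'e::euclidean_space) manifold" and act :: "real \<Rightarrow> 'a \<Rightarrow> 'a"
  assumes M: "smooth_manifold M"
    and act: "smooth_map (prod_manifold real_line M) M (\<lambda>(t, p). act t p)"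
    and act0: "\<And>p. p \<in> carrier M \<Longrightarrow> act 0 p = p"
begin

lemma flow_domain_open:
  assumes c: "c \<in> atlas M"
  shows "open (chart_flow_domain M act c)"
proof -
  let ?X = "top_of_set (UNIV \<times> chart_domain M c) :: (real \<times> 'e) topology"
  let ?h = "\<lambda>z. (fst z, chart_inv c (coord_proj (model M) (snd z)))"
  have X: "openin euclidean (UNIV \<times> chart_domain M c)"
    using chart_domain_open[OF M c] by (simp add: open_Times)
  have "continuous_map ?X (mtop M) ((\<lambda>x. chart_inv c (coord_proj (model M) x)) \<circ> snd)"
    by (rule continuous_map_compose[OF _ chart_inv_continuous[OF M c]])
      (auto intro!: continuous_intros)
  moreover have "continuous_map ?X euclideanreal fst" by (auto intro!: continuous_intros)
  ultimately have "continuous_map ?X (prod_topology euclideanreal (mtop M)) ?h"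
    by (simp add: continuous_map_pairwise o_def)
  moreover have "continuous_map (prod_topology euclideanreal (mtop M)) (mtop M) (\<lambda>(t, p). act t p)"
    using act by (simp add: smooth_map_def prod_manifold_def real_line_def)
  ultimately have "continuous_map ?X (mtop M) ((\<lambda>(t, p). act t p) \<circ> ?h)"
    by (rule continuous_map_compose)
  from openin_continuous_map_preimage[OF this chart_open[OF M c]]
  have "openin ?X {z \<in> UNIV \<times> chart_domain M c. act (fst z) (chart_inv c (coord_proj (model M) (snd z))) \<in> fst c}"
    by simp
  then have "openin euclidean {z \<in> UNIV \<times> chart_domain M c. act (fst z) (chart_inv c (coord_proj (model M) (snd z))) \<in> fst c}"
    using openin_trans_full X by blast
  moreover have "{z \<in> UNIV \<times> chart_domain M c. act (fst z) (chart_inv c (coord_proj (model M) (snd z))) \<in> fst c}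
    = chart_flow_domain M act c" by (auto simp: chart_flow_domain_def)
  ultimately show ?thesis by simp
qed

lemma smooth_flow:
  assumes c: "c \<in> atlas M"
  shows "smooth_open (chart_flow_domain M act c) (chart_flow M act c)"
proof -
  define C where "C = ((UNIV::real set) \<times> fst c, map_prod (id::real \<Rightarrow> real) (snd c))"
  have C: "C \<in> atlas (prod_manifold real_line M)"
    using c by (force simp: C_def prod_manifold_def real_line_def)
  let ?X = "snd C ` {z \<in> fst C. (\<lambda>(t, p). act t p) z \<in> fst c}"
  let ?F = "snd c \<circ> (\<lambda>(t, p). act t p) \<circ> chart_inv C"
  let ?r = "\<lambda>z::real \<times> 'e. (fst z, coord_proj (model M) (snd z))"
  have F: "smooth_on ?X ?F"
    using act[unfolded smooth_map_def, THEN conjunct2, rule_format, OF C c] .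
  have injC: "inj_on (snd C) (fst C)"
    using chart_inj[OF M c] by (auto simp: C_def inj_on_def)
  have inv: "chart_inv C (t, snd c p) = (t, p)" if "p \<in> fst c" for t p
  proof -
    have "(t, p) \<in> fst C" "snd C (t, p) = (t, snd c p)" using that by (auto simp: C_def)
    then show ?thesis using inv_into_f_f[OF injC] unfolding chart_inv_def by metis
  qed
  have "bounded_linear ?r"
    by (intro bounded_linear_Pair bounded_linear_fst bounded_linear_compose[OF coord_proj_linear bounded_linear_snd])
  moreover have "?r ` chart_flow_domain M act c \<subseteq> ?X"
  proof
    fix y assume "y \<in> ?r ` chart_flow_domain M act c"
    then obtain z where z: "z \<in> chart_flow_domain M act c" "y = ?r z" by blast
    then obtain p where p: "p \<in> fst c" "coord_proj (model M) (snd z) = snd c p"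
      using chart_domain_proj[of "snd z" M c] by (auto simp: chart_flow_domain_def)
    have "y = snd C (fst z, p)" using z(2) p(2) by (simp add: C_def)
    moreover have "(fst z, p) \<in> {z \<in> fst C. (\<lambda>(t, p). act t p) z \<in> fst c}"
      using z(1) p chart_inv_chart[OF M c p(1)] by (simp add: C_def chart_flow_domain_def)
    ultimately show "y \<in> ?X" by blast
  qed
  ultimately have "smooth_open (chart_flow_domain M act c) (\<lambda>z. ?F (?r z))"
    by (intro smooth_on_retract[OF F _ flow_domain_open[OF c]])
  then show ?thesis
  proof (rule smooth_open_cong)
    fix z assume "z \<in> chart_flow_domain M act c"
    then obtain p where p: "p \<in> fst c" "coord_proj (model M) (snd z) = snd c p"
      using chart_domain_proj[of "snd z" M c] by (auto simp: chart_flow_domain_def)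
    then show "?F (?r z) = chart_flow M act c z"
      using inv[OF p(1)] chart_inv_chart[OF M c p(1)] by (simp add: chart_flow_def)
  qed
qed

lemma flow_domain_zero:
  assumes c: "c \<in> atlas M" and x: "x \<in> chart_domain M c"
  shows "(0, x) \<in> chart_flow_domain M act c" "chart_flow M act c (0, x) = coord_proj (model M) x"
proof -
  obtain p where p: "p \<in> fst c" "coord_proj (model M) x = snd c p" using chart_domain_proj[OF x] .
  have "act 0 p = p" using act0 chart_subset[OF M c] p(1) by blast
  then show "(0, x) \<in> chart_flow_domain M act c" "chart_flow M act c (0, x) = coord_proj (model M) x"
    using p x chart_inv_chart[OF M c p(1)] by (simp_all add: chart_flow_domain_def chart_flow_def)
qed

lemma smooth_flow_field:
  assumes c: "c \<in> atlas M"
  shows "smooth_open (chart_domain M c) (chart_flow_field M act c)"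
  unfolding chart_flow_field_def[abs_def]
proof (rule smooth_open_compose[OF _ smooth_open_D_smooth[OF smooth_flow[OF c]]])
  have "bounded_linear (\<lambda>x::'e. (0::real, x))"
    by (intro bounded_linear_Pair bounded_linear_zero bounded_linear_ident)
  then show "smooth_open (chart_domain M c) (\<lambda>x. (0::real, x))"
    by (rule smooth_open_bounded_linear[OF _ chart_domain_open[OF M c]])
  show "Pair 0 ` chart_domain M c \<subseteq> chart_flow_domain M act c" using flow_domain_zero(1)[OF c] by blast
qed

lemma chart_flow_chart:
  assumes c: "c \<in> atlas M" and p: "p \<in> fst c"
  shows "chart_flow M act c (t, snd c p) = snd c (act t p)"
    "(t, snd c p) \<in> chart_flow_domain M act c \<longleftrightarrow> act t p \<in> fst c"
  using chart_proj[OF M c p] chart_inv_chart[OF M c p] by (simp_all add: chart_flow_def chart_flow_domain_def)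

lemma orbit_near:
  assumes c: "c \<in> atlas M" and p: "p \<in> fst c"
  shows "\<exists>S. open S \<and> 0 \<in> S \<and> (\<forall>t\<in>S. act t p \<in> fst c)"
proof (intro exI conjI ballI)
  let ?S = "(\<lambda>t. (t, snd c p)) -` chart_flow_domain M act c"
  show "open ?S"
    by (intro continuous_open_vimage flow_domain_open[OF c] continuous_intros)
  show "0 \<in> ?S" using flow_domain_zero(1)[OF c chart_proj(2)[OF M c p]] by simp
  show "act t p \<in> fst c" if "t \<in> ?S" for t using that chart_flow_chart(2)[OF c p] by simp
qed

lemma orbit_derivative:
  assumes c: "c \<in> atlas M" and p: "p \<in> fst c"
  shows "((\<lambda>t. snd c (act t p)) has_vector_derivative chart_flow_field M act c (snd c p)) (at 0)"
proof -
  have "((\<lambda>t. chart_flow M act c ((0, snd c p) + t *\<^sub>R (1, 0))) has_vector_derivative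
      D (chart_flow M act c) ((0, snd c p) + 0 *\<^sub>R (1, 0)) (1, 0)) (at 0)"
    by (rule has_vector_derivative_D_line[OF smooth_flow[OF c]])
      (use flow_domain_zero(1)[OF c chart_proj(2)[OF M c p]] in simp)
  then show ?thesis by (simp add: chart_flow_chart(1)[OF c p] chart_flow_field_def)
qed

lemma fundamental_field_chart:
  assumes c: "c \<in> charts_at M p"
  shows "fundamental_field M act p c = chart_flow_field M act c (snd c p)"
  using vector_derivative_at[OF orbit_derivative[OF charts_atD[OF c]]] c by (simp add: fundamental_field_def)

lemma flow_field_in_span:
  assumes c: "c \<in> atlas M" and p: "p \<in> fst c"
  shows "chart_flow_field M act c (snd c p) \<in> span (model M)"
proof -
  obtain S where S: "open S" "0 \<in> S" "\<And>t. t \<in> S \<Longrightarrow> act t p \<in> fst c" using orbit_near[OF c p] by blast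
  have "((\<lambda>t. snd c (act t p)) has_vector_derivative coord_proj (model M) (chart_flow_field M act c (snd c p))) (at 0)"
    by (rule has_vector_derivative_transform_within_open[OF
        bounded_linear.has_vector_derivative[OF coord_proj_linear orbit_derivative[OF c p]] S(1,2)])
      (simp add: chart_proj(1)[OF M c S(3)])
  then have "coord_proj (model M) (chart_flow_field M act c (snd c p)) = chart_flow_field M act c (snd c p)"
    using vector_derivative_unique_at orbit_derivative[OF c p] by blast
  then show ?thesis using coord_proj_in by metis
qed

text \<open>For the identity this is the transformation law which makes the fundamental field a tangent vector,
  and for the bundle projection, constant along orbits, it gives verticality.\<close>

lemma orbit_chain:
  fixes N :: "('b, 'f::euclidean_space) manifold"
  assumes N: "smooth_manifold N" and f: "smooth_map M N f"
    and c: "c \<in> charts_at M p" and d: "d \<in> charts_at N (f p)"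
  shows "((\<lambda>t. snd d (f (act t p))) has_vector_derivative
    dir_deriv (snd d \<circ> f \<circ> chart_inv c) (snd c p) (fundamental_field M act p c)) (at 0)"
proof -
  note at = charts_atD[OF c] charts_atD[OF d]
  obtain S where S: "open S" "0 \<in> S" "\<And>t. t \<in> S \<Longrightarrow> act t p \<in> fst c" using orbit_near[OF at(1,2)] by blast
  have p0: "act 0 p = p" using act0 chart_subset[OF M at(1)] at(2) by blast
  note X = overlap_open[OF M N f at(1,3)] and F = overlap_smooth[OF f at(1,3)]
  have x: "snd c p \<in> overlap c d f" by (rule overlap_mem[where f = f, OF c d])
  let ?F = "snd d \<circ> f \<circ> chart_inv c"
  have "((\<lambda>t. ?F (snd c (act t p))) has_vector_derivative
     D (extend (model M) ?F) (snd c (act 0 p)) (chart_flow_field M act c (snd c p))) (at 0)"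
  proof (rule dir_deriv_curve[OF model_Basis[OF M] X F orbit_derivative[OF at(1,2)]])
    show "snd c (act 0 p) \<in> overlap c d f" using x p0 by simp
    show "\<forall>\<^sub>F t in nhds 0. snd c (act t p) \<in> span (model M)"
      unfolding eventually_nhds
      using S chart_in_span[OF M] at(1) by (intro exI[of _ S]) (auto simp: charts_at_def)
  qed
  then have "((\<lambda>t. ?F (snd c (act t p))) has_vector_derivative
     dir_deriv ?F (snd c p) (fundamental_field M act p c)) (at 0)"
    unfolding fundamental_field_chart[OF c] p0
    using dir_deriv_eq[OF model_Basis[OF M] X F x flow_field_in_span[OF at(1,2)]] by simp
  then show ?thesis
    by (rule has_vector_derivative_transform_within_open[OF _ S(1,2)])
      (simp add: chart_inv_chart[OF M at(1) S(3)])
qed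

lemma fundamental_field_tangent:
  assumes p: "p \<in> carrier M"
  shows "fundamental_field M act p \<in> tangent_space M p"
  unfolding tangent_space_def mem_Collect_eq
proof (intro conjI ballI allI impI)
  fix c assume c: "c \<in> charts_at M p"
  show "fundamental_field M act p c \<in> span (model M)"
    unfolding fundamental_field_chart[OF c] by (rule flow_field_in_span[OF charts_atD[OF c]])
  fix d assume d: "d \<in> charts_at M p"
  have "((\<lambda>t. snd d (act t p)) has_vector_derivative
    dir_deriv (snd d \<circ> chart_inv c) (snd c p) (fundamental_field M act p c)) (at 0)"
    using orbit_chain[OF M smooth_map_id[OF M] c, of d] d by simp
  from vector_derivative_at[OF this]
  show "fundamental_field M act p d = dir_deriv (snd d \<circ> chart_inv c) (snd c p) (fundamental_field M act p c)"
    using d by (simp add: fundamental_field_def)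
qed (simp add: fundamental_field_def)

lemma fundamental_field_vertical:
  fixes B :: "('b, 'f::euclidean_space) manifold"
  assumes B: "smooth_manifold B" and \<pi>: "smooth_map M B \<pi>" and p: "p \<in> carrier M"
    and inv: "\<And>t. \<pi> (act t p) = \<pi> p"
  shows "fundamental_field M act p \<in> vertical_space M B \<pi> p"
proof -
  obtain c where c: "c \<in> charts_at M p" using charts_at_nonempty[OF M p] by blast
  note t = fundamental_field_tangent[OF p]
  have "differential M B \<pi> p (fundamental_field M act p) d = 0" for d
  proof (cases "d \<in> charts_at B (\<pi> p)")
    case True
    have "((\<lambda>t. snd d (\<pi> (act t p))) has_vector_derivative differential M B \<pi> p (fundamental_field M act p) d) (at 0)"
      unfolding differential_chart[OF M B \<pi> c True t] by (rule orbit_chain[OF B \<pi> c True])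
    moreover have "((\<lambda>t. snd d (\<pi> (act t p))) has_vector_derivative 0) (at 0)"
      unfolding inv by (rule has_vector_derivative_const)
    ultimately show ?thesis by (rule vector_derivative_unique_at)
  next
    case False
    then show ?thesis by (simp add: differential_def Let_def)
  qed
  then show ?thesis using t by (auto simp: vertical_space_def)
qed

end

section \<open>Infinitesimal invariance of the bivector\<close>

text \<open>Let \<open>a\<^sub>t\<close> represent the pullback by \<open>\<phi>\<^sub>t\<close> of the covector represented by \<open>a\<close>. That \<open>\<phi>\<^sub>t\<close> is a Poisson map
reads \<open>A(\<phi>\<^sub>t x) a \<bullet> b = A(x) a\<^sub>t \<bullet> b\<^sub>t\<close>. The claim is the derivative of this identity at \<open>t = 0\<close>: since
time and space derivatives of the flow commute, \<open>a\<^sub>t\<close> has as derivative the transpose of \<open>D \<kappa> x\<close>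
applied to \<open>a\<close>, and skew-symmetry of \<open>A\<close> brings both terms on the right to the stated form.\<close>

lemma (in R_action) lie_coords:
  assumes P: "bivector_field M P" and st: "poisson_stationary M act P"
    and c: "c \<in> atlas M" and p: "p \<in> fst c"
    and x: "x = snd c p" and A: "A = coord_matrix M P c" and \<kappa>: "\<kappa> = chart_flow_field M act c"
  shows "D (\<lambda>x. A x a) x (\<kappa> x) \<bullet> b = D \<kappa> x (A x a) \<bullet> b - D \<kappa> x (A x b) \<bullet> a"
proof -
  let ?E = "model M" and ?\<Phi> = "chart_flow M act c" and ?Z = "chart_flow_domain M act c"
  have cp: "c \<in> charts_at M p" using c p by (simp add: charts_at_def)
  have pM: "p \<in> carrier M" using p chart_subset[OF M c] by blast
  have xd: "x \<in> chart_domain M c" and xp: "coord_proj ?E x = x" unfolding x using chart_proj[OF M c p] by auto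
  have xs: "x \<in> span ?E" using xp coord_proj_in by metis
  have z0: "(0, x) \<in> ?Z" by (rule flow_domain_zero(1)[OF c xd])
  note sm\<Phi> = smooth_flow[OF c]
  obtain T where T: "open T" "0 \<in> T" "\<And>t. t \<in> T \<Longrightarrow> act t p \<in> fst c" using orbit_near[OF c p] by blast
  have zT: "(t, x) \<in> ?Z" if "t \<in> T" for t unfolding x using chart_flow_chart(2)[OF c p] T(3)[OF that] by blast
  have smt: "smooth_map M M (act t)" for t using st by (simp add: poisson_stationary_def poisson_map_def)
  \<comment> \<open>The vector \<open>a\<^sub>t\<close>, the transpose of the space derivative of the flow applied to \<open>a\<close>.\<close>
  define tr where "tr t a = (\<Sum>k\<in>?E. (D ?\<Phi> (t, x) (0, k) \<bullet> a) *\<^sub>R k)" for t a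
  have d: "dir_deriv (snd c \<circ> act t \<circ> chart_inv c) (snd c p) v = D ?\<Phi> (t, x) (0, v)"
    if t: "t \<in> T" and v: "v \<in> span ?E" for t v
  proof -
    have "((\<lambda>s. ?\<Phi> ((t, x) + s *\<^sub>R (0, v))) has_vector_derivative D ?\<Phi> ((t, x) + 0 *\<^sub>R (0, v)) (0, v)) (at 0)"
      by (rule has_vector_derivative_D_line[OF sm\<Phi>]) (use zT[OF t] in simp)
    moreover have "?\<Phi> ((t, x) + s *\<^sub>R (0, v)) = (snd c \<circ> act t \<circ> chart_inv c) (snd c p + s *\<^sub>R v)" for s
      using coord_proj_id[OF model_Basis[OF M], of "x + s *\<^sub>R v"] xs v
      by (simp add: chart_flow_def x span_add span_scale)
    ultimately show ?thesis unfolding dir_deriv_def by (simp add: vector_derivative_at)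
  qed
  have pull: "pullback_covector M M (act t) p (coord_covector M c (act t p) a) = coord_covector M c p (tr t a)"
    if t: "t \<in> T" for t a
  proof
    fix v
    have ct: "c \<in> charts_at M (act t p)" using c T(3)[OF t] by (simp add: charts_at_def)
    show "pullback_covector M M (act t) p (coord_covector M c (act t p) a) v = coord_covector M c p (tr t a) v"
    proof (cases "v \<in> tangent_space M p")
      case True
      have lin: "linear (D ?\<Phi> (t, x))" by (rule smooth_open_linear_D[OF sm\<Phi> zT[OF t]])
      have "(0, v c) = (\<Sum>k\<in>?E. (v c \<bullet> k) *\<^sub>R (0::real, k))"
        using coord_proj_id[OF model_Basis[OF M] tangent_in_span[OF True cp]]
        by (simp add: coord_proj_def prod_eq_iff fst_sum snd_sum)
      then have "D ?\<Phi> (t, x) (0, v c) = (\<Sum>k\<in>?E. (v c \<bullet> k) *\<^sub>R D ?\<Phi> (t, x) (0, k))"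
        by (simp only: linear_sum[OF lin] linear_cmul[OF lin])
      then have "differential M M (act t) p v c \<bullet> a = v c \<bullet> tr t a"
        unfolding differential_chart[OF M M smt cp ct True] d[OF t tangent_in_span[OF True cp]]
        by (simp add: tr_def inner_sum_left inner_sum_right mult.commute)
      then show ?thesis
        using True differential_tangent[OF M M smt pM True, of t] by (simp add: pullback_covector_def coord_covector_def)
    next
      case False
      then show ?thesis by (simp add: pullback_covector_def coord_covector_def)
    qed
  qed
  have inv: "A (snd c (act t p)) a \<bullet> b = A x (tr t a) \<bullet> tr t b" if t: "t \<in> T" for t
  proof -
    have ct: "c \<in> charts_at M (act t p)" using c T(3)[OF t] by (simp add: charts_at_def)
    have pm: "poisson_map M P M P (act t)" using st by (simp add: poisson_stationary_def)
    have "P (act t p) (coord_covector M c (act t p) a) (coord_covector M c (act t p) b) =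
      P p (coord_covector M c p (tr t a)) (coord_covector M c p (tr t b))"
      using pm[unfolded poisson_map_def, THEN conjunct2, rule_format, OF pM
          coord_covector_cotangent[OF M, of c _ a] coord_covector_cotangent[OF M, of c _ b]]
      unfolding pull[OF t] .
    then show ?thesis
      unfolding bivector_coords[OF M P ct] bivector_coords[OF M P cp] A x
        coord_matrix_eq[OF M c p] coord_matrix_eq[OF M c T(3)[OF t]] .
  qed
  have Dk: "((\<lambda>t. D ?\<Phi> (t, x) (0, k)) has_vector_derivative D \<kappa> x k) (at 0)" for k
  proof -
    have "((\<lambda>t. D ?\<Phi> ((0, x) + t *\<^sub>R (1, 0)) (0, k)) has_vector_derivative
        D (\<lambda>z. D ?\<Phi> z (0, k)) ((0, x) + 0 *\<^sub>R (1, 0)) (1, 0)) (at 0)"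
      by (rule has_vector_derivative_D_line[OF smooth_open_D_smooth[OF sm\<Phi>]]) (use z0 in simp)
    then have "((\<lambda>t. D ?\<Phi> (t, x) (0, k)) has_vector_derivative D (\<lambda>z. D ?\<Phi> z (0, k)) (0, x) (1, 0)) (at 0)"
      by simp
    moreover have "D (\<lambda>z. D ?\<Phi> z (0, k)) (0, x) (1, 0) = D (\<lambda>z. D ?\<Phi> z (1, 0)) (0, x) (0, k)"
      by (rule second_derivative_symmetric[OF sm\<Phi> z0])
    moreover have "D (\<lambda>z. D ?\<Phi> z (1, 0)) (0, x) (0, k) = D \<kappa> x k"
    proof -
      have "((\<lambda>y. (0::real, y)) has_derivative (\<lambda>h. (0, h))) (at x)" by (auto intro!: derivative_eq_intros)
      from has_derivative_compose[OF this smooth_open_D[OF smooth_open_D_smooth[OF sm\<Phi>] z0]]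
      have "(\<kappa> has_derivative (\<lambda>h. D (\<lambda>z. D ?\<Phi> z (1, 0)) (0, x) (0, h))) (at x)"
        unfolding \<kappa> chart_flow_field_def[abs_def] .
      from D_eqI[OF this] show ?thesis by simp
    qed
    ultimately show ?thesis by simp
  qed
  have tr': "((\<lambda>t. tr t a) has_vector_derivative (\<Sum>k\<in>?E. (D \<kappa> x k \<bullet> a) *\<^sub>R k)) (at 0)" for a
    unfolding tr_def
    by (intro has_vector_derivative_sum bounded_linear.has_vector_derivative[OF bounded_linear_scaleR_left]
        bounded_linear.has_vector_derivative[OF bounded_linear_inner_left] Dk)
  have tr0: "tr 0 a = coord_proj ?E a" for a
  proof -
    have "D ?\<Phi> (0, x) (0, k) = k" if "k \<in> ?E" for k
    proof -
      have "dir_deriv (snd c \<circ> act 0 \<circ> chart_inv c) (snd c p) k = k"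
      proof -
        have "dir_deriv (snd c \<circ> act 0 \<circ> chart_inv c) (snd c p) k = dir_deriv (snd c \<circ> chart_inv c) (snd c p) k"
        proof (rule dir_deriv_cong[OF chart_image_openin[OF M c]])
          fix y assume "y \<in> snd c ` fst c"
          then obtain q where "q \<in> fst c" "y = snd c q" by blast
          then show "(snd c \<circ> act 0 \<circ> chart_inv c) y = (snd c \<circ> chart_inv c) y"
            using chart_inv_chart[OF M c, of q] act0[of q] chart_subset[OF M c] by auto
        qed (use p that in \<open>auto intro: span_base\<close>)
        also have "\<dots> = k" by (rule transition_self[OF M cp span_base[OF that]])
        finally show ?thesis .
      qed
      then show ?thesis using d[OF T(2) span_base[OF that]] by simp
    qed
    then show ?thesis by (simp add: tr_def coord_proj_def inner_commute)
  qed
  have Ap: "A x (coord_proj ?E a) = A x a" for a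
  proof -
    have "coord_proj ?E a \<bullet> i = a \<bullet> i" if "i \<in> ?E" for i
    proof -
      have "coord_proj ?E i = i" by (rule coord_proj_id[OF model_Basis[OF M] span_base[OF that]])
      then have "a \<bullet> i = a \<bullet> coord_proj ?E i" by simp
      also have "\<dots> = coord_proj ?E a \<bullet> i"
        by (simp add: coord_proj_def inner_sum_left inner_sum_right inner_commute mult.commute)
      finally show ?thesis by simp
    qed
    then show ?thesis unfolding A coord_matrix_def by simp
  qed
  have skew: "A x a \<bullet> b = - (A x b \<bullet> a)" for a b unfolding A by (rule coord_matrix_skew[OF M P c xd])
  have Dtr: "A x a \<bullet> (\<Sum>k\<in>?E. (D \<kappa> x k \<bullet> b) *\<^sub>R k) = D \<kappa> x (A x a) \<bullet> b" for a b
  proof -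
    have lin: "linear (D \<kappa> x)" unfolding \<kappa> by (rule smooth_open_linear_D[OF smooth_flow_field[OF c] xd])
    have "A x a = coord_proj ?E (A x a)"
      unfolding A by (rule coord_proj_id[OF model_Basis[OF M] coord_matrix_in_span, symmetric])
    also have "D \<kappa> x \<dots> \<bullet> b = (\<Sum>k\<in>?E. (A x a \<bullet> k) * (D \<kappa> x k \<bullet> b))"
      unfolding coord_proj_def by (simp add: linear_sum[OF lin] linear_cmul[OF lin] inner_sum_left)
    finally show ?thesis by (simp add: inner_sum_right mult.commute)
  qed
  have p0: "act 0 p = p" by (rule act0[OF pM])
  have blA: "bounded_linear (A x)" unfolding A using linear_coord_matrix linear_conv_bounded_linear by blast
  have lhs: "((\<lambda>t. A (snd c (act t p)) a \<bullet> b) has_vector_derivative D (\<lambda>x. A x a) x (\<kappa> x) \<bullet> b) (at 0)"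
  proof -
    have DA: "((\<lambda>x. A x a) has_derivative D (\<lambda>x. A x a) (snd c (act 0 p))) (at (snd c (act 0 p)))"
      unfolding p0 x[symmetric] A by (rule smooth_open_D[OF smooth_coord_matrix[OF M P c] xd])
    have lin: "linear (D (\<lambda>x. A x a) x)"
      using DA unfolding p0 x[symmetric] by (rule has_derivative_linear)
    have "((\<lambda>t. A (snd c (act t p)) a) has_derivative (\<lambda>h. D (\<lambda>x. A x a) x (h *\<^sub>R \<kappa> x))) (at 0)"
      using has_derivative_compose[OF orbit_derivative[OF c p, unfolded has_vector_derivative_def] DA]
      unfolding p0 x[symmetric] \<kappa> .
    then have "((\<lambda>t. A (snd c (act t p)) a) has_vector_derivative D (\<lambda>x. A x a) x (\<kappa> x)) (at 0)"
      unfolding has_vector_derivative_def linear_cmul[OF lin] .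
    then show ?thesis by (rule bounded_linear.has_vector_derivative[OF bounded_linear_inner_left])
  qed
  have "((\<lambda>t. A x (tr t a) \<bullet> tr t b) has_vector_derivative
      A x (tr 0 a) \<bullet> (\<Sum>k\<in>?E. (D \<kappa> x k \<bullet> b) *\<^sub>R k) + A x (\<Sum>k\<in>?E. (D \<kappa> x k \<bullet> a) *\<^sub>R k) \<bullet> tr 0 b) (at 0)"
    by (rule bounded_bilinear.has_vector_derivative[OF bounded_bilinear_inner
          bounded_linear.has_vector_derivative[OF blA tr'] tr'])
  moreover have "((\<lambda>t. A x (tr t a) \<bullet> tr t b) has_vector_derivative D (\<lambda>x. A x a) x (\<kappa> x) \<bullet> b) (at 0)"
    by (rule has_vector_derivative_transform_within_open[OF lhs T(1,2)]) (rule inv)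
  ultimately have "D (\<lambda>x. A x a) x (\<kappa> x) \<bullet> b =
      A x (tr 0 a) \<bullet> (\<Sum>k\<in>?E. (D \<kappa> x k \<bullet> b) *\<^sub>R k) + A x (\<Sum>k\<in>?E. (D \<kappa> x k \<bullet> a) *\<^sub>R k) \<bullet> tr 0 b"
    using vector_derivative_unique_at by blast
  also have "A x (tr 0 a) \<bullet> (\<Sum>k\<in>?E. (D \<kappa> x k \<bullet> b) *\<^sub>R k) = D \<kappa> x (A x a) \<bullet> b"
    unfolding tr0 Ap Dtr ..
  also have "A x (\<Sum>k\<in>?E. (D \<kappa> x k \<bullet> a) *\<^sub>R k) \<bullet> tr 0 b = - (D \<kappa> x (A x b) \<bullet> a)"
    by (subst skew) (simp only: tr0 Ap Dtr)
  finally show ?thesis by simp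
qed

section \<open>The Carroll vector field on a leaf\<close>

text \<open>An extended function is constant across the model space; so its derivatives at all points of the
cylinder reduce to those at points of the chart, in directions of the model space.\<close>

lemma D_extend_proj:
  assumes "E \<subseteq> Basis" and X: "openin (top_of_set (span E)) X" and F: "smooth_on X F" and y: "y \<in> ambient E X"
  shows "D (extend E F) y h = D (extend E F) (coord_proj E y) (coord_proj E h)"
proof -
  have idem: "coord_proj E (coord_proj E z) = coord_proj E z" for z
    by (rule coord_proj_id[OF assms(1) coord_proj_in])
  have y': "coord_proj E y \<in> ambient E X" using y by (simp add: ambient_def idem)
  have "((\<lambda>z. extend E F (coord_proj E z)) has_derivative (\<lambda>h. D (extend E F) (coord_proj E y) (coord_proj E h))) (at y)"
    by (rule has_derivative_compose[OF bounded_linear_imp_has_derivative[OF coord_proj_linear]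
          smooth_open_D[OF smooth_extend[OF X F] y']])
  moreover have "(\<lambda>z. extend E F (coord_proj E z)) = extend E F" by (simp add: extend_def[abs_def] idem)
  ultimately show ?thesis by (simp add: D_eqI)
qed

text \<open>A leaf of positive dimension has a non-zero tangent vector, and its image under the injective
differential of the inclusion lies in the image of the anchor.\<close>

lemma anchor_rank_nonzero_on_leaf:
  fixes M S :: "('a, 'e::euclidean_space) manifold"
  assumes M: "smooth_manifold M" and S: "smooth_manifold S" and \<iota>: "smooth_map S M id"
    and q: "q \<in> carrier S" "q \<in> carrier M"
    and inj: "inj_on (differential S M id q) (tangent_space S q)"
    and im: "differential S M id q ` tangent_space S q = anchor_image M P q"
    and dim: "manifold_dim S \<noteq> 0"
  shows "anchor_rank M P q \<noteq> 0"
proof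
  assume rank: "anchor_rank M P q = 0"
  obtain d where d: "d \<in> charts_at S q" using charts_at_nonempty[OF S q(1)] by blast
  define c where "c = (SOME c. c \<in> charts_at M q)"
  have c: "c \<in> charts_at M q" unfolding c_def using charts_at_nonempty[OF M q(2)] by (rule someI_ex)
  have "model S \<noteq> {}" using dim by (metis card.empty manifold_dim_def)
  then obtain b where b: "b \<in> model S" by blast
  have b0: "b \<noteq> 0" using b model_Basis[OF S] nonzero_Basis by blast
  note bs = span_base[OF b]
  note im' = immersion_coords[OF M S \<iota> inj c d]
  let ?L = "D (extend (model S) (snd c \<circ> id \<circ> chart_inv d)) (snd d q)"
  let ?v = "coord_vector S d q b"
  note v = coord_vector_tangent[OF S d bs]
  have "differential S M id q ?v \<in> anchor_image M P q" using im v by blast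
  moreover have "(\<lambda>v. v c) ` anchor_image M P q \<subseteq> {0}"
    using rank unfolding anchor_rank_def c_def[symmetric] by (simp only: dim_eq_0)
  ultimately have "differential S M id q ?v c = 0" by blast
  then have "?L b = 0" using im'(3)[OF v(1)] v(2) by simp
  moreover have "?L 0 = 0" by (rule linear_0[OF im'(1)])
  ultimately have "b = 0" using inj_onD[OF im'(2) _ bs span_0] by simp
  then show False using b0 by simp
qed

theorem theorem2p2:
  fixes M S :: "('a, 'e::euclidean_space) manifold"
    and B :: "('b, 'f::euclidean_space) manifold"
    and \<pi> :: "'a \<Rightarrow> 'b"
    and act :: "real \<Rightarrow> 'a \<Rightarrow> 'a"
    and g :: "('a, 'e) two_tensor"
    and \<tau> :: "('a, 'e) one_form"
    and P :: "('a, 'e) bivector"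
  assumes "carrollian_poisson_bundle M B \<pi> act g \<tau> P"
    and "poisson_stationary M act P"
    and "symplectic_leaf M P S"
    and "manifold_dim S \<noteq> 0"
  shows "locally_hamiltonian M P S (fundamental_field M act)"
proof -
  let ?K = "fundamental_field M act"
  have cb: "carrollian_bundle M B \<pi> act g \<tau>" and ps: "poisson_structure M P"
    and ker: "\<And>p. p \<in> carrier M \<Longrightarrow> anchor_rank M P p \<noteq> 0 \<Longrightarrow> metric_kernel M g p \<subseteq> anchor_image M P p"
    using assms(1) unfolding carrollian_poisson_bundle_def by blast+
  have pb: "principal_R_bundle M B \<pi> act"
    and vert: "\<And>p. p \<in> carrier M \<Longrightarrow> metric_kernel M g p = vertical_space M B \<pi> p"
    using cb unfolding carrollian_bundle_def by blast+
  have M: "smooth_manifold M" and B: "smooth_manifold B" and \<pi>: "smooth_map M B \<pi>"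
    and act: "smooth_map (prod_manifold real_line M) M (\<lambda>(t, p). act t p)"
    and act0: "\<And>p. p \<in> carrier M \<Longrightarrow> act 0 p = p"
    and inv: "\<And>t p. p \<in> carrier M \<Longrightarrow> \<pi> (act t p) = \<pi> p"
    using pb unfolding principal_R_bundle_def by blast+
  have bf: "bivector_field M P" using ps by (simp add: poisson_structure_def)
  have im: "integral_manifold M P S" using assms(3) by (simp add: symplectic_leaf_def)
  have S: "smooth_manifold S" and SM: "carrier S \<subseteq> carrier M" and \<iota>: "smooth_map S M id"
    and inj: "\<And>q. q \<in> carrier S \<Longrightarrow> inj_on (differential S M id q) (tangent_space S q)"
    and image: "\<And>q. q \<in> carrier S \<Longrightarrow> differential S M id q ` tangent_space S q = anchor_image M P q"
    using im unfolding integral_manifold_def by blast+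
  interpret R_action M act by unfold_locales (fact M act act0)+
  have K: "?K q \<in> anchor_image M P q" if q: "q \<in> carrier S" for q
  proof -
    have qM: "q \<in> carrier M" using q SM by blast
    have "?K q \<in> vertical_space M B \<pi> q" by (rule fundamental_field_vertical[OF B \<pi> qM inv[OF qM]])
    moreover have "anchor_rank M P q \<noteq> 0"
      by (rule anchor_rank_nonzero_on_leaf[OF M S \<iota> q qM inj[OF q] image[OF q] assms(4)])
    ultimately show ?thesis using ker[OF qM] vert[OF qM] by blast
  qed
  have "\<exists>U f. openin (mtop S) U \<and> p \<in> U \<and> smooth_function S U f \<and>
        (\<forall>q\<in>U. ?K q = differential S M id q (anchor S (restrict_bivector M P S) q (function_differential S f q)))"
    if p: "p \<in> carrier S" for p
  proof -
    have pM: "p \<in> carrier M" using p SM by blast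
    obtain d where d: "d \<in> charts_at S p" using charts_at_nonempty[OF S p] by blast
    obtain c where c: "c \<in> charts_at M p" using charts_at_nonempty[OF M pM] by blast
    note at = charts_atD[OF d] charts_atD[OF c]
    let ?F = "snd c \<circ> id \<circ> chart_inv d" and ?E = "model S" and ?Y = "overlap d c id"
    note Y = overlap_open[OF S M \<iota> at(1,3)] and F = overlap_smooth[OF \<iota> at(1,3)]
    define i where "i = extend ?E ?F"
    define V where "V = ambient ?E ?Y"
    define A where "A = coord_matrix M P c"
    define \<kappa> where "\<kappa> = chart_flow_field M act c"
    have YE: "?Y \<subseteq> span ?E" by (rule openin_imp_subset[OF Y])
    have proj: "coord_proj ?E y = y" if "y \<in> span ?E" for y by (rule coord_proj_id[OF model_Basis[OF S] that])
    have V: "\<exists>q. q \<in> fst d \<and> q \<in> fst c \<and> coord_proj ?E y = snd d q \<and> i y = snd c q" if "y \<in> V" for y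
    proof -
      obtain q where q: "q \<in> fst d" "q \<in> fst c" "coord_proj ?E y = snd d q"
        using \<open>y \<in> V\<close> unfolding V_def ambient_def overlap_def by auto
      then have "i y = snd c q" by (simp add: i_def extend_def chart_inv_chart[OF S at(1)])
      then show ?thesis using q by blast
    qed
    have smi: "smooth_open V i" unfolding V_def i_def by (rule smooth_extend[OF Y F])
    have iX: "i ` V \<subseteq> chart_domain M c" using V chart_proj(2)[OF M at(3)] by fastforce
    have charts: "d \<in> charts_at S q" "c \<in> charts_at M q" "q \<in> carrier S"
      if "q \<in> fst d" "q \<in> fst c" for q
      using that at chart_subset[OF S at(1)] by (auto simp: charts_at_def)
    have Aq: "A (snd c q) = bivector_matrix M P c q" if "q \<in> fst c" for q
      unfolding A_def by (rule coord_matrix_eq[OF M at(3) that])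
    have rangeA: "range (A (snd c q)) = (\<lambda>v. v c) ` anchor_image M P q" if q: "q \<in> fst d" "q \<in> fst c" for q
      unfolding Aq[OF q(2)] anchor_image_coords[OF M bf charts(2)[OF q]] image_image
      by (simp add: coord_vector_tangent(2)[OF M charts(2)[OF q] bivector_matrix_in_span])
    have rangei: "D i (snd d q) ` span ?E = range (A (snd c q))" if q: "q \<in> fst d" "q \<in> fst c" for q
    proof -
      note ch = charts[OF q]
      note imm = immersion_coords[OF M S \<iota> inj[OF ch(3)] ch(2,1), folded i_def]
      have sp: "span ?E = (\<lambda>v. v d) ` tangent_space S q"
      proof (intro equalityI subsetI)
        fix w assume "w \<in> span ?E"
        note cv = coord_vector_tangent[OF S ch(1) this]
        show "w \<in> (\<lambda>v. v d) ` tangent_space S q" 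
          by (rule image_eqI[where x = "coord_vector S d q w"]) (simp_all only: cv)
      next
        fix w assume "w \<in> (\<lambda>v. v d) ` tangent_space S q"
        then obtain v where "v \<in> tangent_space S q" "w = v d" by blast
        then show "w \<in> span ?E" using tangent_in_span[OF _ ch(1)] by blast
      qed
      have "D i (snd d q) ` span ?E = (\<lambda>v. D i (snd d q) (v d)) ` tangent_space S q"
        unfolding sp image_image ..
      also have "\<dots> = (\<lambda>v. differential S M id q v c) ` tangent_space S q"
        by (rule image_cong[OF refl]) (rule imm(3)[symmetric])
      also have "\<dots> = (\<lambda>v. v c) ` anchor_image M P q"
        unfolding image[OF ch(3), symmetric] image_image ..
      finally show ?thesis using rangeA[OF q] by simp
    qed
    have y0: "snd d p \<in> V"
    proof -
      have "snd d p \<in> ?Y" using at by (auto simp: overlap_def)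
      then show ?thesis unfolding V_def using ambient_superset[OF model_Basis[OF S] YE] by blast
    qed
    \<comment> \<open>The geometric hypotheses are checked at points of the leaf only: \<open>V\<close> is a cylinder over the overlap of the
      charts \<open>d\<close> and \<open>c\<close>, so \<open>i y\<close> is the coordinate vector of a point of the leaf for every \<open>y\<close> in \<open>V\<close>.\<close>
    have "\<exists>U f \<eta>. open U \<and> snd d p \<in> U \<and> U \<subseteq> V \<and> smooth_open U f \<and>
      (\<forall>y\<in>U. A (i y) (\<eta> y) = \<kappa> (i y) \<and> (f has_derivative (\<lambda>w. \<eta> y \<bullet> D i y w)) (at y))"
    proof (rule local_potential[OF _ _ _ _ smi iX y0, where r = "dim (span ?E)"])
      show "smooth_open (chart_domain M c) (\<lambda>x. A x a)" for a
        unfolding A_def by (rule smooth_coord_matrix[OF M bf at(3)])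
      show "smooth_open (chart_domain M c) \<kappa>" unfolding \<kappa>_def by (rule smooth_flow_field[OF at(3)])
      show "linear (A x)" for x unfolding A_def by (rule linear_coord_matrix)
      show "A x a \<bullet> b = - (A x b \<bullet> a)" if "x \<in> chart_domain M c" for x a b
        unfolding A_def by (rule coord_matrix_skew[OF M bf at(3) that])
    next
      fix x a b e assume "x \<in> i ` V"
      then obtain q where q: "q \<in> fst c" "x = snd c q" using V by blast
      show "D (\<lambda>x. A x b) x (A x a) \<bullet> e + D (\<lambda>x. A x e) x (A x b) \<bullet> a + D (\<lambda>x. A x a) x (A x e) \<bullet> b = 0"
        by (rule jacobi_coords[OF M ps at(3) q A_def])
      show "D (\<lambda>x. A x a) x (\<kappa> x) \<bullet> b = D \<kappa> x (A x a) \<bullet> b - D \<kappa> x (A x b) \<bullet> a"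
        by (rule lie_coords[OF bf assms(2) at(3) q A_def \<kappa>_def])
    next
      fix y assume y: "y \<in> V"
      then obtain q where q: "q \<in> fst d" "q \<in> fst c" "coord_proj ?E y = snd d q" "i y = snd c q" using V by blast
      have "range (D i y) = D i (snd d q) ` range (coord_proj ?E)"
        using D_extend_proj[OF model_Basis[OF S] Y F] y unfolding V_def i_def q(3)[symmetric]
        by (simp add: image_image)
      also have "range (coord_proj ?E) = span ?E"
        using proj coord_proj_in by (metis (no_types, lifting) image_subset_iff rangeI subsetI subset_antisym)
      finally show "range (D i y) = range (A (i y))" using rangei[OF q(1,2)] q(4) by simp
      note imm = immersion_coords[OF M S \<iota> inj[OF charts(3)[OF q(1,2)]] charts(2,1)[OF q(1,2)], folded i_def]
      show "dim (range (A (i y))) = dim (span ?E)"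
        unfolding q(4) rangei[OF q(1,2), symmetric]
        by (rule dim_image_eq[OF imm(1)]) (simp only: span_span imm(2))
      show "\<kappa> (i y) \<in> range (A (i y))"
        unfolding q(4) rangeA[OF q(1,2)] \<kappa>_def fundamental_field_chart[OF charts(2)[OF q(1,2)], symmetric]
        using K[OF charts(3)[OF q(1,2)]] by blast
    qed
    then obtain U f \<eta> where U: "open U" "snd d p \<in> U" "U \<subseteq> V" and f: "smooth_open U f"
      and A\<eta>: "\<And>y. y \<in> U \<Longrightarrow> A (i y) (\<eta> y) = \<kappa> (i y)"
      and df: "\<And>y. y \<in> U \<Longrightarrow> (f has_derivative (\<lambda>w. \<eta> y \<bullet> D i y w)) (at y)" by blast
    \<comment> \<open>The Hamiltonian: the potential read as a function on a chart domain of the leaf.\<close>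
    let ?U = "{q \<in> fst d. snd d q \<in> U}" and ?f = "f \<circ> snd d"
    have opU: "openin (mtop S) ?U" by (rule chart_preimage_open[OF S at(1) U(1)])
    have smf: "smooth_on (snd e ` (fst e \<inter> ?U)) (?f \<circ> chart_inv e)" if e: "e \<in> atlas S" for e
    proof -
      have "smooth_on (overlap e d id) (snd d \<circ> chart_inv e)"
        using overlap_smooth[OF smooth_map_id[OF S] e at(1)] by simp
      then have "smooth_on (snd e ` (fst e \<inter> ?U)) (snd d \<circ> chart_inv e)"
        by (rule smooth_on_subset) (auto simp: overlap_def)
      then have "smooth_on (snd e ` (fst e \<inter> ?U)) (f \<circ> (snd d \<circ> chart_inv e))"
        by (rule smooth_on_compose_open[OF _ f]) (auto simp: chart_inv_chart[OF S e])
      then show ?thesis by (simp add: comp_assoc)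
    qed
    have "?K q = differential S M id q (anchor S (restrict_bivector M P S) q (function_differential S ?f q))"
      if q: "q \<in> ?U" for q
    proof -
      let ?y = "snd d q"
      have qd: "q \<in> fst d" and yU: "?y \<in> U" using q by auto
      have dq: "d \<in> charts_at S q" using at(1) qd by (simp add: charts_at_def)
      obtain q' where q': "q' \<in> fst d" "q' \<in> fst c" "coord_proj ?E ?y = snd d q'" "i ?y = snd c q'"
        using V U(3) yU by blast
      have "snd d q = snd d q'" using proj[OF chart_in_span[OF S dq]] q'(3) by simp
      then have "q = q'" using chart_inj[OF S at(1)] qd q'(1) by (auto dest: inj_onD)
      then have qc: "q \<in> fst c" and iy: "i ?y = snd c q" using q' by auto
      note ch = charts[OF qd qc]
      have qM: "q \<in> carrier M" using ch(3) SM by blast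
      \<comment> \<open>A covector on \<open>M\<close> which the anchor sends to the fundamental field and whose pullback to the leaf
        is the differential of the Hamiltonian.\<close>
      let ?\<alpha> = "coord_covector M c q (\<eta> ?y)"
      have anc: "anchor M P q ?\<alpha> = ?K q"
      proof (rule tangent_eqI[OF _ fundamental_field_tangent[OF qM] ch(2)])
        note cv = coord_vector_tangent[OF M ch(2) bivector_matrix_in_span]
        show "anchor M P q ?\<alpha> \<in> tangent_space M q" unfolding anchor_coords[OF M bf ch(2)] by (rule cv)
        show "anchor M P q ?\<alpha> c = ?K q c"
          unfolding anchor_coords[OF M bf ch(2)] cv fundamental_field_chart[OF ch(2)]
          using A\<eta>[OF yU] unfolding iy Aq[OF qc] \<kappa>_def .
      qed
      obtain v where v: "v \<in> tangent_space S q" "differential S M id q v = ?K q"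
        using K[OF ch(3)] unfolding image[OF ch(3), symmetric] by (metis imageE)
      note imm = immersion_coords[OF M S \<iota> inj[OF ch(3)] ch(2,1), folded i_def]
      have "function_differential S ?f q = pullback_covector S M id q ?\<alpha>"
      proof
        fix w
        show "function_differential S ?f q w = pullback_covector S M id q ?\<alpha> w"
        proof (cases "w \<in> tangent_space S q")
          case True
          have "function_differential S ?f q w = dir_deriv (?f \<circ> chart_inv d) ?y (w d)"
            by (rule function_differential_chart[OF S opU q dq smf[OF at(1)] True])
          also have "\<dots> = dir_deriv f ?y (w d)"
          proof (rule dir_deriv_cong[OF chart_image_open[OF S at(1) opU] _ _ tangent_in_span[OF True dq]])
            show "?y \<in> snd d ` (fst d \<inter> ?U)" using q by blast
            show "(?f \<circ> chart_inv d) z = f z" if "z \<in> snd d ` (fst d \<inter> ?U)" for z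
              using that chart_inv_chart[OF S at(1)] by auto
          qed
          also have "\<dots> = D f ?y (w d)"
          proof -
            have "((\<lambda>t. f (?y + t *\<^sub>R w d)) has_vector_derivative D f (?y + 0 *\<^sub>R w d) (w d)) (at 0)"
              by (rule has_vector_derivative_D_line[OF f]) (use yU in simp)
            then show ?thesis unfolding dir_deriv_def by (simp add: vector_derivative_at)
          qed
          also have "\<dots> = \<eta> ?y \<bullet> D i ?y (w d)" by (simp add: D_eqI[OF df[OF yU]])
          also have "\<dots> = differential S M id q w c \<bullet> \<eta> ?y" unfolding imm(3)[OF True] by (rule inner_commute)
          also have "\<dots> = pullback_covector S M id q ?\<alpha> w"
          proof -
            have "differential S M id q w \<in> tangent_space M q"
              using differential_tangent[OF S M \<iota> ch(3) True] by (simp only: id_apply)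
            then show ?thesis using True by (simp only: pullback_covector_def coord_covector_def if_True)
          qed
          finally show ?thesis .
        next
          case False
          then show ?thesis by (simp add: function_differential_def Let_def pullback_covector_def)
        qed
      qed
      moreover have "anchor S (restrict_bivector M P S) q (pullback_covector S M id q ?\<alpha>) = v"
        by (rule leaf_anchor[OF M S \<iota> bf ch(3) qM inj[OF ch(3)] image[OF ch(3)]
              coord_covector_cotangent[OF M] v(1)]) (simp only: v(2) anc)
      ultimately show ?thesis using v(2) by (simp only:)
    qed
    moreover have "smooth_function S ?U ?f" unfolding smooth_function_def using smf by blast
    moreover have "p \<in> ?U" using at U by simp
    ultimately show ?thesis using opU by (intro exI[of _ ?U] exI[of _ ?f] conjI ballI)
  qed
  then show ?thesis
    unfolding locally_hamiltonian_def using K image by (intro conjI ballI) (simp_all only:)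
qed

end
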